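(* Let $L$ be an integro-differential operator in the class $\mathcal L_1$ with $\sigma\ge\sigma_0>1$. Suppose $u$ belongs to the weighted space $L^1(\mathbb R^n,\frac1{1+|y|^\sigma})$ and solves $Lu=f$ in $B_1$ for some $f\in L^2$. Let $L'$ be an operator in $\mathcal L_0$. Then $L'u\in L^2(B_{1/2})$ and \[\|L'u\|_{L^2(B_{1/2})}\le C\Big(\|u\|_{L^1(\mathbb R^n,\frac1{1+|y|^\sigma})}+\|f\|_{L^2(B_1)}\Big)\] for a constant $C$ depending on $n,\lambda,\Lambda$ and $\sigma_0$.
   Context: Fix $n\ge1$, $\sigma\in(0,2)$, $0<\lambda\le\Lambda$. For $u$ on $\mathbb R^n$, $\delta u(x,y)=u(x+y)+u(x-y)-2u(x)$. A linear operator $Lu(x)=\int_{\mathbb R^n}\delta u(x,y)K(y)\,dy$ belongs to $\mathcal L_0$ if $(2-\sigma)\lambda|y|^{-n-\sigma}\le K(y)\le(2-\sigma)\Lambda|y|^{-n-\sigma}$ for $y\ne0$, and to $\mathcal L_1$ if moreover $K$ is $C^1$ away from $0$ with $|\nabla K(y)|\le C_1|y|^{-n-1-\sigma}$ for a fixed constant $C_1$. The weighted norm is $\|u\|_{L^1(\mathbb R^n,\frac1{1+|y|^\sigma})}=\int_{\mathbb R^n}\frac{|u(y)|}{1+|y|^\sigma}dy$. $B_r$ is the ball of radius $r$ centered at $0$. *)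

theory Defs
  imports "HOL-Analysis.Analysis"
begin

definition sdiff :: "('a::real_normed_vector \<Rightarrow> real) \<Rightarrow> 'a \<Rightarrow> 'a \<Rightarrow> real" where
  "sdiff u x y = u (x + y) + u (x - y) - 2 * u x"

definition intop :: "('a::euclidean_space \<Rightarrow> real) \<Rightarrow> ('a \<Rightarrow> real) \<Rightarrow> 'a \<Rightarrow> real" where
  "intop K u x = (LINT y|lebesgue. sdiff u x y * K y)"

definition class_L0 :: "real \<Rightarrow> real \<Rightarrow> real \<Rightarrow> ('a::euclidean_space \<Rightarrow> real) \<Rightarrow> bool" where
  "class_L0 \<sigma> lam Lam K \<longleftrightarrow> K \<in> borel_measurable lebesgue \<and>
     (\<forall>y. y \<noteq> 0 \<longrightarrow>
        (2 - \<sigma>) * lam / norm y powr (real DIM('a) + \<sigma>) \<le> K y \<and>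
        K y \<le> (2 - \<sigma>) * Lam / norm y powr (real DIM('a) + \<sigma>))"

definition class_L1 :: "real \<Rightarrow> real \<Rightarrow> real \<Rightarrow> real \<Rightarrow> ('a::euclidean_space \<Rightarrow> real) \<Rightarrow> bool" where
  "class_L1 C1 \<sigma> lam Lam K \<longleftrightarrow> class_L0 \<sigma> lam Lam K \<and>
     (\<exists>G :: 'a \<Rightarrow> 'a.
        (\<forall>y. y \<noteq> 0 \<longrightarrow> (K has_derivative (\<lambda>h. G y \<bullet> h)) (at y)) \<and>
        continuous_on (UNIV - {0}) G \<and>
        (\<forall>y. y \<noteq> 0 \<longrightarrow> norm (G y) \<le> C1 / norm y powr (real DIM('a) + 1 + \<sigma>)))"

coinductive smooth :: "('a::euclidean_space \<Rightarrow> real) \<Rightarrow> bool" where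
  "(\<And>x. f differentiable (at x)) \<Longrightarrow>
   (\<And>v. smooth (\<lambda>x. frechet_derivative f (at x) v)) \<Longrightarrow> smooth f"

definition test_fun :: "real \<Rightarrow> ('a::euclidean_space \<Rightarrow> real) \<Rightarrow> bool" where
  "test_fun r \<phi> \<longleftrightarrow> smooth \<phi> \<and> compact (closure {x. \<phi> x \<noteq> 0}) \<and>
      closure {x. \<phi> x \<noteq> 0} \<subseteq> ball 0 r"

definition wnorm :: "real \<Rightarrow> ('a::euclidean_space \<Rightarrow> real) \<Rightarrow> real" where
  "wnorm \<sigma> u = (LINT y|lebesgue. \<bar>u y\<bar> / (1 + norm y powr \<sigma>))"

definition in_wL1 :: "real \<Rightarrow> ('a::euclidean_space \<Rightarrow> real) \<Rightarrow> bool" where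
  "in_wL1 \<sigma> u \<longleftrightarrow> u \<in> borel_measurable lebesgue \<and>
      integrable lebesgue (\<lambda>y. \<bar>u y\<bar> / (1 + norm y powr \<sigma>))"

definition in_L2_on :: "'a::euclidean_space set \<Rightarrow> ('a \<Rightarrow> real) \<Rightarrow> bool" where
  "in_L2_on S g \<longleftrightarrow> set_borel_measurable lebesgue S g \<and>
      set_integrable lebesgue S (\<lambda>x. (g x)\<^sup>2)"

definition L2_norm_on :: "'a::euclidean_space set \<Rightarrow> ('a \<Rightarrow> real) \<Rightarrow> real" where
  "L2_norm_on S g = sqrt (LINT x:S|lebesgue. (g x)\<^sup>2)"

text \<open>Distributional solution of  L_K u = f  in B_r (L_K is symmetric).\<close>
definition dist_solves :: "('a::euclidean_space \<Rightarrow> real) \<Rightarrow> ('a \<Rightarrow> real) \<Rightarrow> real \<Rightarrow> ('a \<Rightarrow> real) \<Rightarrow> bool" where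
  "dist_solves K u r f \<longleftrightarrow> (\<forall>\<phi>. test_fun r \<phi> \<longrightarrow>
      integrable lebesgue (\<lambda>x. u x * intop K \<phi> x) \<and>
      (LINT x|lebesgue. u x * intop K \<phi> x) = (LINT x:ball 0 r|lebesgue. f x * \<phi> x))"

end

theory Submission
  imports Defs
begin

text \<open>The quadratic form of an operator is the integral of \<open>(v (x + y) - v x)\<^sup>2 K y\<close>, so two
  kernels of comparable size have comparable forms; since the operators commute with
  translations, this gives the comparison of their \<open>L\<^sup>2\<close> norms without Fourier transform.
  Multiplying by a cutoff produces a remainder controlled by the form itself, that is by
  \<open>\<parallel>v\<parallel> \<parallel>L v\<parallel>\<close>, and a Nash-type inequality bounds \<open>\<parallel>v\<parallel>\<close> by a small multiple of \<open>\<parallel>L v\<parallel>\<close> plus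
  the \<open>L\<^sup>1\<close> norm.  Along a sequence of growing cutoffs the term \<open>\<parallel>L v\<parallel>\<close> is absorbed, which is
  an a priori estimate for mollified solutions.  It passes to the limit in weak form, and the Riesz
  representation theorem in \<open>L\<^sup>2\<close> yields \<open>L' u\<close>.  The values of \<open>u\<close> outside the unit ball enter
  only through a bounded right-hand side.\<close>

text \<open>Two obstacles shape the estimates. First, no constant may blow up as \<sigma> tends to
  2. The factor 2 - \<sigma> in the upper kernel bound pays for the mass of the singularity; the
  same factor in the lower bound is recovered by measuring the energy on one dyadic shell only.
  Second, each cutoff estimate returns a term of the same kind on a larger ball. Absorbing it along
  infinitely many cutoffs needs only a finite starting bound with geometric growth, so the
  regularity of mollified solutions is used qualitatively and never enters the constant. The radii
  fit together as follows. The equation is tested in the ball of radius 7/8, at distance 1/8 from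
  the exterior values. Mollifying at scale below 1/8 gives a pointwise equation for |x| < 3/4, which
  contains the supports of all cutoffs. The innermost cutoff is 1 on a ball of radius above 27/50,
  so what it cuts off stays at distance 1/25 from the test functions of L', supported in radius
  1/2.\<close>

lemma nn_integral_lborel_affine:
  fixes t :: "'a::euclidean_space"
  assumes [measurable]: "f \<in> borel_measurable borel" and c: "c \<noteq> 0"
  shows "(\<integral>\<^sup>+x. f x \<partial>lborel) = \<bar>c\<bar> ^ DIM('a) * (\<integral>\<^sup>+x. f (t + c *\<^sub>R x) \<partial>lborel)"
  by (subst lborel_affine[OF c, of t])
     (simp add: nn_integral_density nn_integral_distr nn_integral_cmult ennreal_power)

lemma integrable_lborel_affine:
  fixes f :: "'a::euclidean_space \<Rightarrow> real"
  assumes f: "integrable lborel f" and c: "c \<noteq> 0"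
  shows "integrable lborel (\<lambda>x. f (t + c *\<^sub>R x))"
proof -
  have [measurable]: "f \<in> borel_measurable borel" using f by auto
  show ?thesis
    using f c unfolding integrable_iff_bounded
    by (subst (asm) nn_integral_lborel_affine[where c=c and t=t])
       (auto simp: ennreal_mult_less_top)
qed

lemma integral_lborel_affine:
  fixes f :: "'a::euclidean_space \<Rightarrow> real"
  assumes c: "c \<noteq> 0" and [measurable]: "f \<in> borel_measurable borel"
  shows "(LBINT x. f x) = \<bar>c\<bar> ^ DIM('a) * (LBINT x. f (t + c *\<^sub>R x))"
  by (subst lborel_affine[OF c, of t])
     (simp add: integral_density integral_distr)

lemma integral_lborel_shift:
  fixes f :: "'a::euclidean_space \<Rightarrow> real"
  assumes "f \<in> borel_measurable borel"
  shows "(LBINT x. f (x + t)) = (LBINT x. f x)"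
    and "(LBINT x. f (t + x)) = (LBINT x. f x)"
    and "(LBINT x. f (x - t)) = (LBINT x. f x)"
    and "(LBINT x. f (t - x)) = (LBINT x. f x)"
  using integral_lborel_affine[OF _ assms, of 1 t] integral_lborel_affine[OF _ assms, of 1 "- t"]
    integral_lborel_affine[OF _ assms, of "-1" t]
  by (simp_all add: add.commute)

lemma integrable_lborel_shift:
  fixes f :: "'a::euclidean_space \<Rightarrow> real"
  assumes "integrable lborel f"
  shows "integrable lborel (\<lambda>x. f (x + t))"
    and "integrable lborel (\<lambda>x. f (t + x))"
    and "integrable lborel (\<lambda>x. f (x - t))"
    and "integrable lborel (\<lambda>x. f (t - x))"
  using integrable_lborel_affine[OF assms, of 1 t] integrable_lborel_affine[OF assms, of 1 "- t"]
    integrable_lborel_affine[OF assms, of "-1" t]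
  by (simp_all add: add.commute)

section \<open>Square-integrable functions\<close>

definition L2_in :: "'b measure \<Rightarrow> ('b \<Rightarrow> real) \<Rightarrow> bool" where
  "L2_in M f \<longleftrightarrow> f \<in> borel_measurable M \<and> integrable M (\<lambda>x. (f x)\<^sup>2)"

definition norm2 :: "'b measure \<Rightarrow> ('b \<Rightarrow> real) \<Rightarrow> real" where
  "norm2 M f = sqrt (\<integral>x. (f x)\<^sup>2 \<partial>M)"

abbreviation L2 :: "('a::euclidean_space \<Rightarrow> real) \<Rightarrow> bool" where
  "L2 \<equiv> L2_in lborel"

abbreviation l2 :: "('a::euclidean_space \<Rightarrow> real) \<Rightarrow> real" where
  "l2 \<equiv> norm2 lborel"

abbreviation l1 :: "('a::euclidean_space \<Rightarrow> real) \<Rightarrow> real" where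
  "l1 v \<equiv> (LBINT x. \<bar>v x\<bar>)"

lemma L2D[dest]: "L2_in M f \<Longrightarrow> f \<in> borel_measurable M" "L2_in M f \<Longrightarrow> integrable M (\<lambda>x. (f x)\<^sup>2)"
  by (auto simp: L2_in_def)

lemma l2_nonneg[simp]: "0 \<le> norm2 M f"
  by (simp add: norm2_def)

lemma l2_sq: "(norm2 M f)\<^sup>2 = (\<integral>x. (f x)\<^sup>2 \<partial>M)"
  by (simp add: norm2_def)

lemma L2_bound:
  assumes "L2_in M g" "f \<in> borel_measurable M" "AE x in M. \<bar>f x\<bar> \<le> \<bar>g x\<bar>"
  shows "L2_in M f" "norm2 M f \<le> norm2 M g"
proof -
  have le: "AE x in M. (f x)\<^sup>2 \<le> (g x)\<^sup>2"
    using assms(3) by eventually_elim (simp add: abs_le_square_iff)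
  show f: "L2_in M f"
    unfolding L2_in_def
  proof
    show "integrable M (\<lambda>x. (f x)\<^sup>2)"
      using assms(1,2) le by (intro Bochner_Integration.integrable_bound[OF L2D(2)[OF assms(1)]]) auto
  qed fact
  show "norm2 M f \<le> norm2 M g"
    unfolding norm2_def using assms(1) f le by (intro real_sqrt_le_mono integral_mono_AE) auto
qed

lemma L2_scale: "L2_in M f \<Longrightarrow> L2_in M (\<lambda>x. c * f x)"
  by (auto simp: L2_in_def power_mult_distrib)

lemma l2_scale: "norm2 M (\<lambda>x. c * f x) = \<bar>c\<bar> * norm2 M f"
  by (simp add: norm2_def power_mult_distrib real_sqrt_mult)

lemma L2_mult_integrable:
  assumes "L2_in M f" "L2_in M g" shows "integrable M (\<lambda>x. f x * g x)"
proof (rule Bochner_Integration.integrable_bound[of M "\<lambda>x. (f x)\<^sup>2 + (g x)\<^sup>2"])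
  have "\<bar>f x * g x\<bar> \<le> (f x)\<^sup>2 + (g x)\<^sup>2" for x
  proof -
    have "2 * (\<bar>f x\<bar> * \<bar>g x\<bar>) \<le> (f x)\<^sup>2 + (g x)\<^sup>2"
      using sum_squares_bound[of "\<bar>f x\<bar>" "\<bar>g x\<bar>"] by simp
    moreover have "0 \<le> \<bar>f x\<bar> * \<bar>g x\<bar>" by simp
    ultimately show ?thesis unfolding abs_mult by linarith
  qed
  then show "AE x in M. norm (f x * g x) \<le> norm ((f x)\<^sup>2 + (g x)\<^sup>2)" by simp
qed (use assms in \<open>auto simp: L2_in_def\<close>)

lemma L2_add: assumes "L2_in M f" "L2_in M g" shows "L2_in M (\<lambda>x. f x + g x)"
  using assms L2_mult_integrable[OF assms] unfolding L2_in_def power2_sum mult.assoc by auto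

lemma L2_diff: assumes "L2_in M f" "L2_in M g" shows "L2_in M (\<lambda>x. f x - g x)"
  using assms L2_mult_integrable[OF assms] unfolding L2_in_def power2_diff mult.assoc by auto

lemma L2_abs: "L2_in M f \<Longrightarrow> L2_in M (\<lambda>x. \<bar>f x\<bar>)"
  by (auto simp: L2_in_def)

lemma l2_abs[simp]: "norm2 M (\<lambda>x. \<bar>f x\<bar>) = norm2 M f"
  by (simp add: norm2_def)

text \<open>Evaluating the form at (b, c) gives b (a b - c^2). Both variables are kept so that the
  degenerate case b = 0 is covered. It yields Cauchy-Schwarz for \<open>norm2\<close> and, in
  \<open>product_remainder\<close>, for integrals in y with weight K.\<close>

lemma discriminant_le:
  fixes a b c :: real
  assumes q: "\<And>s t. 0 \<le> s\<^sup>2 * a - 2 * s * t * c + t\<^sup>2 * b" and ab: "0 \<le> b"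
  shows "c\<^sup>2 \<le> a * b"
proof (cases "b = 0")
  case True
  show ?thesis
  proof (rule ccontr)
    assume "\<not> c\<^sup>2 \<le> a * b"
    with True have "c \<noteq> 0" by auto
    \<comment> \<open>At this pair the form equals a - (a + 1) = -1.\<close>
    then show False using q[of 1 "(a + 1) / (2 * c)"] True by simp
  qed
next
  case False
  have "0 \<le> b * (a * b - c\<^sup>2)"
    using q[of b c] by (simp add: power2_eq_square algebra_simps)
  with False ab show ?thesis by (simp add: zero_le_mult_iff)
qed

lemma l2_Cauchy_Schwarz:
  assumes "L2_in M f" "L2_in M g"
  shows "\<bar>\<integral>x. f x * g x \<partial>M\<bar> \<le> norm2 M f * norm2 M g"
proof -
  define a b c where "a = (\<integral>x. (f x)\<^sup>2 \<partial>M)" and "b = (\<integral>x. (g x)\<^sup>2 \<partial>M)" and "c = (\<integral>x. f x * g x \<partial>M)"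
  have "c\<^sup>2 \<le> a * b"
  proof (rule discriminant_le)
    fix s t :: real
    have "0 \<le> (\<integral>x. (s * f x - t * g x)\<^sup>2 \<partial>M)" by simp
    also have "\<dots> = (\<integral>x. s\<^sup>2 * (f x)\<^sup>2 - 2 * s * t * (f x * g x) + t\<^sup>2 * (g x)\<^sup>2 \<partial>M)"
      by (rule Bochner_Integration.integral_cong) (auto simp: power2_eq_square algebra_simps)
    also have "\<dots> = s\<^sup>2 * a - 2 * s * t * c + t\<^sup>2 * b"
      using assms L2_mult_integrable[OF assms] by (simp add: a_def b_def c_def L2_in_def)
    finally show "0 \<le> s\<^sup>2 * a - 2 * s * t * c + t\<^sup>2 * b" .
  qed (simp add: b_def)
  then have "sqrt (c\<^sup>2) \<le> sqrt (a * b)" by (rule real_sqrt_le_mono)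
  then show ?thesis by (simp add: norm2_def a_def b_def c_def real_sqrt_mult)
qed

lemma l2_sum_le:
  assumes "L2_in M f" "L2_in M g"
  shows "norm2 M (\<lambda>x. f x + g x) \<le> norm2 M f + norm2 M g"
proof (rule power2_le_imp_le)
  have "(norm2 M (\<lambda>x. f x + g x))\<^sup>2 = (\<integral>x. (f x)\<^sup>2 + (g x)\<^sup>2 + 2 * (f x * g x) \<partial>M)"
    by (simp add: l2_sq power2_sum mult.assoc)
  also have "\<dots> = (norm2 M f)\<^sup>2 + (norm2 M g)\<^sup>2 + 2 * (\<integral>x. f x * g x \<partial>M)"
    using assms L2_mult_integrable[OF assms] by (simp add: l2_sq L2_in_def)
  also have "\<dots> \<le> (norm2 M f + norm2 M g)\<^sup>2"
    using l2_Cauchy_Schwarz[OF assms] by (simp add: power2_sum)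
  finally show "(norm2 M (\<lambda>x. f x + g x))\<^sup>2 \<le> (norm2 M f + norm2 M g)\<^sup>2" .
qed simp

lemma l2_diff_le:
  assumes "L2_in M f" "L2_in M g"
  shows "norm2 M (\<lambda>x. f x - g x) \<le> norm2 M f + norm2 M g"
  using l2_sum_le[OF assms(1) L2_scale[OF assms(2), of "-1"]] l2_scale[of M "-1" g] by simp

text \<open>Along a sequence that is Cauchy at geometric speed, the increments are summable almost
  everywhere, since \<open>d\<^sub>k \<le> (1/2)\<^sup>k + 2\<^sup>k d\<^sub>k\<^sup>2\<close>; Fatou's lemma then identifies the limit.\<close>

lemma L2_complete_fast:
  assumes f: "\<And>k. L2_in M (f k)" and d: "\<And>k. norm2 M (\<lambda>x. f (Suc k) x - f k x) \<le> (1/2)^k"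
  shows "\<exists>g. L2_in M g \<and> (\<lambda>k. norm2 M (\<lambda>x. g x - f k x)) \<longlonglongrightarrow> 0"
proof -
  have [measurable]: "f k \<in> borel_measurable M" for k using f by auto
  have L2d: "L2_in M (\<lambda>x. f j x - f k x)" for j k by (intro L2_diff f)
  have "(\<integral>\<^sup>+x. (\<Sum>k. ennreal (2^k * (f (Suc k) x - f k x)\<^sup>2)) \<partial>M)
      = (\<Sum>k. \<integral>\<^sup>+x. ennreal (2^k * (f (Suc k) x - f k x)\<^sup>2) \<partial>M)"
    by (rule nn_integral_suminf) measurable
  also have "\<dots> \<le> (\<Sum>k. ennreal ((1/2)^k))"
  proof (intro suminf_le summableI)
    fix k
    have "(\<integral>\<^sup>+x. ennreal (2^k * (f (Suc k) x - f k x)\<^sup>2) \<partial>M)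
        = ennreal (2^k * (norm2 M (\<lambda>x. f (Suc k) x - f k x))\<^sup>2)"
      using L2d[of "Suc k" k] by (subst nn_integral_eq_integral) (auto simp: l2_sq L2_in_def)
    also have "\<dots> \<le> ennreal (2^k * ((1/2)^k)\<^sup>2)"
      using d[of k] by (intro ennreal_leI mult_left_mono power_mono) auto
    also have "2^k * ((1/2)^k)\<^sup>2 = ((1/2)^k :: real)"
      by (simp add: power2_eq_square power_divide)
    finally show "(\<integral>\<^sup>+x. ennreal (2^k * (f (Suc k) x - f k x)\<^sup>2) \<partial>M) \<le> ennreal ((1/2)^k)" .
  qed
  also have "\<dots> = ennreal (\<Sum>k. (1/2)^k)"
    by (subst suminf_ennreal2) (auto intro: summable_geometric)
  finally have "(\<integral>\<^sup>+x. (\<Sum>k. ennreal (2^k * (f (Suc k) x - f k x)\<^sup>2)) \<partial>M) \<noteq> \<infinity>"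
    by (auto simp: top_unique)
  then have "AE x in M. (\<Sum>k. ennreal (2^k * (f (Suc k) x - f k x)\<^sup>2)) \<noteq> \<infinity>"
    by (intro nn_integral_PInf_AE) auto
  then have conv: "AE x in M. convergent (\<lambda>k. f k x)"
  proof eventually_elim
    case (elim x)
    have s: "summable (\<lambda>k. 2^k * (f (Suc k) x - f k x)\<^sup>2)"
      using elim by (intro summable_suminf_not_top) auto
    have "summable (\<lambda>k. f (Suc k) x - f k x)"
    proof (rule summable_comparison_test')
      show "summable (\<lambda>k. (1/2)^k + 2^k * (f (Suc k) x - f k x)\<^sup>2)"
        by (intro summable_add s summable_geometric) simp
      fix k :: nat
      let ?e = "\<bar>f (Suc k) x - f k x\<bar>"
      have "?e \<le> 1 / 2^k + 2^k * ?e\<^sup>2"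
      proof (cases "?e \<le> 1/2^k")
        case True then show ?thesis by (smt (verit) mult_nonneg_nonneg zero_le_power2 zero_le_power)
      next
        case False
        then have "1 \<le> 2^k * ?e" by (simp add: field_simps)
        then have "?e \<le> (2^k * ?e) * ?e" using mult_right_mono[of 1 "2^k * ?e" ?e] by simp
        then show ?thesis by (simp add: power2_eq_square add_nonneg_nonneg mult.assoc add_increasing)
      qed
      then show "norm (f (Suc k) x - f k x) \<le> (1/2)^k + 2^k * (f (Suc k) x - f k x)\<^sup>2"
        by (simp add: power_divide)
    qed
    then have "convergent (\<lambda>n. \<Sum>k<n. f (Suc k) x - f k x)"
      by (simp only: summable_iff_convergent)
    then have "convergent (\<lambda>n. f n x - f 0 x)"
      by (simp only: sum_lessThan_telescope[of "\<lambda>k. f k x"])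
    then show ?case
      using convergent_diff_const_right_iff[of "\<lambda>n. f n x" "f 0 x"] by simp
  qed
  define g where "g x = lim (\<lambda>k. f k x)" for x
  have g[measurable]: "g \<in> borel_measurable M"
    unfolding g_def by (rule borel_measurable_lim_metric) measurable
  have lim: "AE x in M. (\<lambda>k. f k x) \<longlonglongrightarrow> g x"
    using conv by eventually_elim (simp add: g_def convergent_LIMSEQ_iff)
  have dist: "norm2 M (\<lambda>x. f (m + k) x - f k x) \<le> 2 * (1/2)^k" for m k
  proof -
    have "norm2 M (\<lambda>x. f (m + k) x - f k x) \<le> (\<Sum>i<m. (1/2)^(i + k))"
    proof (induction m)
      case 0 then show ?case by (simp add: norm2_def)
    next
      case (Suc m)
      have "norm2 M (\<lambda>x. f (Suc m + k) x - f k x)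
          \<le> norm2 M (\<lambda>x. f (m + k) x - f k x) + norm2 M (\<lambda>x. f (Suc (m + k)) x - f (m + k) x)"
        using l2_sum_le[OF L2d[of "m+k" k] L2d[of "Suc (m+k)" "m+k"]] by simp
      with Suc d[of "m + k"] show ?case by simp
    qed
    also have "\<dots> = (1/2)^k * (\<Sum>i<m. (1/2)^i)"
      by (simp add: sum_distrib_left power_add mult.commute)
    also have "\<dots> \<le> (1/2)^k * 2"
      by (intro mult_left_mono) (auto simp: sum_gp_strict)
    finally show ?thesis by simp
  qed
  have fatou: "(\<integral>\<^sup>+x. ennreal ((g x - f k x)\<^sup>2) \<partial>M) \<le> ennreal ((2 * (1/2)^k)\<^sup>2)" for k
  proof -
    have "(\<integral>\<^sup>+x. ennreal ((g x - f k x)\<^sup>2) \<partial>M)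
        = (\<integral>\<^sup>+x. liminf (\<lambda>m. ennreal ((f (m + k) x - f k x)\<^sup>2)) \<partial>M)"
    proof (rule nn_integral_cong_AE, use lim in eventually_elim)
      case (elim x)
      have "(\<lambda>m. ennreal ((f (m + k) x - f k x)\<^sup>2)) \<longlonglongrightarrow> ennreal ((g x - f k x)\<^sup>2)"
        by (intro tendsto_intros LIMSEQ_ignore_initial_segment elim)
      then show ?case by (intro lim_imp_Liminf[symmetric]) auto
    qed
    also have "\<dots> \<le> liminf (\<lambda>m. \<integral>\<^sup>+x. ennreal ((f (m + k) x - f k x)\<^sup>2) \<partial>M)"
      by (rule nn_integral_liminf) measurable
    also have "\<dots> \<le> ennreal ((2 * (1/2)^k)\<^sup>2)"
    proof (rule Liminf_le[OF _ always_eventually])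
      show "\<forall>m. (\<integral>\<^sup>+x. ennreal ((f (m + k) x - f k x)\<^sup>2) \<partial>M) \<le> ennreal ((2 * (1/2)^k)\<^sup>2)"
      proof
        fix m
        show "(\<integral>\<^sup>+x. ennreal ((f (m + k) x - f k x)\<^sup>2) \<partial>M) \<le> ennreal ((2 * (1/2)^k)\<^sup>2)"
          using L2d[of "m+k" k] power_mono[OF dist[of m k], of 2]
          by (subst nn_integral_eq_integral) (auto simp: L2_in_def l2_sq[symmetric] intro!: ennreal_leI)
      qed
    qed simp
    finally show ?thesis .
  qed
  have L2gf: "L2_in M (\<lambda>x. g x - f k x)" for k
    unfolding L2_in_def using order.strict_trans1[OF fatou[of k] ennreal_less_top]
    by (auto intro!: integrableI_bounded)
  have le: "norm2 M (\<lambda>x. g x - f k x) \<le> 2 * (1/2)^k" for k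
  proof (rule power2_le_imp_le)
    have "ennreal ((norm2 M (\<lambda>x. g x - f k x))\<^sup>2) \<le> ennreal ((2 * (1/2)^k)\<^sup>2)"
      using fatou[of k] L2gf[of k] by (subst (asm) nn_integral_eq_integral) (auto simp: L2_in_def l2_sq)
    then show "(norm2 M (\<lambda>x. g x - f k x))\<^sup>2 \<le> (2 * (1/2)^k)\<^sup>2"
      by (subst (asm) ennreal_le_iff) auto
  qed simp
  have "L2_in M g" using L2_add[OF L2gf[of 0] f[of 0]] by simp
  moreover have "(\<lambda>k. norm2 M (\<lambda>x. g x - f k x)) \<longlonglongrightarrow> 0"
  proof (rule tendsto_sandwich[OF _ _ tendsto_const])
    show "(\<lambda>k. 2 * (1/2)^k) \<longlonglongrightarrow> (0::real)"
      by (intro tendsto_mult_right_zero LIMSEQ_power_zero) simp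
  qed (use le in auto)
  ultimately show ?thesis by blast
qed

text \<open>V is just a linear space of square-integrable functions, neither closed nor dense.
  Minimising \<open>J \<phi> = \<parallel>\<phi>\<parallel>^2 / 2 - l \<phi>\<close> over V gives a
  Cauchy sequence by the parallelogram identity; its limit lies in the closure of V, which is why
  the norm of g is bounded by A, and the Euler-Lagrange equation in directions of V is the
  representation.\<close>

theorem L2_riesz:
  fixes l :: "('b \<Rightarrow> real) \<Rightarrow> real"
  assumes V: "\<And>\<phi>. \<phi> \<in> V \<Longrightarrow> L2_in M \<phi>" and ne: "V \<noteq> {}"
    and lin: "\<And>\<phi> \<psi> c. \<phi> \<in> V \<Longrightarrow> \<psi> \<in> V \<Longrightarrow> (\<lambda>x. \<phi> x + c * \<psi> x) \<in> V"
    and l_lin: "\<And>\<phi> \<psi> c. \<phi> \<in> V \<Longrightarrow> \<psi> \<in> V \<Longrightarrow> l (\<lambda>x. \<phi> x + c * \<psi> x) = l \<phi> + c * l \<psi>"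
    and l_le: "\<And>\<phi>. \<phi> \<in> V \<Longrightarrow> \<bar>l \<phi>\<bar> \<le> A * norm2 M \<phi>" and A: "0 \<le> A"
  shows "\<exists>g. L2_in M g \<and> norm2 M g \<le> A \<and> (\<forall>\<phi>\<in>V. (\<integral>x. g x * \<phi> x \<partial>M) = l \<phi>)"
proof -
  define J where "J \<phi> = (norm2 M \<phi>)\<^sup>2 / 2 - l \<phi>" for \<phi>
  have J_line: "J (\<lambda>x. \<phi> x + t * D x) = J \<phi> + t * ((\<integral>x. \<phi> x * D x \<partial>M) - l D) + t\<^sup>2 * (norm2 M D)\<^sup>2 / 2"
    if "\<phi> \<in> V" "D \<in> V" for \<phi> D t
  proof -
    note L = V[OF that(1)] V[OF that(2)] L2_mult_integrable[OF V[OF that(1)] V[OF that(2)]]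
    have "(norm2 M (\<lambda>x. \<phi> x + t * D x))\<^sup>2 = (\<integral>x. (\<phi> x)\<^sup>2 + 2 * t * (\<phi> x * D x) + t\<^sup>2 * (D x)\<^sup>2 \<partial>M)"
      unfolding l2_sq by (rule Bochner_Integration.integral_cong) (auto simp: power2_eq_square algebra_simps)
    also have "\<dots> = (norm2 M \<phi>)\<^sup>2 + 2 * t * (\<integral>x. \<phi> x * D x \<partial>M) + t\<^sup>2 * (norm2 M D)\<^sup>2"
      using L by (simp add: L2_in_def l2_sq)
    finally show ?thesis by (simp add: J_def l_lin[OF that] field_simps)
  qed
  have J_low: "- (A\<^sup>2) / 2 \<le> J \<phi>" if "\<phi> \<in> V" for \<phi>
  proof -
    have "0 \<le> (norm2 M \<phi> - A)\<^sup>2" by simp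
    then show ?thesis using l_le[OF that] by (simp add: J_def power2_diff mult.commute)
  qed
  define m where "m = Inf (J ` V)"
  have bdd: "bdd_below (J ` V)" using J_low by (intro bdd_belowI2)
  have m_le: "m \<le> J \<phi>" if "\<phi> \<in> V" for \<phi>
    unfolding m_def using bdd that by (intro cInf_lower) auto
  \<comment> \<open>Chosen so that 4 (e k + e (k + 1)) = (5/8) (1/4)^k stays below ((1/2)^k)^2, the
    speed that \<open>L2_complete_fast\<close> asks for.\<close>
  define e :: "nat \<Rightarrow> real" where "e k = (1/4)^k / 8" for k
  have "\<exists>\<phi>\<in>V. J \<phi> < m + e k" for k
  proof -
    have "Inf (J ` V) < m + e k" by (simp add: m_def e_def)
    then show ?thesis using ne by (auto dest!: cInf_lessD[rotated])
  qed
  then obtain f where fV: "\<And>k. f k \<in> V" and fJ: "\<And>k. J (f k) < m + e k" by metis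
  have dV: "(\<lambda>x. \<psi> x - \<phi> x) \<in> V" if "\<phi> \<in> V" "\<psi> \<in> V" for \<phi> \<psi>
    using lin[OF that(2,1), of "-1"] by simp
  have close: "norm2 M (\<lambda>x. f (Suc k) x - f k x) \<le> (1/2)^k" for k
  proof (rule power2_le_imp_le)
    let ?D = "\<lambda>x. f (Suc k) x - f k x"
    have D: "?D \<in> V" by (intro dV fV)
    \<comment> \<open>Parallelogram identity: comparing t = 1/2 and t = 1 on the same line
      eliminates the linear term, and the mean of J at the two ends exceeds J at the midpoint by an
      eighth of the squared distance.\<close>
    have "m \<le> J (\<lambda>x. f k x + (1/2) * ?D x)" by (rule m_le[OF lin[OF fV D]])
    moreover have "J (f (Suc k)) = J (\<lambda>x. f k x + 1 * ?D x)" by simp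
    ultimately have "(norm2 M ?D)\<^sup>2 \<le> 4 * (J (f k) - m + (J (f (Suc k)) - m))"
      unfolding J_line[OF fV D] by (simp add: power2_eq_square field_simps)
    also have "\<dots> \<le> 4 * (e k + e (Suc k))" using fJ[of k] fJ[of "Suc k"] by simp
    also have "\<dots> \<le> ((1/2)^k)\<^sup>2" by (simp add: e_def power2_eq_square power_mult_distrib[symmetric])
    finally show "(norm2 M ?D)\<^sup>2 \<le> ((1/2)^k)\<^sup>2" .
  qed simp
  obtain g where g: "L2_in M g" and lim: "(\<lambda>k. norm2 M (\<lambda>x. g x - f k x)) \<longlonglongrightarrow> 0"
    using L2_complete_fast[of M f] V[OF fV] close by blast
  have inner_lim: "(\<lambda>k. \<integral>x. f k x * D x \<partial>M) \<longlonglongrightarrow> (\<integral>x. g x * D x \<partial>M)" if D: "L2_in M D" for D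
  proof (rule LIM_zero_cancel)
    have "\<bar>(\<integral>x. f k x * D x \<partial>M) - (\<integral>x. g x * D x \<partial>M)\<bar> \<le> norm2 M (\<lambda>x. g x - f k x) * norm2 M D" for k
    proof -
      have "(\<integral>x. g x * D x \<partial>M) - (\<integral>x. f k x * D x \<partial>M) = (\<integral>x. (g x - f k x) * D x \<partial>M)"
        using L2_mult_integrable[OF g D] L2_mult_integrable[OF V[OF fV] D, of k]
        by (simp add: left_diff_distrib)
      then show ?thesis
        using l2_Cauchy_Schwarz[OF L2_diff[OF g V[OF fV]] D, of k] by (simp add: abs_minus_commute)
    qed
    moreover have "(\<lambda>k. norm2 M (\<lambda>x. g x - f k x) * norm2 M D) \<longlonglongrightarrow> 0"
      using tendsto_mult_right[OF lim, of "norm2 M D"] by (simp add: mult.commute)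
    ultimately show "(\<lambda>k. (\<integral>x. f k x * D x \<partial>M) - (\<integral>x. g x * D x \<partial>M)) \<longlonglongrightarrow> 0"
      using Lim_null_comparison[of "\<lambda>k. (\<integral>x. f k x * D x \<partial>M) - (\<integral>x. g x * D x \<partial>M)"
          "\<lambda>k. norm2 M (\<lambda>x. g x - f k x) * norm2 M D" sequentially] by simp
  qed
  have rep: "(\<integral>x. g x * D x \<partial>M) = l D" if D: "D \<in> V" for D
  proof (rule ccontr)
    define X where "X = (\<integral>x. g x * D x \<partial>M) - l D"
    define N where "N = (norm2 M D)\<^sup>2"
    assume "(\<integral>x. g x * D x \<partial>M) \<noteq> l D"
    then have X: "X \<noteq> 0" by (simp add: X_def)
    have e_lim: "e \<longlonglongrightarrow> 0"
      unfolding e_def by (intro tendsto_divide_zero LIMSEQ_power_zero) simp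
    \<comment> \<open>The limit of J (f k + t D) - m \<ge> 0 with J (f k) replaced by its bound m +
      e k; the minimum itself need not be attained in V.\<close>
    have "0 \<le> t * X + t\<^sup>2 * N / 2" for t
    proof (rule LIMSEQ_le_const)
      show "(\<lambda>k. e k + t * ((\<integral>x. f k x * D x \<partial>M) - l D) + t\<^sup>2 * N / 2) \<longlonglongrightarrow> t * X + t\<^sup>2 * N / 2"
        unfolding X_def by (rule tendsto_eq_intros e_lim inner_lim[OF V[OF D]] refl | simp)+
      have "0 \<le> e k + t * ((\<integral>x. f k x * D x \<partial>M) - l D) + t\<^sup>2 * N / 2" for k
        using m_le[OF lin[OF fV D, of k t]] fJ[of k] unfolding J_line[OF fV D] N_def by linarith
      then show "\<exists>n0. \<forall>k\<ge>n0. 0 \<le> e k + t * ((\<integral>x. f k x * D x \<partial>M) - l D) + t\<^sup>2 * N / 2"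
        by blast
    qed
    \<comment> \<open>The natural minimiser is -X / N; the added 1 keeps the denominator positive
      when D has norm 0 and still leaves a strictly negative value.\<close>
    from this[of "- X / (N + 1)"] have "0 \<le> - (X\<^sup>2) / (N + 1) + X\<^sup>2 * N / (2 * (N + 1)\<^sup>2)"
      by (simp add: power_divide power2_eq_square mult.commute)
    moreover have "0 \<le> N" by (simp add: N_def)
    moreover have "- (X\<^sup>2) / P + X\<^sup>2 * N / (2 * P\<^sup>2) = - (X\<^sup>2 * (2 * P - N)) / (2 * P\<^sup>2)" if "0 < P" for P
      using that by (simp add: field_simps power2_eq_square)
    ultimately have "0 \<le> - (X\<^sup>2 * (N + 2)) / (2 * (N + 1)\<^sup>2)" by (simp add: algebra_simps)
    then have "X\<^sup>2 * (N + 2) \<le> 0" using \<open>0 \<le> N\<close>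
      by (simp add: divide_le_0_iff)
    moreover have "0 < X\<^sup>2 * (N + 2)" using X \<open>0 \<le> N\<close> by (intro mult_pos_pos) auto
    ultimately show False by simp
  qed
  \<comment> \<open>Since g is the limit of f k in V, its squared norm is the limit of the integrals
    of f k * g = l (f k), and those are at most A times the norm of f k.\<close>
  have "(norm2 M g)\<^sup>2 \<le> A * norm2 M g"
  proof (rule LIMSEQ_le)
    show "(\<lambda>k. \<integral>x. f k x * g x \<partial>M) \<longlonglongrightarrow> (norm2 M g)\<^sup>2"
      using inner_lim[OF g] unfolding l2_sq by (simp add: power2_eq_square)
    show "(\<lambda>k. A * (norm2 M g + norm2 M (\<lambda>x. g x - f k x))) \<longlonglongrightarrow> A * norm2 M g"
      by (rule tendsto_eq_intros lim refl | simp)+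
    have "(\<integral>x. f k x * g x \<partial>M) \<le> A * (norm2 M g + norm2 M (\<lambda>x. g x - f k x))" for k
    proof -
      have "(\<integral>x. f k x * g x \<partial>M) \<le> A * norm2 M (f k)"
        using rep[OF fV[of k]] l_le[OF fV[of k]] by (simp add: mult.commute)
      also have "norm2 M (f k) \<le> norm2 M g + norm2 M (\<lambda>x. g x - f k x)"
        using l2_diff_le[OF g L2_diff[OF g V[OF fV[of k]]]] by simp
      finally show ?thesis using A by (simp add: mult_left_mono)
    qed
    then show "\<exists>N. \<forall>n\<ge>N. (\<integral>x. f n x * g x \<partial>M) \<le> A * (norm2 M g + norm2 M (\<lambda>x. g x - f n x))" by blast
  qed
  then have "norm2 M g \<le> A"
    unfolding power2_eq_square using A l2_nonneg[of M g] by (metis mult_le_cancel_right_pos order_le_less)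
  with g rep show ?thesis by blast
qed

section \<open>Bounded functions with bounded second differences\<close>

text \<open>A derivative-free form of C^{1,1}, with one constant for all bounds. First differences
  are included because the second difference of a product contains products of them. The piecewise
  quadratic cutoffs satisfy it although they are not twice differentiable.\<close>

definition C11 :: "real \<Rightarrow> ('a::euclidean_space \<Rightarrow> real) \<Rightarrow> bool" where
  "C11 M v \<longleftrightarrow> v \<in> borel_measurable borel \<and> (\<forall>x. \<bar>v x\<bar> \<le> M) \<and>
     (\<forall>x y. \<bar>v (x + y) - v x\<bar> \<le> M * norm y) \<and> (\<forall>x y. \<bar>sdiff v x y\<bar> \<le> M * (norm y)\<^sup>2)"

definition bsupp :: "('a::euclidean_space \<Rightarrow> real) \<Rightarrow> bool" where
  "bsupp v \<longleftrightarrow> (\<exists>R. \<forall>x. R < norm x \<longrightarrow> v x = 0)"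

definition C11c :: "('a::euclidean_space \<Rightarrow> real) \<Rightarrow> bool" where
  "C11c v \<longleftrightarrow> (\<exists>M. C11 M v) \<and> bsupp v"

text \<open>The weight in the definition of a Levy measure: second differences are quadratically
  small near y = 0 and merely bounded far away.\<close>

definition trunc_sq :: "'a::euclidean_space \<Rightarrow> real" where
  "trunc_sq y = min 1 ((norm y)\<^sup>2)"

lemma trunc_sq_nonneg[simp]: "0 \<le> trunc_sq y"
  by (simp add: trunc_sq_def)

lemma trunc_sq_measurable[measurable]: "trunc_sq \<in> borel_measurable borel"
  unfolding trunc_sq_def[abs_def] by measurable

lemma sdiff_measurable[measurable]:
  fixes v :: "'a::euclidean_space \<Rightarrow> real"
  assumes [measurable]: "v \<in> borel_measurable borel" "f \<in> borel_measurable M" "g \<in> borel_measurable M"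
  shows "(\<lambda>x. sdiff v (f x) (g x)) \<in> borel_measurable M"
  unfolding sdiff_def by measurable

lemma C11D:
  assumes "C11 M v"
  shows "v \<in> borel_measurable borel" "\<bar>v x\<bar> \<le> M" "\<bar>v (x + y) - v x\<bar> \<le> M * norm y"
    "\<bar>v (x - y) - v x\<bar> \<le> M * norm y" "\<bar>sdiff v x y\<bar> \<le> M * (norm y)\<^sup>2" "0 \<le> M"
proof -
  show "v \<in> borel_measurable borel" "\<bar>v x\<bar> \<le> M" "\<bar>v (x + y) - v x\<bar> \<le> M * norm y" "\<bar>sdiff v x y\<bar> \<le> M * (norm y)\<^sup>2"
    using assms by (auto simp: C11_def)
  have "\<bar>v (x + - y) - v x\<bar> \<le> M * norm (- y)" using assms unfolding C11_def by blast
  then show "\<bar>v (x - y) - v x\<bar> \<le> M * norm y" by simp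
  show "0 \<le> M" using assms abs_ge_zero order_trans unfolding C11_def by blast
qed

lemma C11_sdiff_le:
  assumes "C11 M v" shows "\<bar>sdiff v x y\<bar> \<le> 4 * M * trunc_sq y"
proof -
  note C = C11D[OF assms]
  have "\<bar>sdiff v x y\<bar> \<le> 4 * M" unfolding sdiff_def using C(2)[of "x+y"] C(2)[of "x-y"] C(2)[of x] by arith
  moreover have "\<bar>sdiff v x y\<bar> \<le> 4 * M * (norm y)\<^sup>2"
    using C(5)[of x y] mult_right_mono[of M "4*M" "(norm y)\<^sup>2"] C(6) by linarith
  ultimately show ?thesis by (simp add: trunc_sq_def min_def)
qed

lemma C11_diff_sq_le:
  assumes "C11 M v" shows "(v (x + y) - v x)\<^sup>2 \<le> 4 * M\<^sup>2 * trunc_sq y" "(v (x - y) - v x)\<^sup>2 \<le> 4 * M\<^sup>2 * trunc_sq y"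
proof -
  note C = C11D[OF assms]
  have *: "a\<^sup>2 \<le> 4 * M\<^sup>2 * trunc_sq y" if "\<bar>a\<bar> \<le> 2 * M" "\<bar>a\<bar> \<le> M * norm y" for a
  proof -
    have "\<bar>a\<bar>\<^sup>2 \<le> (2 * M)\<^sup>2" "\<bar>a\<bar>\<^sup>2 \<le> (M * norm y)\<^sup>2" using that by (intro power_mono; simp)+
    then have "a\<^sup>2 \<le> 4 * M\<^sup>2" "a\<^sup>2 \<le> 4 * M\<^sup>2 * (norm y)\<^sup>2"
      using mult_nonneg_nonneg[of "M\<^sup>2" "(norm y)\<^sup>2"] by (simp_all add: power_mult_distrib del: zero_le_mult_iff mult_nonneg_nonneg)
    then show ?thesis by (simp add: trunc_sq_def min_def power_mult_distrib)
  qed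
  show "(v (x + y) - v x)\<^sup>2 \<le> 4 * M\<^sup>2 * trunc_sq y"
    by (rule *[OF _ C(3)]) (use C(2)[of "x+y"] C(2)[of x] in arith)
  show "(v (x - y) - v x)\<^sup>2 \<le> 4 * M\<^sup>2 * trunc_sq y"
    by (rule *[OF _ C(4)]) (use C(2)[of "x-y"] C(2)[of x] in arith)
qed

lemma C11_const: "C11 \<bar>c\<bar> (\<lambda>x::'a::euclidean_space. c)"
  by (simp add: C11_def sdiff_def)

lemma C11_lin:
  assumes "C11 M v" "C11 N w" shows "C11 (M + \<bar>c\<bar> * N) (\<lambda>x. v x + c * w x)"
proof -
  note C = C11D[OF assms(1)] and D = C11D[OF assms(2)]
  have *: "\<bar>a + c * b\<bar> \<le> (M + \<bar>c\<bar> * N) * r" if "\<bar>a\<bar> \<le> M * r" "\<bar>b\<bar> \<le> N * r" for a b r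
  proof -
    have "\<bar>c * b\<bar> \<le> \<bar>c\<bar> * (N * r)" unfolding abs_mult using that by (intro mult_left_mono) auto
    with that show ?thesis by (simp add: algebra_simps)
  qed
  have "\<bar>v x + c * w x\<bar> \<le> M + \<bar>c\<bar> * N" for x using *[of "v x" 1 "w x"] C(2) D(2) by simp
  moreover have "\<bar>v (x + y) + c * w (x + y) - (v x + c * w x)\<bar> \<le> (M + \<bar>c\<bar> * N) * norm y" for x y
    using *[OF C(3) D(3), of x y x] by (simp add: algebra_simps)
  moreover have "\<bar>sdiff (\<lambda>x. v x + c * w x) x y\<bar> \<le> (M + \<bar>c\<bar> * N) * (norm y)\<^sup>2" for x y
    using *[OF C(5) D(5), of x y x] by (simp add: sdiff_def algebra_simps)
  ultimately show ?thesis using C(1) D(1) by (simp add: C11_def)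
qed

text \<open>The discrete Leibniz rule. Integrated against K, the last bracket is the commutator
  error of a cutoff, a bilinear carre du champ.\<close>

lemma sdiff_mult:
  "sdiff (\<lambda>x. v x * w x) x y = v x * sdiff w x y + w x * sdiff v x y
     + ((v (x + y) - v x) * (w (x + y) - w x) + (v (x - y) - v x) * (w (x - y) - w x))"
  by (simp add: sdiff_def algebra_simps)

lemma C11_mult:
  assumes "C11 M v" "C11 N w" shows "C11 (4 * M * N) (\<lambda>x. v x * w x)"
proof -
  note C = C11D[OF assms(1)] and D = C11D[OF assms(2)]
  have MN: "0 \<le> M * N" using C(6) D(6) by simp
  have "\<bar>v x * w x\<bar> \<le> 4 * M * N" for x
    using mult_mono[OF C(2)[of x] D(2)[of x] C(6) abs_ge_zero] MN by (simp add: abs_mult)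
  moreover have "\<bar>v (x + y) * w (x + y) - v x * w x\<bar> \<le> 4 * M * N * norm y" for x y
  proof -
    have "v (x + y) * w (x + y) - v x * w x = v (x + y) * (w (x + y) - w x) + w x * (v (x + y) - v x)"
      by (simp add: algebra_simps)
    also have "\<bar>\<dots>\<bar> \<le> M * (N * norm y) + N * (M * norm y)"
      by (rule order_trans[OF abs_triangle_ineq]) (intro add_mono, unfold abs_mult, (intro mult_mono C D abs_ge_zero)+)
    also have "\<dots> = 2 * ((M * N) * norm y)" by simp
    also have "\<dots> \<le> 4 * ((M * N) * norm y)" using mult_nonneg_nonneg[OF MN norm_ge_zero[of y]] by linarith
    finally show ?thesis by (simp add: mult.assoc)
  qed
  moreover have "\<bar>sdiff (\<lambda>x. v x * w x) x y\<bar> \<le> 4 * M * N * (norm y)\<^sup>2" for x y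
  proof -
    have "\<bar>sdiff (\<lambda>x. v x * w x) x y\<bar> \<le> \<bar>v x * sdiff w x y\<bar> + \<bar>w x * sdiff v x y\<bar>
        + (\<bar>(v (x + y) - v x) * (w (x + y) - w x)\<bar> + \<bar>(v (x - y) - v x) * (w (x - y) - w x)\<bar>)"
      unfolding sdiff_mult by linarith
    also have "\<dots> \<le> M * (N * (norm y)\<^sup>2) + N * (M * (norm y)\<^sup>2) + ((M * norm y) * (N * norm y) + (M * norm y) * (N * norm y))"
      unfolding abs_mult by (intro add_mono mult_mono C D abs_ge_zero mult_nonneg_nonneg norm_ge_zero)
    finally show ?thesis by (simp add: power2_eq_square algebra_simps)
  qed
  ultimately show ?thesis using C(1) D(1) by (simp add: C11_def)
qed

lemma C11_shift:
  fixes v :: "'a::euclidean_space \<Rightarrow> real"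
  assumes "C11 M v" shows "C11 M (\<lambda>x. v (x + h))"
proof -
  note C = C11D[OF assms]
  have [measurable]: "v \<in> borel_measurable borel" by (rule C)
  have "\<bar>v (x + y + h) - v (x + h)\<bar> \<le> M * norm y" for x y
    using C(3)[of "x + h" y] by (simp add: algebra_simps)
  moreover have "\<bar>sdiff (\<lambda>x. v (x + h)) x y\<bar> \<le> M * (norm y)\<^sup>2" for x y
    using C(5)[of "x + h" y] by (simp add: sdiff_def algebra_simps)
  ultimately show ?thesis using C(2) by (simp add: C11_def)
qed

lemma bsupp_lin: "bsupp v \<Longrightarrow> bsupp w \<Longrightarrow> bsupp (\<lambda>x. v x + c * w x)"
  unfolding bsupp_def by (metis add.right_neutral max_less_iff_conj mult_zero_right)

lemma bsupp_shift: assumes "bsupp v" shows "bsupp (\<lambda>x. v (x + h))"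
proof -
  obtain R where R: "\<And>x. R < norm x \<Longrightarrow> v x = 0" using assms by (auto simp: bsupp_def)
  have "v (x + h) = 0" if "R + norm h < norm x" for x
  proof (rule R)
    have "norm x \<le> norm (x + h) + norm h" using norm_triangle_ineq4[of "x + h" h] by simp
    then show "R < norm (x + h)" using that by simp
  qed
  then show ?thesis by (auto simp: bsupp_def)
qed

lemma bsupp_mult: "bsupp v \<Longrightarrow> bsupp (\<lambda>x. w x * v x)"
  unfolding bsupp_def by (metis mult_zero_right)

lemma C11c_lin: "C11c v \<Longrightarrow> C11c w \<Longrightarrow> C11c (\<lambda>x. v x + c * w x)"
  unfolding C11c_def using C11_lin bsupp_lin by blast

lemma C11c_shift: "C11c v \<Longrightarrow> C11c (\<lambda>x. v (x + h))"
  unfolding C11c_def using C11_shift bsupp_shift by blast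

lemma C11c_mult: "C11 M w \<Longrightarrow> C11c v \<Longrightarrow> C11c (\<lambda>x. w x * v x)"
  unfolding C11c_def using C11_mult bsupp_mult by blast

lemma C11c_borel[measurable_dest]: "C11c v \<Longrightarrow> v \<in> borel_measurable borel"
  by (auto simp: C11c_def C11_def)

lemma integrable_indicator_cball: "integrable lborel (\<lambda>x::'a::euclidean_space. c * indicator (cball 0 R) x :: real)"
  using emeasure_lborel_cball_finite[of "0::'a" R] by (intro integrable_mult_right integrable_real_indicator) auto

lemma L2_indicator_cball: "L2 (\<lambda>x::'a::euclidean_space. c * indicator (cball 0 R) x)"
  and l2_indicator_cball: "0 \<le> c \<Longrightarrow> l2 (\<lambda>x::'a. c * indicator (cball 0 R) x) = c * sqrt (measure lborel (cball (0::'a) R))"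
proof -
  have sq: "(c * indicator (cball 0 R) x)\<^sup>2 = c\<^sup>2 * indicator (cball 0 R) x" for x :: 'a
    by (simp add: indicator_def)
  show "L2 (\<lambda>x::'a. c * indicator (cball 0 R) x)"
    unfolding L2_in_def sq using borel_measurable_integrable[OF integrable_indicator_cball[of c R]]
      integrable_indicator_cball[of "c\<^sup>2" R, where 'a='a] by simp
  show "0 \<le> c \<Longrightarrow> l2 (\<lambda>x::'a. c * indicator (cball 0 R) x) = c * sqrt (measure lborel (cball (0::'a) R))"
    unfolding norm2_def sq by (simp add: real_sqrt_mult)
qed

lemma integrable_bounded_support:
  fixes f :: "'a::euclidean_space \<Rightarrow> real"
  assumes "f \<in> borel_measurable borel" "\<And>x. \<bar>f x\<bar> \<le> M" "\<And>x. R < norm x \<Longrightarrow> f x = 0"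
  shows "integrable lborel f"
proof (rule Bochner_Integration.integrable_bound)
  show "integrable lborel (\<lambda>x::'a. M * indicator (cball 0 R) x)" by (rule integrable_indicator_cball)
  show "AE x in lborel. norm (f x) \<le> norm (M * indicator (cball 0 R) x)"
    using assms(2,3) by (auto simp: indicator_def not_le intro: order_trans[OF assms(2) abs_ge_self])
qed (use assms in auto)

lemma C11c_integrable: assumes "C11c v" shows "integrable lborel v"
  using assms integrable_bounded_support[of v] unfolding C11c_def C11_def bsupp_def by metis

lemma C11c_L2: assumes "C11c v" shows "L2 v"
proof -
  obtain M where "C11 M v" using assms by (auto simp: C11c_def)
  then have "C11c (\<lambda>x. v x * v x)" using C11c_mult assms by blast
  from C11c_integrable[OF this] show ?thesis using assms C11c_borel by (simp add: L2_in_def power2_eq_square)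
qed

text \<open>For |y| \<le> 1 the second difference lives in a ball of radius R + 1 and is at most M
  |y|^2; for larger y it consists of four copies of v. The resulting modulus
  \<open>B * trunc_sq y\<close> is what K can integrate, so Fubini in (x, y) becomes available
  against any bounded function of x.\<close>

lemma sdiff_L1:
  fixes v :: "'a::euclidean_space \<Rightarrow> real"
  assumes M: "C11 M v" and R: "\<And>x. R < norm x \<Longrightarrow> v x = 0"
  defines "B \<equiv> M * measure lborel (cball (0::'a) (R + 1)) + 4 * l1 v"
  shows "0 \<le> B" "integrable lborel (\<lambda>x. sdiff v x y)"
    "(LBINT x. \<bar>sdiff v x y\<bar>) \<le> B * trunc_sq y"
proof -
  note C = C11D[OF M]
  have [measurable]: "v \<in> borel_measurable borel" by (rule C)
  have v: "integrable lborel v" by (rule integrable_bounded_support[OF C(1,2) R])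
  note vi = v integrable_lborel_shift[OF v]
  show int: "integrable lborel (\<lambda>x. sdiff v x y)"
    unfolding sdiff_def using vi by auto
  define m where "m = measure lborel (cball (0::'a) (R + 1))"
  have B: "0 \<le> M * m" "0 \<le> l1 v" using C(6) by (auto simp: m_def)
  have Bm: "B = M * m + 4 * l1 v" by (simp add: B_def m_def)
  show "0 \<le> B" using B by (simp add: Bm)
  show "(LBINT x. \<bar>sdiff v x y\<bar>) \<le> B * trunc_sq y"
  proof (cases "norm y \<le> 1")
    case True
    have z: "sdiff v x y = 0" if "R + 1 < norm x" for x
      using that True norm_triangle_ineq4[of "x + y" y] norm_triangle_ineq[of "x - y" y]
      by (simp add: sdiff_def R)
    have "(LBINT x. \<bar>sdiff v x y\<bar>) \<le> (LBINT x. M * (norm y)\<^sup>2 * indicator (cball (0::'a) (R + 1)) x)"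
    proof (rule integral_mono)
      show "integrable lborel (\<lambda>x::'a. M * (norm y)\<^sup>2 * indicator (cball 0 (R + 1)) x)"
        by (rule integrable_indicator_cball)
      show "\<bar>sdiff v x y\<bar> \<le> M * (norm y)\<^sup>2 * indicator (cball 0 (R + 1)) x" for x
        using C(5)[of x y] z[of x] by (auto simp: indicator_def not_le)
    qed (use int in auto)
    also have "\<dots> = M * m * (norm y)\<^sup>2" by (simp add: m_def)
    also have "\<dots> \<le> B * (norm y)\<^sup>2" using B by (intro mult_right_mono) (auto simp: Bm)
    also have "(norm y)\<^sup>2 = trunc_sq y" using True by (simp add: trunc_sq_def power_le_one)
    finally show ?thesis .
  next
    case False
    have "(LBINT x. \<bar>sdiff v x y\<bar>) \<le> (LBINT x. \<bar>v (x + y)\<bar> + \<bar>v (x - y)\<bar> + 2 * \<bar>v x\<bar>)"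
      using int vi by (intro integral_mono integrable_abs Bochner_Integration.integrable_add integrable_mult_right)
        (auto simp: sdiff_def)
    also have "\<dots> = 4 * l1 v"
      using vi integral_lborel_shift(1,3)[of "\<lambda>x. \<bar>v x\<bar>" y] by simp
    also have "\<dots> \<le> B" using B by (simp add: Bm)
    also have "B = B * trunc_sq y" using False by (simp add: trunc_sq_def)
    finally show ?thesis .
  qed
qed

lemma C11c_sdiff_L1:
  assumes "C11c v"
  obtains B where "0 \<le> B" "\<And>y. integrable lborel (\<lambda>x. sdiff v x y)"
    "\<And>y. (LBINT x. \<bar>sdiff v x y\<bar>) \<le> B * trunc_sq y"
proof -
  obtain M R where "C11 M v" "\<And>x. R < norm x \<Longrightarrow> v x = 0"
    using assms by (auto simp: C11c_def bsupp_def)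
  from sdiff_L1[OF this] that show ?thesis by blast
qed

text \<open>Discrete integration by parts for a bounded h against an integrable v. Nothing about the
  decay of h enters, so h may be an operator applied to v.\<close>

lemma integral_sdiff_swap:
  fixes h v :: "'a::euclidean_space \<Rightarrow> real"
  assumes [measurable]: "h \<in> borel_measurable borel" and h: "\<And>x. \<bar>h x\<bar> \<le> H" and v: "integrable lborel v"
  shows "(LBINT x. h x * sdiff v x y) = (LBINT x. sdiff h x y * v x)"
    and "(LBINT x. h x * sdiff v x y) = - (LBINT x. (h (x + y) - h x) * (v (x + y) - v x))"
proof -
  have [measurable]: "v \<in> borel_measurable borel" using v by auto
  have i: "integrable lborel (\<lambda>x. h (x + a) * v (x + b))" for a b
  proof (rule Bochner_Integration.integrable_bound)
    show "integrable lborel (\<lambda>x. H * v (x + b))" using integrable_lborel_shift(1)[OF v, of b] by simp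
    have "\<bar>h x\<bar> \<le> \<bar>H\<bar>" for x using h[of x] by simp
    then show "AE x in lborel. norm (h (x + a) * v (x + b)) \<le> norm (H * v (x + b))"
      by (auto simp: abs_mult intro!: mult_right_mono)
  qed measurable
  define I where "I a b = (LBINT x. h (x + a) * v (x + b))" for a b
  \<comment> \<open>By translation invariance the correlation \<open>I a b\<close> depends on a - b
    only; the two identities are then linear relations between the few values that occur.\<close>
  have sh: "I (a + c) (b + c) = I a b" for a b c
    unfolding I_def using integral_lborel_shift(1)[of "\<lambda>x. h (x + a) * v (x + b)" c]
    by (simp add: add.assoc add.commute[of c])
  have 1: "(LBINT x. h x * sdiff v x y) = I 0 y + I 0 (- y) - 2 * I 0 0"
  proof -
    have "h x * sdiff v x y = h (x + 0) * v (x + y) + h (x + 0) * v (x + - y) - 2 * (h (x + 0) * v (x + 0))" for x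
      by (simp add: sdiff_def algebra_simps)
    then show ?thesis using i[of 0 y] i[of 0 "-y"] i[of 0 0] unfolding I_def by simp
  qed
  have 2: "(LBINT x. sdiff h x y * v x) = I y 0 + I (- y) 0 - 2 * I 0 0"
  proof -
    have "sdiff h x y * v x = h (x + y) * v (x + 0) + h (x + - y) * v (x + 0) - 2 * (h (x + 0) * v (x + 0))" for x
      by (simp add: sdiff_def algebra_simps)
    then show ?thesis using i[of y 0] i[of "-y" 0] i[of 0 0] unfolding I_def by simp
  qed
  have 3: "(LBINT x. (h (x + y) - h x) * (v (x + y) - v x)) = I y y - I y 0 - I 0 y + I 0 0"
  proof -
    have "(h (x + y) - h x) * (v (x + y) - v x)
        = h (x + y) * v (x + y) - h (x + y) * v (x + 0) - h (x + 0) * v (x + y) + h (x + 0) * v (x + 0)" for x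
      by (simp add: algebra_simps)
    then show ?thesis using i[of y y] i[of y 0] i[of 0 y] i[of 0 0] unfolding I_def by simp
  qed
  have e: "I y y = I 0 0" "I (- y) 0 = I 0 y" "I 0 (- y) = I y 0"
    using sh[of 0 y 0] sh[of "- y" y 0] sh[of 0 y "- y"] by simp_all
  show "(LBINT x. h x * sdiff v x y) = (LBINT x. sdiff h x y * v x)"
    unfolding 1 2 e by simp
  show "(LBINT x. h x * sdiff v x y) = - (LBINT x. (h (x + y) - h x) * (v (x + y) - v x))"
    unfolding 1 3 e by simp
qed

section \<open>Integro-differential operators\<close>

text \<open>The operator \<open>intop\<close> over the uncompleted measure, on whose products the
  Fubini arguments take place. \<open>class_L0_representative\<close> links the two.\<close>

definition Lop :: "('a::euclidean_space \<Rightarrow> real) \<Rightarrow> ('a \<Rightarrow> real) \<Rightarrow> 'a \<Rightarrow> real" where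
  "Lop K v x = (LBINT y. sdiff v x y * K y)"

definition kmass :: "('a::euclidean_space \<Rightarrow> real) \<Rightarrow> real" where
  "kmass K = (LBINT y. trunc_sq y * K y)"

text \<open>Symmetry sits in \<open>sdiff\<close>, which is even in y and therefore sees only the
  even part of K.\<close>

locale levy_kernel =
  fixes K :: "'a::euclidean_space \<Rightarrow> real"
  assumes K_borel[measurable]: "K \<in> borel_measurable borel"
    and K_nonneg: "\<And>y. 0 \<le> K y"
    and K_int: "integrable lborel (\<lambda>y. trunc_sq y * K y)"
begin

lemma kmass_nonneg: "0 \<le> kmass K"
  unfolding kmass_def by (intro integral_nonneg_AE) (simp add: K_nonneg)

lemma integrable_times_K:
  assumes [measurable]: "f \<in> borel_measurable borel" and f: "\<And>y. \<bar>f y\<bar> \<le> B * trunc_sq y"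
  shows "integrable lborel (\<lambda>y. f y * K y)" "\<bar>LBINT y. f y * K y\<bar> \<le> B * kmass K"
proof -
  have b: "\<bar>f y * K y\<bar> \<le> B * (trunc_sq y * K y)" for y
    using mult_right_mono[OF f K_nonneg, of y y] by (simp add: abs_mult K_nonneg mult.assoc)
  show i: "integrable lborel (\<lambda>y. f y * K y)"
  proof (rule Bochner_Integration.integrable_bound)
    show "integrable lborel (\<lambda>y. B * (trunc_sq y * K y))" using K_int by simp
    show "AE y in lborel. norm (f y * K y) \<le> norm (B * (trunc_sq y * K y))"
      using b by (auto intro: order_trans[OF b abs_ge_self])
  qed measurable
  have "\<bar>LBINT y. f y * K y\<bar> \<le> (LBINT y. \<bar>f y * K y\<bar>)" by (rule integral_abs_bound)
  also have "\<dots> \<le> (LBINT y. B * (trunc_sq y * K y))"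
    using i K_int b by (intro integral_mono) auto
  finally show "\<bar>LBINT y. f y * K y\<bar> \<le> B * kmass K" by (simp add: kmass_def)
qed

lemma Lop_measurable[measurable]:
  assumes [measurable]: "v \<in> borel_measurable borel"
  shows "Lop K v \<in> borel_measurable borel"
  unfolding Lop_def[abs_def] by measurable

lemma Lop_integrable: "C11 M v \<Longrightarrow> integrable lborel (\<lambda>y. sdiff v x y * K y)"
  using C11_sdiff_le[of M v] C11D(1)[of M v] by (intro integrable_times_K) auto

lemma Lop_bound: "C11 M v \<Longrightarrow> \<bar>Lop K v x\<bar> \<le> 4 * M * kmass K"
  unfolding Lop_def using C11_sdiff_le[of M v] C11D(1)[of M v] by (intro integrable_times_K) auto

lemma Lop_lin:
  assumes "C11 M v" "C11 N w"
  shows "Lop K (\<lambda>x. v x + c * w x) x = Lop K v x + c * Lop K w x"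
proof -
  have "Lop K (\<lambda>x. v x + c * w x) x = (LBINT y. sdiff v x y * K y + c * (sdiff w x y * K y))"
    unfolding Lop_def by (rule Bochner_Integration.integral_cong) (auto simp: sdiff_def algebra_simps)
  then show ?thesis using Lop_integrable[OF assms(1)] Lop_integrable[OF assms(2)] by (simp add: Lop_def)
qed

lemma Lop_shift: "Lop K (\<lambda>x. v (x + h)) x = Lop K v (x + h)"
  by (simp add: Lop_def sdiff_def algebra_simps)

lemma pair_integrable:
  assumes v: "C11c v" and [measurable]: "h \<in> borel_measurable borel" and h: "\<And>x. \<bar>h x\<bar> \<le> H"
  shows "integrable (lborel \<Otimes>\<^sub>M lborel) (\<lambda>(y, x). h x * sdiff v x y * K y)"
proof -
  have [measurable]: "v \<in> borel_measurable borel" using v by measurable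
  obtain B where B: "0 \<le> B" "\<And>y. integrable lborel (\<lambda>x. sdiff v x y)"
      "\<And>y. (LBINT x. \<bar>sdiff v x y\<bar>) \<le> B * trunc_sq y"
    using C11c_sdiff_L1[OF v] by blast
  have H: "0 \<le> H" using h abs_ge_zero order_trans by blast
  have hi: "integrable lborel (\<lambda>x. h x * sdiff v x y)" for y
  proof (rule Bochner_Integration.integrable_bound)
    show "integrable lborel (\<lambda>x. H * sdiff v x y)" using B(2) by simp
    show "AE x in lborel. norm (h x * sdiff v x y) \<le> norm (H * sdiff v x y)"
      using h H by (auto simp: abs_mult intro!: mult_right_mono)
  qed measurable
  have le: "(LBINT x. \<bar>h x * sdiff v x y\<bar>) \<le> (H * B) * trunc_sq y" for y
  proof -
    have "(LBINT x. \<bar>h x * sdiff v x y\<bar>) \<le> (LBINT x. H * \<bar>sdiff v x y\<bar>)"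
      using hi B(2) h by (intro integral_mono integrable_abs integrable_mult_right) (auto simp: abs_mult intro!: mult_right_mono)
    also have "\<dots> \<le> H * (B * trunc_sq y)" using B(3)[of y] H by (simp add: mult_left_mono)
    finally show ?thesis by (simp add: mult.assoc)
  qed
  show ?thesis
  proof (rule lborel_pair.Fubini_integrable)
    have eq: "(LBINT x. norm (case (y, x) of (y, x) \<Rightarrow> h x * sdiff v x y * K y))
        = (LBINT x. \<bar>h x * sdiff v x y\<bar>) * K y" for y
      by (simp add: abs_mult[of _ "K y"] K_nonneg)
    show "integrable lborel (\<lambda>y. LBINT x. norm (case (y, x) of (y, x) \<Rightarrow> h x * sdiff v x y * K y))"
      unfolding eq using le by (intro integrable_times_K(1)[where B="H * B"]) auto
    show "AE y in lborel. integrable lborel (\<lambda>x. case (y, x) of (y, x) \<Rightarrow> h x * sdiff v x y * K y)"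
      using hi by auto
  qed measurable
qed

text \<open>Fubini with a merely bounded factor h. The decisive choice is h = \<open>Lop K v\<close>
  or \<open>Lop K' v\<close>: it makes squared norms and mixed products of operators accessible as
  integrals over y of pairings with second differences.\<close>

lemma integral_mult_Lop:
  assumes v: "C11c v" and h: "h \<in> borel_measurable borel" "\<And>x. \<bar>h x\<bar> \<le> H"
  shows "(LBINT x. h x * Lop K v x) = (LBINT y. (LBINT x. h x * sdiff v x y) * K y)"
    and "integrable lborel (\<lambda>x. h x * Lop K v x)"
    and "integrable lborel (\<lambda>y. (LBINT x. h x * sdiff v x y) * K y)"
proof -
  note i = pair_integrable[OF assms]
  have e: "(LBINT y. h x * sdiff v x y * K y) = h x * Lop K v x" for x
    by (simp add: Lop_def mult.assoc)
  show "(LBINT x. h x * Lop K v x) = (LBINT y. (LBINT x. h x * sdiff v x y) * K y)"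
    using lborel_pair.Fubini_integral[of "\<lambda>y x. h x * sdiff v x y * K y"] i by (simp add: e)
  show "integrable lborel (\<lambda>x. h x * Lop K v x)"
    using lborel_pair.integrable_snd[of "\<lambda>y x. h x * sdiff v x y * K y"] i by (simp add: e)
  show "integrable lborel (\<lambda>y. (LBINT x. h x * sdiff v x y) * K y)"
    using lborel_pair.integrable_fst[of "\<lambda>y x. h x * sdiff v x y * K y"] i by simp
qed

lemma energy:
  assumes "C11c v"
  shows "(LBINT y. (LBINT x. (v (x + y) - v x)\<^sup>2) * K y) = - (LBINT x. v x * Lop K v x)"
    and "integrable lborel (\<lambda>y. (LBINT x. (v (x + y) - v x)\<^sup>2) * K y)"
proof -
  obtain M where "C11 M v" using assms by (auto simp: C11c_def)
  note C = C11D[OF this]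
  have "(LBINT x. (v (x + y) - v x)\<^sup>2) = - (LBINT x. v x * sdiff v x y)" for y
    using integral_sdiff_swap(2)[OF C(1,2) C11c_integrable[OF assms], of y] by (simp add: power2_eq_square)
  then show "(LBINT y. (LBINT x. (v (x + y) - v x)\<^sup>2) * K y) = - (LBINT x. v x * Lop K v x)"
    and "integrable lborel (\<lambda>y. (LBINT x. (v (x + y) - v x)\<^sup>2) * K y)"
    using integral_mult_Lop[OF assms C(1,2)] by simp_all
qed

text \<open>A crude bound, obtained by pairing \<open>Lop K v\<close> with itself and using its sup
  bound for one factor. What counts is that it is linear in M: cutoffs whose constants grow
  geometrically then give norms of geometric growth, as \<open>iterate_absorption\<close>
  requires.\<close>

lemma l2_Lop_bound:
  fixes v :: "'a \<Rightarrow> real"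
  assumes M: "C11 M v" and R: "\<And>x. R < norm x \<Longrightarrow> v x = 0"
  shows "l2 (Lop K v)
    \<le> 4 * M * kmass K * sqrt (measure lborel (cball (0::'a) (R + 1)) + measure lborel (cball (0::'a) R))"
proof (rule power2_le_imp_le)
  have v: "C11c v" using M R by (auto simp: C11c_def bsupp_def)
  note C = C11D[OF M]
  have [measurable]: "v \<in> borel_measurable borel" by (rule C)
  define m1 m2 where "m1 = measure lborel (cball (0::'a) R)" and "m2 = measure lborel (cball (0::'a) (R + 1))"
  have vM: "l1 v \<le> M * m1"
  proof -
    have "l1 v \<le> (LBINT x. M * indicator (cball (0::'a) R) x)"
    proof (rule integral_mono)
      show "integrable lborel (\<lambda>x. \<bar>v x\<bar>)" using C11c_integrable[OF v] by simp
      show "integrable lborel (\<lambda>x. M * indicator (cball (0::'a) R) x)" by (rule integrable_indicator_cball)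
      show "\<bar>v x\<bar> \<le> M * indicator (cball 0 R) x" for x using C(2)[of x] R[of x] by (auto simp: indicator_def not_le)
    qed
    then show ?thesis by (simp add: m1_def)
  qed
  define B where "B = M * m2 + 4 * l1 v"
  have B: "0 \<le> B" "integrable lborel (\<lambda>x. sdiff v x y)" "(LBINT x. \<bar>sdiff v x y\<bar>) \<le> B * trunc_sq y" for y
    unfolding B_def m2_def by (rule sdiff_L1[OF M], erule R)+
  define H where "H = 4 * M * kmass K"
  have H: "0 \<le> H" using C(6) kmass_nonneg by (simp add: H_def)
  have Lm: "Lop K v \<in> borel_measurable borel" by measurable
  note i = integral_mult_Lop[OF v Lm Lop_bound[OF M]]
  have "(l2 (Lop K v))\<^sup>2 = (LBINT y. (LBINT x. Lop K v x * sdiff v x y) * K y)"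
    using i(1) unfolding l2_sq by (simp add: power2_eq_square)
  also have "\<dots> \<le> (LBINT y. (H * B) * (trunc_sq y * K y))"
  proof (rule integral_mono)
    fix y
    have hi: "integrable lborel (\<lambda>x. H * \<bar>sdiff v x y\<bar>)" using B(2) by simp
    have le: "\<bar>Lop K v x * sdiff v x y\<bar> \<le> H * \<bar>sdiff v x y\<bar>" for x
      unfolding abs_mult H_def by (intro mult_right_mono Lop_bound[OF M]) simp
    have "integrable lborel (\<lambda>x. Lop K v x * sdiff v x y)"
      by (rule Bochner_Integration.integrable_bound[OF hi]) (auto intro: order_trans[OF le abs_ge_self])
    then have "(LBINT x. Lop K v x * sdiff v x y) \<le> (LBINT x. H * \<bar>sdiff v x y\<bar>)"
      using hi by (rule integral_mono) (rule order_trans[OF abs_ge_self le])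
    also have "\<dots> \<le> H * (B * trunc_sq y)"
      using B(3)[of y] H by (simp add: mult_left_mono)
    finally have "(LBINT x. Lop K v x * sdiff v x y) * K y \<le> H * (B * trunc_sq y) * K y"
      by (intro mult_right_mono K_nonneg)
    then show "(LBINT x. Lop K v x * sdiff v x y) * K y \<le> (H * B) * (trunc_sq y * K y)"
      by (simp add: mult.assoc)
  qed (use i(3) K_int in auto)
  also have "\<dots> = H * B * kmass K" by (simp add: kmass_def)
  also have "\<dots> \<le> H * (4 * M * (m2 + m1)) * kmass K"
  proof (intro mult_right_mono mult_left_mono kmass_nonneg H)
    have "0 \<le> M * m2" using C(6) by (simp add: m2_def)
    then show "B \<le> 4 * M * (m2 + m1)" using vM by (simp add: B_def algebra_simps)
  qed
  also have "\<dots> = (4 * M * kmass K * sqrt (m2 + m1))\<^sup>2"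
    by (simp add: H_def power_mult_distrib m1_def m2_def power2_eq_square)
  finally show "(l2 (Lop K v))\<^sup>2 \<le> (4 * M * kmass K
      * sqrt (measure lborel (cball (0::'a) (R + 1)) + measure lborel (cball (0::'a) R)))\<^sup>2"
    by (simp add: m1_def m2_def)
qed (use C11D(6)[OF M] kmass_nonneg in simp)

lemma Lop_L2: assumes "C11c v" shows "L2 (Lop K v)"
proof -
  obtain M where M: "C11 M v" using assms by (auto simp: C11c_def)
  have [measurable]: "v \<in> borel_measurable borel" using assms by measurable
  show ?thesis
    using integral_mult_Lop(2)[OF assms _ Lop_bound[OF M]] by (simp add: L2_in_def power2_eq_square)
qed

end

section \<open>Symmetry of the operators and comparison of their L2 norms\<close>

lemma C11c_swap_Lop:
  assumes K: "levy_kernel K" and v: "C11c v" and w: "C11 M w"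
  shows "(LBINT x. w x * Lop K v x) = (LBINT x. Lop K w x * v x)"
proof -
  interpret levy_kernel K by fact
  have [measurable]: "v \<in> borel_measurable borel" using v by measurable
  note C = C11D[OF w]
  have [measurable]: "w \<in> borel_measurable borel" by (rule C)
  have i: "integrable (lborel \<Otimes>\<^sub>M lborel) (\<lambda>(y, x). sdiff w x y * v x * K y)"
  proof (rule lborel_pair.Fubini_integrable)
    have vi: "integrable lborel (\<lambda>x. 4 * M * trunc_sq y * \<bar>v x\<bar>)" for y
      using C11c_integrable[OF v] by simp
    have le: "\<bar>sdiff w x y * v x\<bar> \<le> 4 * M * trunc_sq y * \<bar>v x\<bar>" for x y
      unfolding abs_mult by (intro mult_right_mono C11_sdiff_le[OF w]) simp
    have int: "integrable lborel (\<lambda>x. sdiff w x y * v x)" for y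
      by (rule Bochner_Integration.integrable_bound[OF vi[of y]])
        (auto intro: order_trans[OF le abs_ge_self])
    have eq: "(LBINT x. norm (case (y, x) of (y, x) \<Rightarrow> sdiff w x y * v x * K y))
        = (LBINT x. \<bar>sdiff w x y * v x\<bar>) * K y" for y
      by (simp add: abs_mult[of _ "K y"] K_nonneg)
    have "(LBINT x. \<bar>sdiff w x y * v x\<bar>) \<le> (LBINT x. 4 * M * trunc_sq y * \<bar>v x\<bar>)" for y
      using int vi le by (intro integral_mono integrable_abs)
    then have "(LBINT x. \<bar>sdiff w x y * v x\<bar>) \<le> (4 * M * l1 v) * trunc_sq y" for y
      by (simp add: mult_ac)
    then show "integrable lborel (\<lambda>y. LBINT x. norm (case (y, x) of (y, x) \<Rightarrow> sdiff w x y * v x * K y))"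
      unfolding eq by (intro integrable_times_K(1)[where B="4 * M * l1 v"]) auto
    show "AE y in lborel. integrable lborel (\<lambda>x. case (y, x) of (y, x) \<Rightarrow> sdiff w x y * v x * K y)"
      using int by auto
  qed measurable
  have "(LBINT x. w x * Lop K v x) = (LBINT y. (LBINT x. w x * sdiff v x y) * K y)"
    by (rule integral_mult_Lop(1)[OF v C(1,2)])
  also have "\<dots> = (LBINT y. (LBINT x. sdiff w x y * v x * K y))"
    using integral_sdiff_swap(1)[OF C(1,2) C11c_integrable[OF v]] by simp
  also have "\<dots> = (LBINT x. (LBINT y. sdiff w x y * v x * K y))"
    using lborel_pair.Fubini_integral[OF i] by simp
  also have "\<dots> = (LBINT x. Lop K w x * v x)"
    by (simp add: Lop_def mult_ac flip: integral_mult_right_zero)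
  finally show ?thesis .
qed

text \<open>The energies of \<open>K\<close> and \<open>K'\<close> are comparable; applying this to every difference
  \<open>v (x + y) - v x\<close> and integrating against \<open>K' y\<close> upgrades it to the square of the operators,
  because \<open>Lop K\<close> and \<open>Lop K'\<close> commute with translations.\<close>

theorem Lop_L2_comparison:
  assumes K: "levy_kernel K" and K': "levy_kernel K'" and le: "\<And>y. K' y \<le> c * K y" and c: "0 \<le> c"
    and v: "C11c v"
  shows "l2 (Lop K' v) \<le> c * l2 (Lop K v)"
proof -
  interpret K: levy_kernel K by fact
  interpret K': levy_kernel K' by fact
  obtain M where M: "C11 M v" using v by (auto simp: C11c_def)
  have vm[measurable]: "v \<in> borel_measurable borel" using v by measurable
  note vi = C11c_integrable[OF v]
  have en: "- (LBINT x. w x * Lop K' w x) \<le> c * - (LBINT x. w x * Lop K w x)" if w: "C11c w" for w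
  proof -
    have "(LBINT y. (LBINT x. (w (x + y) - w x)\<^sup>2) * K' y)
        \<le> (LBINT y. c * ((LBINT x. (w (x + y) - w x)\<^sup>2) * K y))"
    proof (rule integral_mono)
      fix y
      have "(LBINT x. (w (x + y) - w x)\<^sup>2) * K' y \<le> (LBINT x. (w (x + y) - w x)\<^sup>2) * (c * K y)"
        by (intro mult_left_mono le) simp
      then show "(LBINT x. (w (x + y) - w x)\<^sup>2) * K' y \<le> c * ((LBINT x. (w (x + y) - w x)\<^sup>2) * K y)"
        by (simp add: mult_ac)
    qed (use K.energy(2)[OF w] K'.energy(2)[OF w] in auto)
    then show ?thesis using K.energy(1)[OF w] K'.energy(1)[OF w] by simp
  qed
  have dif: "(LBINT x. h x * sdiff v x y) = - (LBINT x. (v (x + y) - v x) * Lop J (\<lambda>x. v (x + y) - v x) x)"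
    if J: "levy_kernel J" and h: "h = Lop J v" for J h y
  proof -
    interpret J: levy_kernel J by fact
    have 1: "Lop J (\<lambda>x. v (x + y) - v x) x = h (x + y) - h x" for x
      using J.Lop_lin[OF C11_shift[OF M, of y] M, of "-1" x] by (simp add: J.Lop_shift h)
    have "(LBINT x. h x * sdiff v x y) = - (LBINT x. (h (x + y) - h x) * (v (x + y) - v x))"
      unfolding h by (rule integral_sdiff_swap(2)[OF _ J.Lop_bound[OF M] vi]) measurable
    then show ?thesis by (simp add: 1 mult.commute)
  qed
  note iK = K'.integral_mult_Lop[OF v K.Lop_measurable[OF vm] K.Lop_bound[OF M]]
    and iK' = K'.integral_mult_Lop[OF v K'.Lop_measurable[OF vm] K'.Lop_bound[OF M]]
  have "(l2 (Lop K' v))\<^sup>2 = (LBINT y. (LBINT x. Lop K' v x * sdiff v x y) * K' y)"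
    using iK'(1) unfolding l2_sq by (simp add: power2_eq_square)
  also have "\<dots> \<le> (LBINT y. c * ((LBINT x. Lop K v x * sdiff v x y) * K' y))"
  proof (rule integral_mono)
    fix y
    have "C11c (\<lambda>x. v (x + y) - v x)" using C11c_lin[OF C11c_shift[OF v, of y] v, of "-1"] by simp
    from en[OF this] have "(LBINT x. Lop K' v x * sdiff v x y) \<le> c * (LBINT x. Lop K v x * sdiff v x y)"
      unfolding dif[OF K refl] dif[OF K' refl] by simp
    from mult_right_mono[OF this K'.K_nonneg]
    show "(LBINT x. Lop K' v x * sdiff v x y) * K' y \<le> c * ((LBINT x. Lop K v x * sdiff v x y) * K' y)"
      by (simp add: mult.assoc)
  qed (use iK'(3) iK(3) in auto)
  \<comment> \<open>Only the inner kernel has been exchanged; the outer integration is still against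
    K', so undoing Fubini gives the mixed product. Cauchy-Schwarz then leaves one factor
    \<open>l2 (Lop K' v)\<close> to cancel.\<close>
  also have "\<dots> = c * (LBINT x. Lop K v x * Lop K' v x)" using iK(1) by simp
  also have "\<dots> \<le> c * (l2 (Lop K v) * l2 (Lop K' v))"
    using l2_Cauchy_Schwarz[OF K.Lop_L2[OF v] K'.Lop_L2[OF v]] c by (intro mult_left_mono) auto
  finally have "l2 (Lop K' v) * l2 (Lop K' v) \<le> (c * l2 (Lop K v)) * l2 (Lop K' v)"
    by (simp add: power2_eq_square mult.assoc)
  then show ?thesis
    using c l2_nonneg[of lborel "Lop K' v"] l2_nonneg[of lborel "Lop K v"]
    by (metis mult_le_cancel_right_pos mult_nonneg_nonneg order_le_less)
qed

section \<open>Product rule and localization by cutoffs\<close>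

context levy_kernel
begin

text \<open>The identity \<Gamma>(v) = L(v^2) - 2 v L v. It exhibits the right-hand side as
  nonnegative and makes its integral computable, because L(v^2) has integral 0.\<close>

lemma carre_du_champ:
  assumes "C11 M v"
  shows "(LBINT y. ((v (x + y) - v x)\<^sup>2 + (v (x - y) - v x)\<^sup>2) * K y)
      = Lop K (\<lambda>x. v x * v x) x - 2 * (v x * Lop K v x)"
proof -
  have "((v (x + y) - v x)\<^sup>2 + (v (x - y) - v x)\<^sup>2) * K y
      = sdiff (\<lambda>x. v x * v x) x y * K y - 2 * v x * (sdiff v x y * K y)" for y
    by (simp add: sdiff_def power2_eq_square algebra_simps)
  then show ?thesis
    using Lop_integrable[OF assms] Lop_integrable[OF C11_mult[OF assms assms]]
    by (simp add: Lop_def mult.assoc)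
qed

lemma integral_carre_du_champ:
  assumes "C11c v"
  defines "G \<equiv> \<lambda>x. Lop K (\<lambda>x. v x * v x) x - 2 * (v x * Lop K v x)"
  shows "integrable lborel G" "(LBINT x. G x) \<le> 2 * (l2 v * l2 (Lop K v))"
proof -
  obtain M where M: "C11 M v" using assms by (auto simp: C11c_def)
  have vv: "C11c (\<lambda>x. v x * v x)" by (rule C11c_mult[OF M assms(1)])
  note i1 = integral_mult_Lop[OF vv, of "\<lambda>_. 1" 1] and i2 = integral_mult_Lop[OF assms(1) C11D(1,2)[OF M]]
  show "integrable lborel G" unfolding G_def using i1(2) i2(2) by simp
  have "(LBINT x. sdiff (\<lambda>x. v x * v x) x y) = 0" for y
    using integral_sdiff_swap(1)[of "\<lambda>_. 1" 1, OF _ _ C11c_integrable[OF vv], of y] by (simp add: sdiff_def)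
  then have "(LBINT x. Lop K (\<lambda>x. v x * v x) x) = 0" using i1(1) by simp
  then have "(LBINT x. G x) = - 2 * (LBINT x. v x * Lop K v x)"
    unfolding G_def using i1(2) i2(2) by simp
  also have "\<dots> \<le> 2 * (l2 v * l2 (Lop K v))"
    using l2_Cauchy_Schwarz[OF C11c_L2[OF assms(1)] Lop_L2[OF assms(1)]] by simp
  finally show "(LBINT x. G x) \<le> 2 * (l2 v * l2 (Lop K v))" .
qed

text \<open>Pointwise Cauchy-Schwarz in y with weight K gives R^2 \<le> \<Gamma>(\<eta>)
  \<Gamma>(v); here \<Gamma>(\<eta>) is at most 8 N^2 \<open>kmass K\<close> and \<Gamma>(v) has
  integral at most 2 \<open>l2 v * l2 (Lop K v)\<close>, whence 16 = 4^2. The point is that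
  \<open>l2 (Lop K v)\<close> enters only through its square root, so Young's inequality can give it
  a small coefficient.\<close>

lemma product_remainder:
  assumes \<eta>: "C11 N \<eta>" and v: "C11c v"
  defines "R \<equiv> \<lambda>x. Lop K (\<lambda>x. \<eta> x * v x) x - \<eta> x * Lop K v x - v x * Lop K \<eta> x"
  shows "L2 R" "l2 R \<le> 4 * N * sqrt (kmass K * (l2 v * l2 (Lop K v)))"
proof -
  obtain M where M: "C11 M v" using v by (auto simp: C11c_def)
  have [measurable]: "v \<in> borel_measurable borel" "\<eta> \<in> borel_measurable borel"
    using C11D(1)[OF M] C11D(1)[OF \<eta>] by auto
  define G where "G = (\<lambda>x. Lop K (\<lambda>x. v x * v x) x - 2 * (v x * Lop K v x))"
  have R: "R x = (LBINT y. ((\<eta> (x + y) - \<eta> x) * (v (x + y) - v x) + (\<eta> (x - y) - \<eta> x) * (v (x - y) - v x)) * K y)"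
    and Ri: "integrable lborel (\<lambda>y. ((\<eta> (x + y) - \<eta> x) * (v (x + y) - v x) + (\<eta> (x - y) - \<eta> x) * (v (x - y) - v x)) * K y)"
    for x
  proof -
    have e: "((\<eta> (x + y) - \<eta> x) * (v (x + y) - v x) + (\<eta> (x - y) - \<eta> x) * (v (x - y) - v x)) * K y
      = sdiff (\<lambda>x. \<eta> x * v x) x y * K y - \<eta> x * (sdiff v x y * K y) - v x * (sdiff \<eta> x y * K y)" for y
      unfolding sdiff_mult by (simp add: algebra_simps)
    note i = Lop_integrable[OF C11_mult[OF \<eta> M], of x] Lop_integrable[OF M, of x] Lop_integrable[OF \<eta>, of x]
    show "R x = (LBINT y. ((\<eta> (x + y) - \<eta> x) * (v (x + y) - v x) + (\<eta> (x - y) - \<eta> x) * (v (x - y) - v x)) * K y)"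
      unfolding e using i by (simp add: R_def Lop_def)
    show "integrable lborel (\<lambda>y. ((\<eta> (x + y) - \<eta> x) * (v (x + y) - v x) + (\<eta> (x - y) - \<eta> x) * (v (x - y) - v x)) * K y)"
      unfolding e using i by simp
  qed
  have sq: "integrable lborel (\<lambda>y. ((f (x + y) - f x)\<^sup>2 + (f (x - y) - f x)\<^sup>2) * K y)"
    "(LBINT y. ((f (x + y) - f x)\<^sup>2 + (f (x - y) - f x)\<^sup>2) * K y) \<le> 8 * L\<^sup>2 * kmass K"
    if f: "C11 L f" for f L x
  proof -
    have [measurable]: "f \<in> borel_measurable borel" by (rule C11D[OF f])
    have b: "\<bar>(f (x + y) - f x)\<^sup>2 + (f (x - y) - f x)\<^sup>2\<bar> \<le> 8 * L\<^sup>2 * trunc_sq y" for y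
      using C11_diff_sq_le[OF f, of x y] by simp
    show "integrable lborel (\<lambda>y. ((f (x + y) - f x)\<^sup>2 + (f (x - y) - f x)\<^sup>2) * K y)"
      by (rule integrable_times_K(1)[OF _ b]) measurable
    show "(LBINT y. ((f (x + y) - f x)\<^sup>2 + (f (x - y) - f x)\<^sup>2) * K y) \<le> 8 * L\<^sup>2 * kmass K"
      using integrable_times_K(2)[OF _ b] by force
  qed
  have Gx: "G x = (LBINT y. ((v (x + y) - v x)\<^sup>2 + (v (x - y) - v x)\<^sup>2) * K y)" for x
    unfolding G_def by (rule carre_du_champ[OF M, symmetric])
  have G0: "0 \<le> G x" for x
    unfolding Gx by (intro integral_nonneg_AE) (simp add: K_nonneg)
  have R2: "(R x)\<^sup>2 \<le> 8 * N\<^sup>2 * kmass K * G x" for x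
  proof -
    define H where "H = (LBINT y. ((\<eta> (x + y) - \<eta> x)\<^sup>2 + (\<eta> (x - y) - \<eta> x)\<^sup>2) * K y)"
    have "(R x)\<^sup>2 \<le> H * G x"
    proof (rule discriminant_le)
      fix s t :: real
      have "0 \<le> (LBINT y. ((s * (\<eta> (x + y) - \<eta> x) - t * (v (x + y) - v x))\<^sup>2
          + (s * (\<eta> (x - y) - \<eta> x) - t * (v (x - y) - v x))\<^sup>2) * K y)"
        by (intro integral_nonneg_AE) (simp add: K_nonneg)
      also have "\<dots> = (LBINT y. s\<^sup>2 * (((\<eta> (x + y) - \<eta> x)\<^sup>2 + (\<eta> (x - y) - \<eta> x)\<^sup>2) * K y)
          - 2 * s * t * (((\<eta> (x + y) - \<eta> x) * (v (x + y) - v x) + (\<eta> (x - y) - \<eta> x) * (v (x - y) - v x)) * K y)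
          + t\<^sup>2 * (((v (x + y) - v x)\<^sup>2 + (v (x - y) - v x)\<^sup>2) * K y))"
        by (rule Bochner_Integration.integral_cong) (auto simp: power2_eq_square algebra_simps)
      also have "\<dots> = s\<^sup>2 * H - 2 * s * t * R x + t\<^sup>2 * G x"
        using sq(1)[OF \<eta>] sq(1)[OF M] Ri by (simp add: H_def R Gx)
      finally show "0 \<le> s\<^sup>2 * H - 2 * s * t * R x + t\<^sup>2 * G x" .
    qed (rule G0)
    also have "\<dots> \<le> 8 * N\<^sup>2 * kmass K * G x"
      unfolding H_def by (intro mult_right_mono sq(2)[OF \<eta>] G0)
    finally show ?thesis .
  qed
  have [measurable]: "R \<in> borel_measurable borel" unfolding R_def by measurable
  note Gi = integral_carre_du_champ[OF v, folded G_def]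
  have i: "integrable lborel (\<lambda>x. (R x)\<^sup>2)"
  proof (rule Bochner_Integration.integrable_bound)
    show "integrable lborel (\<lambda>x. 8 * N\<^sup>2 * kmass K * G x)" using Gi(1) by simp
    show "AE x in lborel. norm ((R x)\<^sup>2) \<le> norm (8 * N\<^sup>2 * kmass K * G x)"
      using R2 by (auto intro: order_trans[OF R2 abs_ge_self])
  qed measurable
  then show "L2 R" by (simp add: L2_in_def)
  show "l2 R \<le> 4 * N * sqrt (kmass K * (l2 v * l2 (Lop K v)))"
  proof (rule power2_le_imp_le)
    have "(l2 R)\<^sup>2 \<le> (LBINT x. 8 * N\<^sup>2 * kmass K * G x)"
      unfolding l2_sq using i Gi(1) R2 by (intro integral_mono) auto
    also have "\<dots> \<le> 8 * N\<^sup>2 * kmass K * (2 * (l2 v * l2 (Lop K v)))"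
      unfolding integral_mult_right_zero using Gi(2) kmass_nonneg by (intro mult_left_mono) auto
    also have "\<dots> = (4 * N * sqrt (kmass K * (l2 v * l2 (Lop K v))))\<^sup>2"
      using kmass_nonneg by (simp add: power_mult_distrib)
    finally show "(l2 R)\<^sup>2 \<le> (4 * N * sqrt (kmass K * (l2 v * l2 (Lop K v))))\<^sup>2" .
  qed (use C11D(6)[OF \<eta>] kmass_nonneg in simp)
qed

text \<open>Where w vanishes near x the singularity of K is never met: a bounded kernel acts on the
  two translates w (x + y) and w (x - y), which explains the factor 2.\<close>

lemma Lop_far:
  assumes w: "integrable lborel w" and z: "\<And>y. norm (y - x) < d \<Longrightarrow> w y = 0"
    and K: "\<And>y. d \<le> norm y \<Longrightarrow> K y \<le> b" and d: "0 < d"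
  shows "\<bar>Lop K w x\<bar> \<le> 2 * b * l1 w"
proof -
  have [measurable]: "w \<in> borel_measurable borel" using w by auto
  obtain e :: 'a where e: "e \<in> Basis" using nonempty_Basis by blast
  have b: "0 \<le> b" using K[of "d *\<^sub>R e"] K_nonneg[of "d *\<^sub>R e"] d e by simp
  have le: "\<bar>sdiff w x y * K y\<bar> \<le> b * (\<bar>w (x + y)\<bar> + \<bar>w (x - y)\<bar>)" for y
  proof (cases "norm y < d")
    case True
    then have "sdiff w x y = 0" using z[of x] z[of "x + y"] z[of "x - y"] d by (simp add: sdiff_def)
    then show ?thesis using b by simp
  next
    case False
    have "\<bar>sdiff w x y\<bar> * K y \<le> (\<bar>w (x + y)\<bar> + \<bar>w (x - y)\<bar>) * b"
      using False K z[of x] d K_nonneg by (intro mult_mono) (auto simp: sdiff_def)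
    then show ?thesis by (simp add: abs_mult K_nonneg mult.commute)
  qed
  have i: "integrable lborel (\<lambda>y. b * (\<bar>w (x + y)\<bar> + \<bar>w (x - y)\<bar>))"
    using integrable_lborel_shift(2,4)[OF w, of x] by auto
  have i': "integrable lborel (\<lambda>y. sdiff w x y * K y)"
    by (rule Bochner_Integration.integrable_bound[OF i]) (auto intro: order_trans[OF le abs_ge_self])
  have "\<bar>Lop K w x\<bar> \<le> (LBINT y. \<bar>sdiff w x y * K y\<bar>)" unfolding Lop_def by (rule integral_abs_bound)
  also have "\<dots> \<le> (LBINT y. b * (\<bar>w (x + y)\<bar> + \<bar>w (x - y)\<bar>))"
    using i i' le by (intro integral_mono) auto
  also have "\<dots> = 2 * b * l1 w"
    using integrable_lborel_shift(2,4)[OF w, of x] integral_lborel_shift(2,4)[of "\<lambda>x. \<bar>w x\<bar>" x] by simp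
  finally show "\<bar>Lop K w x\<bar> \<le> 2 * b * l1 w" .
qed

text \<open>The function w has no compact support, so the product rule is applied to v = \<psi> w
  instead. As \<psi> = 1 within distance d of the support of \<eta>, \<eta> w = \<eta> v, and there
  \<open>Lop K v\<close> differs from g only by the far field of w - v, bounded by
  \<open>Lop_far\<close>. The last two terms are the price of the cutoff \<eta>.\<close>

lemma localization:
  assumes w: "C11 M w" "integrable lborel w"
    and \<eta>: "C11 N \<eta>" "\<And>x. 0 \<le> \<eta> x \<and> \<eta> x \<le> 1" "\<And>x. 1 < norm x \<Longrightarrow> \<eta> x = 0"
    and \<psi>: "C11 N' \<psi>" "\<And>x. 0 \<le> \<psi> x \<and> \<psi> x \<le> 1" "bsupp \<psi>"
    and sep: "\<And>x y. \<eta> x \<noteq> 0 \<Longrightarrow> norm (y - x) < d \<Longrightarrow> \<psi> y = 1" and d: "0 < d"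
    and Kd: "\<And>y. d \<le> norm y \<Longrightarrow> K y \<le> b"
    and g: "L2 g" "\<And>x. \<eta> x \<noteq> 0 \<Longrightarrow> Lop K w x = g x"
  defines "v \<equiv> \<lambda>x. \<psi> x * w x"
  shows "l2 (Lop K (\<lambda>x. \<eta> x * w x)) \<le> l2 g
     + 2 * b * l1 w * sqrt (measure lborel (cball (0::'a) 1))
     + 4 * N * kmass K * l2 v + 4 * N * sqrt (kmass K * (l2 v * l2 (Lop K v)))"
proof -
  have [measurable]: "w \<in> borel_measurable borel" "\<eta> \<in> borel_measurable borel" "\<psi> \<in> borel_measurable borel"
    using C11D(1)[OF w(1)] C11D(1)[OF \<eta>(1)] C11D(1)[OF \<psi>(1)] by auto
  note vC = C11_mult[OF \<psi>(1) w(1), folded v_def]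
  have v: "C11c v"
    unfolding C11c_def using vC bsupp_mult[OF \<psi>(3), of w] by (auto simp: v_def mult.commute)
  have [measurable]: "v \<in> borel_measurable borel" using v by measurable
  define W where "W = l1 w"
  have W: "0 \<le> W" by (simp add: W_def)
  obtain e :: 'a where e: "e \<in> Basis" using nonempty_Basis by blast
  have b: "0 \<le> b" using Kd[of "d *\<^sub>R e"] K_nonneg[of "d *\<^sub>R e"] d e by simp
  define R where "R = (\<lambda>x. Lop K (\<lambda>x. \<eta> x * v x) x - \<eta> x * Lop K v x - v x * Lop K \<eta> x)"
  note R = product_remainder[OF \<eta>(1) v, folded R_def]
  have \<eta>v: "\<eta> x * w x = \<eta> x * v x" for x using sep[of x x] d by (cases "\<eta> x = 0") (auto simp: v_def)
  define z where "z = (\<lambda>x. w x + (-1) * v x)"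
  have zi: "integrable lborel z" unfolding z_def using w(2) C11c_integrable[OF v] by auto
  have zw: "\<bar>z x\<bar> \<le> \<bar>w x\<bar>" for x
  proof -
    have "z x = (1 - \<psi> x) * w x" by (simp add: z_def v_def algebra_simps)
    then show ?thesis using \<psi>(2)[of x] by (simp add: abs_mult mult_left_le_one_le)
  qed
  have zW: "l1 z \<le> W"
    unfolding W_def using zi w(2) zw by (intro integral_mono) auto
  define c where "c = 2 * b * W"
  have c: "0 \<le> c" using b W by (simp add: c_def)
  \<comment> \<open>The far field is bounded rather than small, so it is recorded as a constant on
    the unit ball, which contains the support of \<eta>.\<close>
  have t1: "\<bar>\<eta> x * Lop K v x\<bar> \<le> \<bar>g x\<bar> + c * indicator (cball 0 1) x" for x
  proof (cases "\<eta> x = 0")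
    case True then show ?thesis using c by (simp add: indicator_def)
  next
    case False
    then have x: "x \<in> cball 0 1" using \<eta>(3)[of x] by force
    have "\<bar>Lop K z x\<bar> \<le> 2 * b * l1 z"
      using sep[OF False] by (intro Lop_far[OF zi _ Kd d]) (auto simp: z_def v_def)
    also have "\<dots> \<le> c" unfolding c_def using zW b by (intro mult_left_mono) auto
    finally have "\<bar>Lop K z x\<bar> \<le> c" .
    moreover have "Lop K z x = Lop K w x + (-1) * Lop K v x"
      unfolding z_def by (rule Lop_lin[OF w(1) vC])
    ultimately have "\<bar>Lop K v x\<bar> \<le> \<bar>g x\<bar> + c" using g(2)[OF False] by linarith
    moreover have "\<bar>\<eta> x * Lop K v x\<bar> \<le> \<bar>Lop K v x\<bar>"
      using \<eta>(2)[of x] by (simp add: abs_mult mult_left_le_one_le)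
    ultimately show ?thesis using x by simp
  qed
  note ind = L2_indicator_cball[of c 1, where 'a='a] l2_indicator_cball[OF c, of 1, where 'a='a]
  have L1: "L2 (\<lambda>x. \<bar>g x\<bar> + c * indicator (cball 0 1) x)" by (intro L2_add L2_abs g ind)
  have T1: "L2 (\<lambda>x. \<eta> x * Lop K v x)"
    "l2 (\<lambda>x. \<eta> x * Lop K v x) \<le> l2 g + c * sqrt (measure lborel (cball (0::'a) 1))"
  proof -
    have m: "(\<lambda>x. \<eta> x * Lop K v x) \<in> borel_measurable lborel" by measurable
    have ae: "AE x in lborel. \<bar>\<eta> x * Lop K v x\<bar> \<le> \<bar>\<bar>g x\<bar> + c * indicator (cball 0 1) x\<bar>"
      by (intro AE_I2 order_trans[OF t1 abs_ge_self])
    show "L2 (\<lambda>x. \<eta> x * Lop K v x)" by (rule L2_bound[OF L1 m ae])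
    show "l2 (\<lambda>x. \<eta> x * Lop K v x) \<le> l2 g + c * sqrt (measure lborel (cball (0::'a) 1))"
      using L2_bound(2)[OF L1 m ae] l2_sum_le[OF L2_abs[OF g(1)] ind(1)] ind(2) by simp
  qed
  have k: "0 \<le> 4 * N * kmass K" using C11D(6)[OF \<eta>(1)] kmass_nonneg by simp
  have T2: "L2 (\<lambda>x. v x * Lop K \<eta> x)" "l2 (\<lambda>x. v x * Lop K \<eta> x) \<le> 4 * N * kmass K * l2 v"
  proof -
    have m: "(\<lambda>x. v x * Lop K \<eta> x) \<in> borel_measurable lborel" by measurable
    have "\<bar>v x * Lop K \<eta> x\<bar> \<le> \<bar>(4 * N * kmass K) * v x\<bar>" for x
      using mult_left_mono[OF Lop_bound[OF \<eta>(1), of x] abs_ge_zero, of "v x"]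
      unfolding abs_mult[of "4 * N * kmass K"] abs_of_nonneg[OF k] by (simp add: abs_mult mult_ac)
    then have ae: "AE x in lborel. \<bar>v x * Lop K \<eta> x\<bar> \<le> \<bar>(4 * N * kmass K) * v x\<bar>" by simp
    note s = L2_scale[OF C11c_L2[OF v], of "4 * N * kmass K"]
    show "L2 (\<lambda>x. v x * Lop K \<eta> x)" by (rule L2_bound[OF s m ae])
    show "l2 (\<lambda>x. v x * Lop K \<eta> x) \<le> 4 * N * kmass K * l2 v"
      using L2_bound(2)[OF s m ae] k by (simp add: l2_scale)
  qed
  have "Lop K (\<lambda>x. \<eta> x * w x) = (\<lambda>x. (\<eta> x * Lop K v x + v x * Lop K \<eta> x) + R x)"
    unfolding \<eta>v by (simp add: R_def)
  then have "l2 (Lop K (\<lambda>x. \<eta> x * w x))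
      \<le> l2 (\<lambda>x. \<eta> x * Lop K v x) + l2 (\<lambda>x. v x * Lop K \<eta> x) + l2 R"
    using l2_sum_le[OF L2_add[OF T1(1) T2(1)] R(1)] l2_sum_le[OF T1(1) T2(1)] by simp
  then show ?thesis using T1(2) T2(2) R(2) by (simp add: c_def W_def)
qed

end

section \<open>Kernels comparable to the fractional Laplacian\<close>

text \<open>At \<open>y = 0\<close> both bounds read \<open>K 0 = 0\<close>, since \<open>0 powr _ = 0\<close> and division by zero gives zero.\<close>

locale frac_kernel =
  fixes \<sigma> lam Lam :: real and K :: "'a::euclidean_space \<Rightarrow> real"
  assumes \<sigma>: "1 < \<sigma>" "\<sigma> < 2" and lam: "0 < lam"
    and borel_K: "K \<in> borel_measurable borel"
    and lower: "\<And>y. (2 - \<sigma>) * lam / norm y powr (real DIM('a) + \<sigma>) \<le> K y"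
    and upper: "\<And>y. K y \<le> (2 - \<sigma>) * Lam / norm y powr (real DIM('a) + \<sigma>)"

section \<open>Kernel mass, uniformly in the order\<close>

definition vol1 :: "'a::euclidean_space itself \<Rightarrow> real" where
  "vol1 _ = unit_ball_vol (real DIM('a))"

lemma emeasure_ball0: "0 \<le> r \<Longrightarrow> emeasure lborel (ball (0::'a::euclidean_space) r) = ennreal (vol1 TYPE('a) * r ^ DIM('a))"
  by (simp add: emeasure_ball vol1_def)

lemma vol1_pos: "0 < vol1 TYPE('a::euclidean_space)"
  by (simp add: vol1_def)

text \<open>The convex function 2^(-s) lies below its chord over [0, 1]. With s = 2 - \<sigma> this
  bounds the sum of the geometric series over the shells near the origin.\<close>

lemma one_minus_powr_ge:
  fixes s :: real assumes "0 \<le> s" "s \<le> 1" shows "s / 2 \<le> 1 - 2 powr (- s)"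
proof -
  have "convex_on UNIV (\<lambda>x::real. 2 powr (- x))"
  proof -
    have e: "(\<lambda>x::real. 2 powr (- x)) = (\<lambda>x. exp ((- ln 2) *\<^sub>R x))" by (auto simp: powr_def)
    show ?thesis unfolding e
      by (rule convex_on_realI[of _ _ "\<lambda>x. - ln 2 * exp ((- ln 2) *\<^sub>R x)"])
         (rule derivative_eq_intros refl | simp add: mult_right_mono_neg)+
  qed
  note c = convex_onD[OF this assms, of 0 1]
  have "(1 - s) *\<^sub>R 0 + s *\<^sub>R (1::real) = s" by simp
  then have "2 powr (- s) \<le> (1 - s) * 2 powr (- 0) + s * 2 powr (- 1)" using c by simp
  also have "(2::real) powr (- 1) = 1 / 2" by (simp add: powr_minus_divide)
  finally show ?thesis by simp
qed

text \<open>The opposite direction, from the tangent at 0; in \<open>shell_energy\<close> it bounds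
  the share of the energy in one shell.\<close>

lemma one_minus_powr_le:
  fixes s :: real assumes "0 \<le> s" shows "1 - 2 powr (- s) \<le> s"
proof -
  have "1 + (- s * ln 2) \<le> exp (- s * ln 2)" by (rule exp_ge_add_one_self)
  moreover have "s * ln 2 \<le> s * 1" using assms ln_2_less_1 by (intro mult_left_mono) auto
  ultimately show ?thesis by (simp add: powr_def)
qed

text \<open>Dyadic shells: the factor \<open>2 - \<sigma>\<close> compensates the geometric series
  \<open>\<Sum>\<^sub>k (2 powr (- (2 - \<sigma>)))\<^sup>k \<le> 2 / (2 - \<sigma>)\<close>, which makes the bound uniform as \<open>\<sigma>\<close> tends to 2.\<close>

lemma trunc_sq_powr_le:
  fixes y :: "'a::euclidean_space"
  defines "n \<equiv> real DIM('a)"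
  assumes \<sigma>: "1 < \<sigma>" "\<sigma> < 2"
  shows "ennreal (trunc_sq y / norm y powr (n + \<sigma>))
    \<le> (\<Sum>k. ennreal (2 ^ DIM('a) * ((2 powr (2 - n - \<sigma>)) powr (- real k))) * indicator (ball 0 ((1/2)^k)) y)
    + (\<Sum>k. ennreal (2 ^ (DIM('a) + 2) * ((2 powr (- n - \<sigma>)) powr (real k))) * indicator (ball 0 (2^k)) y)"
proof -
  have term_le: "f k \<le> (\<Sum>k. f k)" for f :: "nat \<Rightarrow> ennreal" and k
    using sum_le_suminf[of f "{k}"] by (simp add: summableI)
  have pw2: "(2::real) ^ DIM('a) = 2 powr n" by (simp add: n_def powr_realpow)
  consider "y = 0" | "y \<noteq> 0" "norm y < 1" | "1 \<le> norm y" by fastforce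
  then show ?thesis
  proof cases
    case 1 then show ?thesis by simp
  next
    case 2
    define k where "k = (LEAST k. (1/2)^(Suc k) \<le> norm y)"
    have "\<exists>k. (1/2)^(Suc k) \<le> norm y"
    proof -
      obtain m where "(1/2)^m < norm y" using real_arch_pow_inv[of "norm y" "1/2"] 2 by auto
      then have "(1/2)^(Suc m) \<le> norm y" using power_decreasing[of m "Suc m" "1/2::real"] by linarith
      then show ?thesis by blast
    qed
    then have k1: "(1/2)^(Suc k) \<le> norm y" unfolding k_def by (rule LeastI_ex)
    have k2: "norm y < (1/2)^k"
    proof (cases k)
      case 0 then show ?thesis using 2 by simp
    next
      case (Suc j)
      then show ?thesis using not_less_Least[of j "\<lambda>k. (1/2)^(Suc k) \<le> norm y"] by (simp add: k_def not_le)
    qed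
    have half: "(1/2::real)^j = 2 powr (- real j)" for j
      by (simp add: powr_minus powr_realpow power_one_over inverse_eq_divide)
    have "trunc_sq y / norm y powr (n + \<sigma>) = norm y powr (2 - n - \<sigma>)"
    proof -
      have "trunc_sq y = (norm y)\<^sup>2" using 2 by (simp add: trunc_sq_def power_le_one)
      also have "\<dots> = norm y powr 2" using 2 by (simp add: powr_numeral)
      finally show ?thesis by (simp only: powr_diff[symmetric] diff_diff_eq)
    qed
    also have "\<dots> \<le> ((1/2)^(Suc k)) powr (2 - n - \<sigma>)"
    proof (rule powr_mono2')
      have "1 \<le> n" by (simp add: n_def DIM_positive Suc_leI)
      then show "2 - n - \<sigma> \<le> 0" using \<sigma> by linarith
    qed (use k1 in auto)
    also have "\<dots> = 2 powr (n + \<sigma> - 2) * ((2 powr (2 - n - \<sigma>)) powr (- real k))"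
      unfolding half powr_powr powr_add[symmetric] by (simp add: algebra_simps)
    also have "\<dots> \<le> 2 ^ DIM('a) * ((2 powr (2 - n - \<sigma>)) powr (- real k))"
      unfolding pw2 using \<sigma> by (intro mult_right_mono powr_mono) auto
    finally have "ennreal (trunc_sq y / norm y powr (n + \<sigma>))
      \<le> ennreal (2 ^ DIM('a) * ((2 powr (2 - n - \<sigma>)) powr (- real k))) * indicator (ball 0 ((1/2)^k)) y"
      using k2 by (simp add: ennreal_leI)
    also have "\<dots> \<le> (\<Sum>k. ennreal (2 ^ DIM('a) * ((2 powr (2 - n - \<sigma>)) powr (- real k))) * indicator (ball 0 ((1/2)^k)) y)"
      by (rule term_le)
    finally show ?thesis by (rule order_trans) simp
  next
    case 3
    define k where "k = (LEAST k. norm y < 2^k)"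
    have "\<exists>k. norm y < 2^k" using real_arch_pow[of 2 "norm y"] by auto
    then have k1: "norm y < 2^k" unfolding k_def by (rule LeastI_ex)
    \<comment> \<open>The exponent is real, so k = 0 is not truncated; that case is contradictory
      since |y| \<ge> 1.\<close>
    have k2: "2 powr (real k - 1) \<le> norm y"
    proof (cases k)
      case 0 then show ?thesis using k1 3 by simp
    next
      case (Suc j)
      then have "2^j \<le> norm y" using not_less_Least[of j "\<lambda>k. norm y < 2^k"] by (simp add: k_def not_less)
      then show ?thesis using Suc by (simp add: powr_realpow)
    qed
    have "trunc_sq y / norm y powr (n + \<sigma>) \<le> 1 / norm y powr (n + \<sigma>)"
      by (intro divide_right_mono) (auto simp: trunc_sq_def)
    also have "\<dots> = norm y powr (- (n + \<sigma>))" using 3 by (simp only: powr_minus_divide)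
    also have "\<dots> \<le> (2 powr (real k - 1)) powr (- (n + \<sigma>))"
      using k2 \<sigma> by (intro powr_mono2') (auto simp: n_def)
    also have "\<dots> = 2 powr (n + \<sigma>) * ((2 powr (- n - \<sigma>)) powr (real k))"
      unfolding powr_powr powr_add[symmetric] by (simp add: algebra_simps)
    also have "\<dots> \<le> 2 ^ (DIM('a) + 2) * ((2 powr (- n - \<sigma>)) powr (real k))"
    proof (intro mult_right_mono)
      have "2 powr (n + \<sigma>) \<le> 2 powr (n + 2)" using \<sigma> by (intro powr_mono) auto
      then show "2 powr (n + \<sigma>) \<le> 2 ^ (DIM('a) + 2)" unfolding power_add pw2 by (simp add: powr_add)
    qed simp
    finally have "ennreal (trunc_sq y / norm y powr (n + \<sigma>))
      \<le> ennreal (2 ^ (DIM('a) + 2) * ((2 powr (- n - \<sigma>)) powr (real k))) * indicator (ball 0 (2^k)) y"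
      using k1 by (simp add: ennreal_leI)
    also have "\<dots> \<le> (\<Sum>k. ennreal (2 ^ (DIM('a) + 2) * ((2 powr (- n - \<sigma>)) powr (real k))) * indicator (ball 0 (2^k)) y)"
      by (rule term_le)
    finally show ?thesis by (rule order_trans) simp
  qed
qed

text \<open>The volumes r^n of the balls cancel the n in the exponents, leaving geometric ratios
  2^(-(2 - \<sigma>)) for the small balls and 2^(-\<sigma>) for the large ones. Only the first comes
  close to 1 as \<sigma> tends to 2.\<close>

lemma nn_integral_trunc_sq_powr:
  fixes \<sigma> :: real
  assumes \<sigma>: "1 < \<sigma>" "\<sigma> < 2"
  shows "(\<integral>\<^sup>+y. ennreal (trunc_sq y / norm (y::'a::euclidean_space) powr (real DIM('a) + \<sigma>)) \<partial>lborel)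
     \<le> ennreal (2 ^ (DIM('a) + 4) * vol1 TYPE('a) / (2 - \<sigma>))"
proof -
  define n where "n = real DIM('a)"
  define V where "V = vol1 TYPE('a)"
  have V: "0 < V" by (simp add: V_def vol1_pos)
  have geo: "(\<Sum>k. ennreal (c * (2 powr (- s)) ^ k)) = ennreal (c / (1 - 2 powr (- s)))" if "0 < s" "0 \<le> c" for s c :: real
  proof -
    have "2 powr (- s) < 1" using that by (simp add: powr_less_one)
    then have "(\<lambda>k. c * (2 powr (- s)) ^ k) sums (c * (1 / (1 - 2 powr (- s))))"
      by (intro sums_mult geometric_sums) simp
    then show ?thesis using that by (subst suminf_ennreal_eq) auto
  qed
  have pw: "(2 powr s) ^ k = 2 powr (s * real k)" for s :: real and k by (simp add: powr_powr[symmetric] powr_realpow)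
  have "(\<integral>\<^sup>+y. ennreal (trunc_sq y / norm (y::'a) powr (n + \<sigma>)) \<partial>lborel)
    \<le> (\<integral>\<^sup>+y. (\<Sum>k. ennreal (2 ^ DIM('a) * ((2 powr (2 - n - \<sigma>)) powr (- real k))) * indicator (ball (0::'a) ((1/2)^k)) y)
    + (\<Sum>k. ennreal (2 ^ (DIM('a) + 2) * ((2 powr (- n - \<sigma>)) powr (real k))) * indicator (ball (0::'a) (2^k)) y) \<partial>lborel)"
    unfolding n_def by (intro nn_integral_mono trunc_sq_powr_le \<sigma>)
  also have "\<dots> = (\<Sum>k. ennreal (2 ^ DIM('a) * ((2 powr (2 - n - \<sigma>)) powr (- real k))) * emeasure lborel (ball (0::'a) ((1/2)^k)))
    + (\<Sum>k. ennreal (2 ^ (DIM('a) + 2) * ((2 powr (- n - \<sigma>)) powr (real k))) * emeasure lborel (ball (0::'a) (2^k)))"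
  proof -
    have t: "(\<integral>\<^sup>+y. (\<Sum>k. a k * indicator (ball (0::'a) (r k)) y) \<partial>lborel) = (\<Sum>k. a k * emeasure lborel (ball (0::'a) (r k)))"
      for a :: "nat \<Rightarrow> ennreal" and r :: "nat \<Rightarrow> real"
    proof -
      have [measurable]: "ball (0::'a) (r k) \<in> sets borel" for k by simp
      have "(\<integral>\<^sup>+y. (\<Sum>k. a k * indicator (ball (0::'a) (r k)) y) \<partial>lborel) = (\<Sum>k. \<integral>\<^sup>+y. a k * indicator (ball (0::'a) (r k)) y \<partial>lborel)"
        by (rule nn_integral_suminf) measurable
      then show ?thesis by (simp add: nn_integral_cmult_indicator)
    qed
    have [measurable]: "ball (0::'a) r \<in> sets borel" for r by simp
    show ?thesis by (subst nn_integral_add) (measurable, simp only: t)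
  qed
  also have "(\<lambda>k. ennreal (2 ^ DIM('a) * ((2 powr (2 - n - \<sigma>)) powr (- real k))) * emeasure lborel (ball (0::'a) ((1/2)^k)))
      = (\<lambda>k. ennreal ((2 ^ DIM('a) * V) * (2 powr (- (2 - \<sigma>))) ^ k))"
  proof
    fix k
    have "((1/2)^k) ^ DIM('a) = 2 powr (- n * real k)"
      by (simp add: n_def powr_minus powr_realpow[symmetric] power_one_over inverse_eq_divide power_mult[symmetric] powr_powr mult.commute)
    then have "2 ^ DIM('a) * ((2 powr (2 - n - \<sigma>)) powr (- real k)) * (V * ((1/2)^k) ^ DIM('a))
        = (2 ^ DIM('a) * V) * (2 powr (- (2 - \<sigma>))) ^ k"
      unfolding pw powr_powr by (simp add: powr_add[symmetric] algebra_simps)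
    then show "ennreal (2 ^ DIM('a) * ((2 powr (2 - n - \<sigma>)) powr (- real k))) * emeasure lborel (ball (0::'a) ((1/2)^k))
      = ennreal ((2 ^ DIM('a) * V) * (2 powr (- (2 - \<sigma>))) ^ k)"
      using V by (simp add: emeasure_ball0 V_def[symmetric] ennreal_mult'[symmetric])
  qed
  also have "(\<lambda>k. ennreal (2 ^ (DIM('a) + 2) * ((2 powr (- n - \<sigma>)) powr (real k))) * emeasure lborel (ball (0::'a) (2^k)))
      = (\<lambda>k. ennreal ((2 ^ (DIM('a) + 2) * V) * (2 powr (- \<sigma>)) ^ k))"
  proof
    fix k
    have "((2::real)^k) ^ DIM('a) = 2 powr (n * real k)"
      by (simp add: n_def powr_realpow[symmetric] power_mult[symmetric] powr_powr mult.commute)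
    then have "2 ^ (DIM('a) + 2) * ((2 powr (- n - \<sigma>)) powr (real k)) * (V * (2^k) ^ DIM('a))
        = (2 ^ (DIM('a) + 2) * V) * (2 powr (- \<sigma>)) ^ k"
      unfolding pw powr_powr by (simp add: powr_add[symmetric] algebra_simps)
    then show "ennreal (2 ^ (DIM('a) + 2) * ((2 powr (- n - \<sigma>)) powr (real k))) * emeasure lborel (ball (0::'a) (2^k))
      = ennreal ((2 ^ (DIM('a) + 2) * V) * (2 powr (- \<sigma>)) ^ k)"
      using V by (simp add: emeasure_ball0 V_def[symmetric] ennreal_mult'[symmetric])
  qed
  also have "(\<Sum>k. ennreal ((2 ^ DIM('a) * V) * (2 powr (- (2 - \<sigma>))) ^ k)) = ennreal (2 ^ DIM('a) * V / (1 - 2 powr (- (2 - \<sigma>))))"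
    using \<sigma> V by (intro geo) auto
  also have "(\<Sum>k. ennreal ((2 ^ (DIM('a) + 2) * V) * (2 powr (- \<sigma>)) ^ k)) = ennreal (2 ^ (DIM('a) + 2) * V / (1 - 2 powr (- \<sigma>)))"
    using \<sigma> V by (intro geo) auto
  also have "ennreal (2 ^ DIM('a) * V / (1 - 2 powr (- (2 - \<sigma>)))) + ennreal (2 ^ (DIM('a) + 2) * V / (1 - 2 powr (- \<sigma>)))
     \<le> ennreal (2 ^ (DIM('a) + 4) * V / (2 - \<sigma>))"
  proof -
    define P where "P = 2 ^ DIM('a) * V"
    have P: "0 < P" using V by (simp add: P_def)
    have a: "(2 - \<sigma>) / 2 \<le> 1 - 2 powr (- (2 - \<sigma>))" using \<sigma> by (intro one_minus_powr_ge) auto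
    have "2 powr (- \<sigma>) \<le> 2 powr (- 1)" using \<sigma> by (intro powr_mono) auto
    moreover have "(2::real) powr (- 1) = 1 / 2" by (simp add: powr_minus_divide)
    ultimately have b: "1 / 2 \<le> 1 - 2 powr (- \<sigma>)" by linarith
    \<comment> \<open>The two series are at most 2P / (2 - \<sigma>) and 8P, together at most 10P /
      (2 - \<sigma>) because 2 - \<sigma> \<le> 1; rounding 10 up to 16 = 2^4 gives the exponent n +
      4.\<close>
    have "P / (1 - 2 powr (- (2 - \<sigma>))) + 4 * P / (1 - 2 powr (- \<sigma>)) \<le> P / ((2 - \<sigma>) / 2) + 4 * P / (1 / 2)"
      using a b P \<sigma> by (intro add_mono divide_left_mono mult_pos_pos) auto
    also have "\<dots> \<le> 16 * P / (2 - \<sigma>)"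
    proof -
      have "8 * P * (2 - \<sigma>) \<le> 8 * P * 1" using P \<sigma> by (intro mult_left_mono) auto
      then have "(P / ((2 - \<sigma>) / 2) + 4 * P / (1 / 2)) * (2 - \<sigma>) \<le> 16 * P"
        using P \<sigma> by (simp add: distrib_right)
      then show ?thesis using \<sigma> by (simp add: pos_le_divide_eq)
    qed
    finally have "P / (1 - 2 powr (- (2 - \<sigma>))) + 4 * P / (1 - 2 powr (- \<sigma>)) \<le> 16 * P / (2 - \<sigma>)" .
    moreover have "0 \<le> P / (1 - 2 powr (- (2 - \<sigma>)))" "0 \<le> 4 * P / (1 - 2 powr (- \<sigma>))"
      using P a b \<sigma> by (auto intro!: divide_nonneg_nonneg)
    ultimately show ?thesis
      by (simp add: P_def power_add mult_ac ennreal_plus[symmetric] ennreal_leI del: ennreal_plus)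
  qed
  finally show ?thesis by (simp add: n_def V_def)
qed

context frac_kernel
begin

lemma Lam_nonneg: "0 \<le> Lam"
proof -
  obtain e :: 'a where e: "e \<in> Basis" using nonempty_Basis by blast
  have "(2 - \<sigma>) * lam \<le> (2 - \<sigma>) * Lam" using lower[of e] upper[of e] e by simp
  then show ?thesis using lam \<sigma> by simp
qed

text \<open>The factor 2 - \<sigma> of the upper kernel bound cancels the denominator of
  \<open>nn_integral_trunc_sq_powr\<close>, so the bound on \<open>kmass K\<close> is free of
  \<sigma>.\<close>

lemma trunc_sq_K: "integrable lborel (\<lambda>y. trunc_sq y * K y)"
    "kmass K \<le> Lam * (2 ^ (DIM('a) + 4) * vol1 TYPE('a))" "0 \<le> K y"
proof -
  have K0: "0 \<le> K y" for y by (rule order_trans[OF _ lower]) (use \<sigma> lam in simp)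
  then show "0 \<le> K y" .
  have [measurable]: "K \<in> borel_measurable borel" by (rule borel_K)
  have "(\<integral>\<^sup>+y. ennreal (trunc_sq y * K y) \<partial>lborel)
    \<le> (\<integral>\<^sup>+y. ennreal ((2 - \<sigma>) * Lam) * ennreal (trunc_sq y / norm (y::'a) powr (real DIM('a) + \<sigma>)) \<partial>lborel)"
  proof (rule nn_integral_mono)
    fix y :: 'a
    have "trunc_sq y * K y \<le> trunc_sq y * ((2 - \<sigma>) * Lam / norm y powr (real DIM('a) + \<sigma>))"
      by (intro mult_left_mono upper) simp
    then show "ennreal (trunc_sq y * K y) \<le> ennreal ((2 - \<sigma>) * Lam) * ennreal (trunc_sq y / norm (y::'a) powr (real DIM('a) + \<sigma>))"
      using \<sigma> Lam_nonneg by (simp add: ennreal_mult'[symmetric] ennreal_leI mult_ac)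
  qed
  also have "\<dots> = ennreal ((2 - \<sigma>) * Lam) * (\<integral>\<^sup>+y. ennreal (trunc_sq y / norm (y::'a) powr (real DIM('a) + \<sigma>)) \<partial>lborel)"
    by (rule nn_integral_cmult) measurable
  also have "\<dots> \<le> ennreal ((2 - \<sigma>) * Lam) * ennreal (2 ^ (DIM('a) + 4) * vol1 TYPE('a) / (2 - \<sigma>))"
    by (intro mult_left_mono nn_integral_trunc_sq_powr \<sigma>) simp
  also have "\<dots> = ennreal (Lam * (2 ^ (DIM('a) + 4) * vol1 TYPE('a)))"
    using \<sigma> Lam_nonneg vol1_pos[where 'a='a] by (subst ennreal_mult'[symmetric]) auto
  finally have le: "(\<integral>\<^sup>+y. ennreal (trunc_sq y * K y) \<partial>lborel) \<le> ennreal (Lam * (2 ^ (DIM('a) + 4) * vol1 TYPE('a)))" .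
  show i: "integrable lborel (\<lambda>y. trunc_sq y * K y)"
    using order.strict_trans1[OF le ennreal_less_top] K0 by (intro integrableI_bounded) auto
  show "kmass K \<le> Lam * (2 ^ (DIM('a) + 4) * vol1 TYPE('a))"
    using le K0 Lam_nonneg vol1_pos[where 'a='a] unfolding kmass_def
    by (subst (asm) nn_integral_eq_integral[OF i]) (auto simp: ennreal_le_iff)
qed

sublocale levy_kernel K
  by unfold_locales (use borel_K trunc_sq_K in auto)

text \<open>For d \<le> 1 the exponent \<sigma> may be raised to 2, which removes \<sigma> from the
  bound.\<close>

lemma K_far:
  assumes "0 < d" "d \<le> 1" "d \<le> norm y"
  shows "K y \<le> Lam / d ^ (DIM('a) + 2)"
proof -
  have "K y \<le> (2 - \<sigma>) * Lam / norm y powr (real DIM('a) + \<sigma>)" by (rule upper)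
  also have "\<dots> \<le> (2 - \<sigma>) * Lam / d powr (real DIM('a) + \<sigma>)"
    using assms \<sigma> Lam_nonneg by (intro divide_left_mono powr_mono2 mult_pos_pos) auto
  also have "\<dots> \<le> Lam / d powr (real DIM('a) + \<sigma>)"
    using \<sigma> Lam_nonneg by (intro divide_right_mono) (auto simp: mult_left_le_one_le)
  also have "\<dots> \<le> Lam / d powr (real DIM('a) + 2)"
    using assms \<sigma> Lam_nonneg by (intro divide_left_mono powr_mono' mult_pos_pos) auto
  also have "d powr (real DIM('a) + 2) = d ^ (DIM('a) + 2)"
    using assms powr_realpow[of d "DIM('a) + 2"] by (simp add: add.commute)
  finally show ?thesis .
qed

end

section \<open>A Nash-type inequality\<close>

lemma L2_shift_diff:
  assumes "C11c v" shows "integrable lborel (\<lambda>x. (v (x + y) - v x)\<^sup>2)"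
  using C11c_L2[OF C11c_lin[OF C11c_shift[OF assms, of y] assms, of "-1"]] by (simp add: L2_in_def)

text \<open>A step of 2y is two steps of y. The factor 4 = 2^2 is the growth of a quadratic
  function, and this exact power is what yields 2^(2 - \<sigma>) after rescaling in
  \<open>shell_energy\<close>.\<close>

lemma diff_energy_double:
  fixes v :: "'a::euclidean_space \<Rightarrow> real"
  assumes v: "C11c v"
  shows "(LBINT x. (v (x + 2 *\<^sub>R y) - v x)\<^sup>2) \<le> 4 * (LBINT x. (v (x + y) - v x)\<^sup>2)"
proof -
  have [measurable]: "v \<in> borel_measurable borel" using v by measurable
  note i = L2_shift_diff[OF v]
  note j = integrable_lborel_shift(1)[OF i[of y], of y]
  have "(LBINT x. (v (x + 2 *\<^sub>R y) - v x)\<^sup>2)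
      \<le> (LBINT x. 2 * (v (x + y + y) - v (x + y))\<^sup>2 + 2 * (v (x + y) - v x)\<^sup>2)"
  proof (rule integral_mono)
    fix x
    have "x + 2 *\<^sub>R y = x + y + y" by (simp add: scaleR_2 add.assoc)
    moreover have "(a + b)\<^sup>2 \<le> 2 * a\<^sup>2 + 2 * b\<^sup>2" for a b :: real
      using sum_squares_bound[of a b] by (simp add: power2_sum)
    from this[of "v (x + y + y) - v (x + y)" "v (x + y) - v x"]
    have "(v (x + y + y) - v x)\<^sup>2 \<le> 2 * (v (x + y + y) - v (x + y))\<^sup>2 + 2 * (v (x + y) - v x)\<^sup>2" by simp
    ultimately show "(v (x + 2 *\<^sub>R y) - v x)\<^sup>2 \<le> 2 * (v (x + y + y) - v (x + y))\<^sup>2 + 2 * (v (x + y) - v x)\<^sup>2"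
      by (simp only:)
  qed (use i j in auto)
  also have "\<dots> = 4 * (LBINT x. (v (x + y) - v x)\<^sup>2)"
    using i j integral_lborel_shift(1)[of "\<lambda>x. (v (x + y) - v x)\<^sup>2" y] by simp
  finally show ?thesis .
qed

context frac_kernel
begin

text \<open>Rescaling by 2 shows that the energy in the ball of radius \<open>\<delta>\<close> is at most
  \<open>2 powr (2 - \<sigma>)\<close> times the energy in the ball of radius \<open>\<delta> / 2\<close>.  Hence the shell between them
  carries only a fraction \<open>2 - \<sigma>\<close> of the energy, which is the uniformity as \<open>\<sigma>\<close> tends to 2.\<close>

lemma shell_energy:
  assumes v: "C11c v" and \<delta>: "0 < \<delta>"
  shows "lam * (LBINT y. (LBINT x. (v (x + y) - v x)\<^sup>2) * indicator (ball 0 \<delta> - ball 0 (\<delta>/2)) y)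
     \<le> \<delta> powr (real DIM('a) + \<sigma>) * - (LBINT x. v x * Lop K v x)"
proof -
  have [measurable]: "v \<in> borel_measurable borel" using v by measurable
  have [measurable]: "ball (0::'a) r \<in> sets borel" for r by simp
  define p where "p = real DIM('a) + \<sigma>"
  have p: "0 < p" using \<sigma> by (simp add: p_def)
  define a where "a y = (LBINT x. (v (x + y) - v x)\<^sup>2)" for y
  have [measurable]: "a \<in> borel_measurable borel" unfolding a_def[abs_def] by measurable
  have a0: "0 \<le> a y" for y by (simp add: a_def)
  define q where "q y = a y / norm y powr p" for y
  have [measurable]: "q \<in> borel_measurable borel" unfolding q_def[abs_def] by measurable
  have q0: "0 \<le> q y" for y by (simp add: q_def a0)
  have s: "0 < 2 - \<sigma>" using \<sigma> by simp
  have en: "integrable lborel (\<lambda>y. a y * K y)" "(LBINT y. a y * K y) = - (LBINT x. v x * Lop K v x)"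
    using energy[OF v] by (simp_all add: a_def)
  have qK: "(2 - \<sigma>) * lam * q y \<le> a y * K y" for y
    using mult_left_mono[OF lower[of y] a0[of y]] by (simp add: q_def p_def mult_ac)
  have qi: "integrable lborel q"
  proof (rule Bochner_Integration.integrable_bound)
    show "integrable lborel (\<lambda>y. a y * K y / ((2 - \<sigma>) * lam))" using en(1) by simp
    have "q y \<le> a y * K y / ((2 - \<sigma>) * lam)" for y
      using qK[of y] s lam by (simp add: pos_le_divide_eq mult.commute mult.left_commute)
    then show "AE y in lborel. norm (q y) \<le> norm (a y * K y / ((2 - \<sigma>) * lam))"
      using q0 by (intro AE_I2) (simp only: real_norm_def abs_of_nonneg order_trans[OF _ abs_ge_self])
  qed measurable
  define F where "F r = (LBINT y. q y * indicator (ball 0 r) y)" for r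
  have Fi: "integrable lborel (\<lambda>y. q y * indicator (ball 0 r) y)" for r
    using integrable_mult_indicator[OF _ qi, of "ball 0 r"] by (simp add: mult.commute)
  have F0: "0 \<le> F r" for r unfolding F_def by (intro integral_nonneg_AE) (simp add: q0)
  \<comment> \<open>The substitution y = 2y' contributes 2^n, doubling the increment contributes 4,
    and the weight contributes 2^(-n - \<sigma>).\<close>
  have F_le: "F \<delta> \<le> 2 powr (2 - \<sigma>) * F (\<delta>/2)"
  proof -
    have "F \<delta> = 2 ^ DIM('a) * (LBINT y. q (2 *\<^sub>R y) * indicator (ball 0 \<delta>) (2 *\<^sub>R y))"
      unfolding F_def by (subst integral_lborel_affine[of 2 _ 0]) auto
    also have "\<dots> \<le> 2 ^ DIM('a) * (LBINT y. 2 powr (2 - p) * (q y * indicator (ball 0 (\<delta>/2)) y))"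
    proof (intro mult_left_mono integral_mono)
      show "integrable lborel (\<lambda>y. q (2 *\<^sub>R y) * indicator (ball 0 \<delta>) (2 *\<^sub>R y))"
        using integrable_lborel_affine[OF Fi[of \<delta>], of 2 0] by simp
      show "integrable lborel (\<lambda>y. 2 powr (2 - p) * (q y * indicator (ball 0 (\<delta>/2)) y))" using Fi by simp
      fix y :: 'a
      have "q (2 *\<^sub>R y) \<le> (4 * a y) / norm (2 *\<^sub>R y) powr p"
        unfolding q_def a_def by (intro divide_right_mono diff_energy_double[OF v]) simp
      also have "\<dots> = 2 powr (2 - p) * q y" by (simp add: q_def powr_mult powr_diff)
      finally show "q (2 *\<^sub>R y) * indicator (ball 0 \<delta>) (2 *\<^sub>R y)
        \<le> 2 powr (2 - p) * (q y * indicator (ball 0 (\<delta>/2)) y)"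
        by (auto simp: indicator_def)
    qed simp
    also have "\<dots> = 2 powr (2 - \<sigma>) * F (\<delta>/2)"
    proof -
      have "(2::real) ^ DIM('a) * 2 powr (2 - p) = 2 powr (2 - \<sigma>)"
        by (simp add: powr_realpow[symmetric] powr_add[symmetric] p_def)
      then show ?thesis unfolding F_def integral_mult_right_zero by (metis mult.assoc)
    qed
    finally show ?thesis .
  qed
  have sh: "F \<delta> - F (\<delta>/2) \<le> (2 - \<sigma>) * F \<delta>"
  proof -
    have "2 powr (- (2 - \<sigma>)) * F \<delta> \<le> 2 powr (- (2 - \<sigma>)) * (2 powr (2 - \<sigma>) * F (\<delta>/2))"
      by (intro mult_left_mono F_le) simp
    also have "\<dots> = F (\<delta>/2)" by (simp add: mult.assoc[symmetric] powr_add[symmetric])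
    finally have "F \<delta> - F (\<delta>/2) \<le> (1 - 2 powr (- (2 - \<sigma>))) * F \<delta>" by (simp add: algebra_simps)
    also have "\<dots> \<le> (2 - \<sigma>) * F \<delta>" using s by (intro mult_right_mono F0 one_minus_powr_le) simp
    finally show ?thesis .
  qed
  have "(LBINT y. a y * indicator (ball 0 \<delta> - ball 0 (\<delta>/2)) y)
    \<le> (LBINT y. \<delta> powr p * (q y * indicator (ball 0 \<delta>) y - q y * indicator (ball 0 (\<delta>/2)) y))"
  proof (rule integral_mono')
    show "integrable lborel (\<lambda>y. \<delta> powr p * (q y * indicator (ball 0 \<delta>) y - q y * indicator (ball 0 (\<delta>/2)) y))"
      using Fi by simp
    fix y :: 'a
    have sub: "y \<in> ball 0 (\<delta>/2) \<Longrightarrow> y \<in> ball 0 \<delta>" using \<delta> by simp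
    have "a y \<le> \<delta> powr p * q y" if "y \<in> ball 0 \<delta>" "y \<notin> ball 0 (\<delta>/2)"
    proof -
      have y: "0 < norm y" "norm y \<le> \<delta>" using that \<delta> by (auto simp: not_less)
      have "a y = norm y powr p * q y" using y by (simp add: q_def)
      also have "\<dots> \<le> \<delta> powr p * q y" using y p by (intro mult_right_mono powr_mono2 q0) auto
      finally show ?thesis .
    qed
    then show "a y * indicator (ball 0 \<delta> - ball 0 (\<delta>/2)) y
      \<le> \<delta> powr p * (q y * indicator (ball 0 \<delta>) y - q y * indicator (ball 0 (\<delta>/2)) y)"
      using sub by (auto simp: indicator_def)
    show "0 \<le> \<delta> powr p * (q y * indicator (ball 0 \<delta>) y - q y * indicator (ball 0 (\<delta>/2)) y)"
      using sub q0[of y] by (auto simp: indicator_def)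
  qed
  also have "\<dots> = \<delta> powr p * (F \<delta> - F (\<delta>/2))" using Fi by (simp add: F_def)
  also have "\<dots> \<le> \<delta> powr p * ((2 - \<sigma>) * F \<delta>)" by (intro mult_left_mono sh) simp
  finally have "lam * (LBINT y. a y * indicator (ball 0 \<delta> - ball 0 (\<delta>/2)) y)
      \<le> lam * (\<delta> powr p * ((2 - \<sigma>) * F \<delta>))"
    using lam by (intro mult_left_mono) auto
  \<comment> \<open>The factor 2 - \<sigma> gained on the shell is exactly the one in the lower
    kernel bound, so passing from the weight to K costs no division by 2 - \<sigma>.\<close>
  also have "\<dots> = \<delta> powr p * ((2 - \<sigma>) * lam * F \<delta>)" by simp
  also have "(2 - \<sigma>) * lam * F \<delta> \<le> (LBINT y. a y * K y)"
  proof -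
    have "(2 - \<sigma>) * lam * F \<delta> = (LBINT y. (2 - \<sigma>) * lam * (q y * indicator (ball 0 \<delta>) y))"
      by (simp add: F_def)
    also have "\<dots> \<le> (LBINT y. a y * K y)"
    proof (rule integral_mono')
      show "integrable lborel (\<lambda>y. a y * K y)" by (rule en)
      fix y
      show "0 \<le> a y * K y" using a0 K_nonneg by simp
      then show "(2 - \<sigma>) * lam * (q y * indicator (ball 0 \<delta>) y) \<le> a y * K y"
        using qK[of y] by (auto simp: indicator_def)
    qed
    finally show ?thesis .
  qed
  finally show ?thesis using en(2) by (simp add: a_def p_def mult_left_mono)
qed

text \<open>For every shift y the square of \<open>l2 v\<close> is at most the squared norm of v (x
  + y) - v x plus twice the correlation of |v| with its shift. Averaged over the shell \<delta>/2
  \<le> |y| < \<delta>, the first term is controlled by the energy and the correlations by the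
  square of \<open>l1 v\<close>. A shell replaces the usual ball because there the energy bound is
  uniform in \<sigma>.\<close>

lemma nash_L2:
  assumes v: "C11c v" and \<delta>: "0 < \<delta>" "\<delta> \<le> 1"
  shows "l2 v \<le> (2 / (vol1 TYPE('a) * lam)) * \<delta> * l2 (Lop K v)
     + (2 / sqrt (vol1 TYPE('a))) * l1 v / \<delta> ^ DIM('a)"
proof -
  have [measurable]: "v \<in> borel_measurable borel" using v by measurable
  have [measurable]: "ball (0::'a) r \<in> sets borel" for r by simp
  define V where "V = vol1 TYPE('a)"
  have V: "0 < V" by (simp add: V_def vol1_pos)
  define a where "a y = (LBINT x. (v (x + y) - v x)\<^sup>2)" for y
  have [measurable]: "a \<in> borel_measurable borel" unfolding a_def[abs_def] by measurable
  define c where "c y = (LBINT x. \<bar>v x\<bar> * \<bar>v (x + y)\<bar>)" for y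
  define N1 where "N1 = l1 v"
  have N1: "0 \<le> N1" by (simp add: N1_def)
  define S where "S = ball (0::'a) \<delta> - ball 0 (\<delta>/2)"
  have [measurable]: "S \<in> sets borel" unfolding S_def by measurable
  define X where "X = l2 v"
  define Y where "Y = l2 (Lop K v)"
  have X0: "0 \<le> X" and Y0: "0 \<le> Y" by (auto simp: X_def Y_def)
  note vi = C11c_integrable[OF v] and vL2 = C11c_L2[OF v]
  note di = L2_shift_diff[OF v]
  have vv: "integrable lborel (\<lambda>x. \<bar>v x\<bar> * \<bar>v (x + y)\<bar>)" for y
    using L2_mult_integrable[OF L2_abs[OF vL2] L2_abs[OF C11c_L2[OF C11c_shift[OF v, of y]]]] .
  have pt: "X\<^sup>2 \<le> a y + 2 * c y" for y
  proof -
    have "X\<^sup>2 \<le> (LBINT x. (v (x + y) - v x)\<^sup>2 + 2 * (\<bar>v x\<bar> * \<bar>v (x + y)\<bar>))"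
      unfolding X_def l2_sq
    proof (rule integral_mono)
      fix x
      have "(v x)\<^sup>2 \<le> (v (x + y) - v x)\<^sup>2 + 2 * (v x * v (x + y))" by (simp add: power2_diff)
      also have "v x * v (x + y) \<le> \<bar>v x\<bar> * \<bar>v (x + y)\<bar>" by (simp add: abs_mult[symmetric])
      finally show "(v x)\<^sup>2 \<le> (v (x + y) - v x)\<^sup>2 + 2 * (\<bar>v x\<bar> * \<bar>v (x + y)\<bar>)" by simp
    qed (use vL2 di vv in auto)
    then show ?thesis using di vv by (simp add: a_def c_def)
  qed
  have cpair: "integrable (lborel \<Otimes>\<^sub>M lborel) (\<lambda>(x, y). \<bar>v x\<bar> * \<bar>v (x + y)\<bar>)"
  proof (rule lborel_pair.Fubini_integrable)
    have "(LBINT y. norm (case (x, y) of (x, y) \<Rightarrow> \<bar>v x\<bar> * \<bar>v (x + y)\<bar>)) = \<bar>v x\<bar> * N1" for x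
      using integral_lborel_shift(2)[of "\<lambda>x. \<bar>v x\<bar>" x] by (simp add: N1_def abs_mult)
    then show "integrable lborel (\<lambda>x. LBINT y. norm (case (x, y) of (x, y) \<Rightarrow> \<bar>v x\<bar> * \<bar>v (x + y)\<bar>))"
      using vi by (simp only: integrable_mult_left integrable_abs)
    show "AE x in lborel. integrable lborel (\<lambda>y. case (x, y) of (x, y) \<Rightarrow> \<bar>v x\<bar> * \<bar>v (x + y)\<bar>)"
      using integrable_lborel_shift(2)[OF vi] by auto
  qed measurable
  have ci: "integrable lborel c" and cN: "(LBINT y. c y) = N1\<^sup>2"
  proof -
    show "integrable lborel c"
      unfolding c_def[abs_def] using lborel_pair.integrable_snd[of "\<lambda>x y. \<bar>v x\<bar> * \<bar>v (x + y)\<bar>"] cpair by simp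
    have "(LBINT y. c y) = (LBINT x. (LBINT y. \<bar>v x\<bar> * \<bar>v (x + y)\<bar>))"
      unfolding c_def by (rule lborel_pair.Fubini_integral[OF cpair])
    also have "\<dots> = (LBINT x. \<bar>v x\<bar> * N1)"
      using integral_lborel_shift(2)[of "\<lambda>x. \<bar>v x\<bar>"] by (simp add: N1_def)
    finally show "(LBINT y. c y) = N1\<^sup>2" by (simp add: N1_def power2_eq_square)
  qed
  have c0: "0 \<le> c y" for y by (simp add: c_def)
  have a0: "0 \<le> a y" for y by (simp add: a_def)
  have aX: "a y \<le> 4 * X\<^sup>2" for y
  proof -
    note i1 = vL2[THEN L2D(2)] and i2 = integrable_lborel_shift(1)[OF vL2[THEN L2D(2)], of y]
    have "a y \<le> (LBINT x. 2 * (v (x + y))\<^sup>2 + 2 * (v x)\<^sup>2)"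
      unfolding a_def
    proof (rule integral_mono)
      fix x
      have "0 \<le> (v (x + y) + v x)\<^sup>2" by simp
      then show "(v (x + y) - v x)\<^sup>2 \<le> 2 * (v (x + y))\<^sup>2 + 2 * (v x)\<^sup>2" by (simp add: power2_sum power2_diff)
    qed (use di i1 i2 in auto)
    also have "\<dots> = 4 * X\<^sup>2"
      using i1 i2 integral_lborel_shift(1)[of "\<lambda>x. (v x)\<^sup>2" y] unfolding X_def l2_sq by simp
    finally show ?thesis .
  qed
  have Sfin: "emeasure lborel S < \<infinity>"
  proof -
    have "emeasure lborel S \<le> emeasure lborel (ball (0::'a) \<delta>)" by (intro emeasure_mono) (auto simp: S_def)
    also have "\<dots> < \<infinity>" using \<delta> by (simp add: emeasure_ball0)
    finally show ?thesis .
  qed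
  have Si: "integrable lborel (\<lambda>y. r * indicator S y)" for r :: real
    using Sfin by (intro integrable_mult_right integrable_real_indicator) auto
  have ai: "integrable lborel (\<lambda>y. a y * indicator S y)"
    by (rule Bochner_Integration.integrable_bound[OF Si[of "4 * X\<^sup>2"]])
      (use aX a0 in \<open>auto simp: indicator_def\<close>)
  have "(LBINT y. X\<^sup>2 * indicator S y) \<le> (LBINT y. a y * indicator S y + 2 * c y)"
    by (rule integral_mono) (use Si ai ci pt c0 in \<open>auto simp: indicator_def\<close>)
  then have 1: "X\<^sup>2 * measure lborel S \<le> (LBINT y. a y * indicator S y) + 2 * N1\<^sup>2"
    using ai ci by (simp add: cN)
  \<comment> \<open>The inner ball takes the fraction 2^(-n) \<le> 1/2 of the volume.\<close>
  have mS: "V * \<delta> ^ DIM('a) / 2 \<le> measure lborel S"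
  proof -
    have "measure lborel S = measure lborel (ball (0::'a) \<delta>) - measure lborel (ball (0::'a) (\<delta>/2))"
      unfolding S_def using \<delta> by (intro measure_Diff) (auto simp: emeasure_ball0)
    also have "\<dots> = V * \<delta> ^ DIM('a) - V * (\<delta>/2) ^ DIM('a)"
      using \<delta> V by (simp add: measure_def emeasure_ball0 V_def)
    finally have e: "measure lborel S = V * \<delta> ^ DIM('a) - V * (\<delta>/2) ^ DIM('a)" .
    have "(1/2::real) ^ DIM('a) \<le> (1/2) ^ 1" by (intro power_decreasing) (auto simp: Suc_leI DIM_positive)
    then have "V * \<delta> ^ DIM('a) * (1/2) ^ DIM('a) \<le> V * \<delta> ^ DIM('a) * (1/2)"
      using V \<delta> by (intro mult_left_mono) auto
    then have "V * (\<delta>/2) ^ DIM('a) \<le> V * \<delta> ^ DIM('a) / 2"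
      by (simp add: power_divide)
    then show ?thesis using e by linarith
  qed
  have 2: "lam * (LBINT y. a y * indicator S y) \<le> \<delta> ^ DIM('a) * \<delta> * (X * Y)"
  proof -
    have "lam * (LBINT y. a y * indicator S y) \<le> \<delta> powr (real DIM('a) + \<sigma>) * - (LBINT x. v x * Lop K v x)"
      using shell_energy[OF v \<delta>(1)] by (simp add: a_def S_def)
    also have "\<dots> \<le> \<delta> powr (real DIM('a) + \<sigma>) * (X * Y)"
      using l2_Cauchy_Schwarz[OF vL2 Lop_L2[OF v]] by (intro mult_left_mono) (auto simp: X_def Y_def)
    \<comment> \<open>This uses \<sigma> > 1 and \<delta> \<le> 1: after division by the volume a
      full factor \<delta> is left, whatever \<sigma> is.\<close>
    also have "\<dots> \<le> (\<delta> ^ DIM('a) * \<delta>) * (X * Y)"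
    proof (rule mult_right_mono)
      have "\<delta> powr (real DIM('a) + \<sigma>) \<le> \<delta> powr (real DIM('a) + 1)"
        using \<delta> \<sigma> by (intro powr_mono') auto
      also have "\<dots> = \<delta> ^ DIM('a) * \<delta>" using \<delta> by (simp add: powr_add powr_realpow)
      finally show "\<delta> powr (real DIM('a) + \<sigma>) \<le> \<delta> ^ DIM('a) * \<delta>" .
    qed (use X0 Y0 in simp)
    finally show ?thesis .
  qed
  define D where "D = \<delta> ^ DIM('a)"
  have D: "0 < D" "D \<le> 1" using \<delta> by (auto simp: D_def power_le_one)
  define P where "P = 2 / (V * lam) * \<delta> * Y"
  define Q where "Q = 2 / sqrt V * N1 / D"
  have PQ: "0 \<le> P" "0 \<le> Q" using V lam \<delta> Y0 N1 D by (auto simp: P_def Q_def)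
  have "X\<^sup>2 * (V * D / 2) \<le> X\<^sup>2 * measure lborel S" using mS by (intro mult_left_mono) (auto simp: D_def)
  also have "\<dots> \<le> D * \<delta> * (X * Y) / lam + 2 * N1\<^sup>2"
    using 1 2 lam by (simp add: D_def pos_le_divide_eq mult.commute) (smt (verit) pos_le_divide_eq mult.commute)
  finally have "X\<^sup>2 \<le> (D * \<delta> * (X * Y) / lam + 2 * N1\<^sup>2) * (2 / (V * D))"
    using V D by (simp add: field_simps)
  also have "\<dots> = P * X + 4 * N1\<^sup>2 / (V * D)"
    using V D lam by (simp add: P_def field_simps)
  \<comment> \<open>Giving away a factor D \<le> 1 turns the term into the square of Q, with an
    integer power of \<delta> in Q.\<close>
  also have "4 * N1\<^sup>2 / (V * D) \<le> 4 * N1\<^sup>2 / (V * (D * D))"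
    using V D by (intro divide_left_mono mult_left_mono mult_pos_pos) (auto simp: mult_le_one)
  also have "\<dots> = Q\<^sup>2"
    using V by (simp add: Q_def power_divide power_mult_distrib power2_eq_square[of D])
  finally have X2: "X * X \<le> P * X + Q\<^sup>2" by (simp add: power2_eq_square)
  have "X \<le> P + Q"
  proof (rule ccontr)
    assume "\<not> X \<le> P + Q"
    then have "(P + Q) * X < X * X" "Q * Q \<le> Q * X"
      using PQ X0 by (auto intro!: mult_strict_right_mono mult_left_mono)
    with X2 show False by (simp add: distrib_right power2_eq_square)
  qed
  then show ?thesis by (simp add: X_def P_def Q_def Y_def N1_def V_def D_def)
qed

end

section \<open>Cutoff functions\<close>

text \<open>The quadratic spline from 0 to 1 with second derivative 4 on (0, 1/2) and -4 on (1/2,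
  1). As a combination of truncated squares it inherits its difference bounds from
  \<open>(max 0 s)\<^sup>2\<close>.\<close>

definition ramp :: "real \<Rightarrow> real" where
  "ramp s = 2 * (max 0 s)\<^sup>2 - 4 * (max 0 (s - 1/2))\<^sup>2 + 2 * (max 0 (s - 1))\<^sup>2"

lemma ramp_eq: "s \<le> 0 \<Longrightarrow> ramp s = 0" "1 \<le> s \<Longrightarrow> ramp s = 1"
  by (auto simp: ramp_def max_def power2_eq_square algebra_simps)

lemma ramp_01: "0 \<le> ramp s" "ramp s \<le> 1"
proof -
  consider "s \<le> 0" | "0 \<le> s" "s \<le> 1/2" | "1/2 \<le> s" "s \<le> 1" | "1 \<le> s" by linarith
  then have "0 \<le> ramp s \<and> ramp s \<le> 1"
  proof cases
    case 2
    then have "ramp s = 2 * s\<^sup>2" by (auto simp: ramp_def max_def)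
    moreover have "s\<^sup>2 \<le> (1/2)\<^sup>2" using 2 by (intro power_mono) auto
    ultimately show ?thesis by (simp add: power2_eq_square)
  next
    case 3
    then have "ramp s = 1 - 2 * (1 - s)\<^sup>2" by (auto simp: ramp_def max_def power2_eq_square algebra_simps)
    moreover have "(1 - s)\<^sup>2 \<le> (1/2)\<^sup>2" using 3 by (intro power_mono) auto
    ultimately show ?thesis by (simp add: power2_eq_square)
  qed (auto simp: ramp_eq)
  then show "0 \<le> ramp s" "ramp s \<le> 1" by auto
qed

lemma ramp_lipschitz: "\<bar>ramp s - ramp r\<bar> \<le> 12 * \<bar>s - r\<bar>"
proof -
  \<comment> \<open>Clamping to [0, 1] changes neither ramp nor increases distances; on that
    interval the third truncated square vanishes and the others have Lipschitz constant at most 2,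
    so 2 * 2 + 4 * 2 = 12.\<close>
  define cl where "cl t = max 0 (min 1 t)" for t :: real
  have cl: "ramp t = ramp (cl t)" "0 \<le> cl t" "cl t \<le> 1" for t
    using ramp_eq[of t] ramp_eq[of "cl t"] by (auto simp: cl_def max_def min_def)
  have q: "\<bar>(max 0 (s - e))\<^sup>2 - (max 0 (r - e))\<^sup>2\<bar> \<le> 2 * \<bar>s - r\<bar>"
    if "0 \<le> s" "s \<le> 1" "0 \<le> r" "r \<le> 1" "0 \<le> e" for s r e :: real
  proof -
    have "\<bar>(max 0 (s - e))\<^sup>2 - (max 0 (r - e))\<^sup>2\<bar> = \<bar>max 0 (s - e) + max 0 (r - e)\<bar> * \<bar>max 0 (s - e) - max 0 (r - e)\<bar>"
      unfolding abs_mult[symmetric] by (simp add: power2_eq_square algebra_simps)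
    also have "\<dots> \<le> 2 * \<bar>s - r\<bar>" using that by (intro mult_mono) (auto simp: max_def)
    finally show ?thesis .
  qed
  have "\<bar>ramp s - ramp r\<bar> \<le> 12 * \<bar>s - r\<bar>" if "0 \<le> s" "s \<le> 1" "0 \<le> r" "r \<le> 1" for s r :: real
  proof -
    have "max 0 (s - 1) = 0" "max 0 (r - 1) = 0" using that by auto
    moreover have "\<bar>2 * A - 4 * B - (2 * A' - 4 * B')\<bar> \<le> 12 * d"
      if "\<bar>A - A'\<bar> \<le> 2 * d" "\<bar>B - B'\<bar> \<le> 2 * d" for A B A' B' d :: real
      using that by linarith
    from this[OF q[OF that, of 0] q[OF that, of "1/2"]]
    have "\<bar>2 * (max 0 (s - 0))\<^sup>2 - 4 * (max 0 (s - 1/2))\<^sup>2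
      - (2 * (max 0 (r - 0))\<^sup>2 - 4 * (max 0 (r - 1/2))\<^sup>2)\<bar> \<le> 12 * \<bar>s - r\<bar>" by simp
    ultimately show ?thesis unfolding ramp_def by simp
  qed
  from this[OF cl(2,3) cl(2,3), of s r] have "\<bar>ramp s - ramp r\<bar> \<le> 12 * \<bar>cl s - cl r\<bar>"
    by (simp add: cl(1)[symmetric])
  also have "\<bar>cl s - cl r\<bar> \<le> \<bar>s - r\<bar>" by (auto simp: cl_def max_def min_def)
  finally show ?thesis by simp
qed

text \<open>The second difference of a truncated square lies between 0 and 2 h^2; the weights 2, 4,
  2 add up to 8 in absolute value.\<close>

lemma ramp_sdiff: "\<bar>ramp (s + h) + ramp (s - h) - 2 * ramp s\<bar> \<le> 16 * h\<^sup>2"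
proof -
  have q: "0 \<le> (max 0 (s + h))\<^sup>2 + (max 0 (s - h))\<^sup>2 - 2 * (max 0 s)\<^sup>2 \<and>
      (max 0 (s + h))\<^sup>2 + (max 0 (s - h))\<^sup>2 - 2 * (max 0 s)\<^sup>2 \<le> 2 * h\<^sup>2" if "0 \<le> h" for s h :: real
  proof -
    consider "h \<le> s" | "0 \<le> s" "s < h" | "s < 0" "0 < s + h" | "s + h \<le> 0" using that by linarith
    then show ?thesis
    proof cases
      case 1 then show ?thesis using that by (auto simp: max_def power2_eq_square algebra_simps)
    next
      case 2
      have "s * s \<le> h * s" "0 \<le> h * h" "0 \<le> h * s" using 2 by (auto intro: mult_right_mono)
      then have "s * s \<le> h * h + h * (s * 2)" by linarith
      moreover have "0 \<le> (h - s)\<^sup>2" by simp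
      ultimately show ?thesis using 2 by (auto simp: max_def power2_eq_square algebra_simps)
    next
      case 3
      have "(s + h)\<^sup>2 \<le> h\<^sup>2" using 3 by (intro power_mono) auto
      then have "(s + h)\<^sup>2 \<le> 2 * h\<^sup>2" using zero_le_power2[of h] by linarith
      then show ?thesis using 3 that by (simp add: max_def)
    next
      case 4
      then have "max 0 (s + h) = 0" "max 0 (s - h) = 0" "max 0 s = 0" using that by auto
      then show ?thesis by simp
    qed
  qed
  have q': "\<bar>ramp (s + h) + ramp (s - h) - 2 * ramp s\<bar> \<le> 16 * h\<^sup>2" if "0 \<le> h" for s h
    using q[OF that, of s] q[OF that, of "s - 1/2"] q[OF that, of "s - 1"]
    unfolding ramp_def by (simp add: algebra_simps abs_le_iff)
  show ?thesis using q'[of h s] q'[of "- h" s] by (cases "0 \<le> h") (auto simp: algebra_simps)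
qed

text \<open>The thresholds a and b are squared radii. A function of |x|^2 avoids the singularity of
  the norm at 0, and |x \<plusminus> y|^2 expands exactly.\<close>

definition cutoff :: "real \<Rightarrow> real \<Rightarrow> 'a::euclidean_space \<Rightarrow> real" where
  "cutoff a b x = ramp ((b - (norm x)\<^sup>2) / (b - a))"

lemma cutoff_01: "0 \<le> cutoff a b x" "cutoff a b x \<le> 1"
  by (simp_all add: cutoff_def ramp_01)

lemma cutoff_eq_1: "a < b \<Longrightarrow> (norm x)\<^sup>2 \<le> a \<Longrightarrow> cutoff a b x = 1"
  by (simp add: cutoff_def ramp_eq)

lemma cutoff_eq_0: "a < b \<Longrightarrow> b \<le> (norm x)\<^sup>2 \<Longrightarrow> cutoff a b x = 0"
  by (simp add: cutoff_def ramp_eq divide_nonpos_pos)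

text \<open>Only the power of the gap b - a matters: the iteration halves the gap at every step, so
  the constants then grow by the factor 4. For large x or y the bounds are trivial, because the
  cutoff vanishes for |x| \<ge> 1 and has values in [0, 1].\<close>

lemma C11_cutoff:
  assumes "0 \<le> a" "a < b" "b \<le> 1"
  shows "C11 (200 / (b - a)\<^sup>2) (cutoff a b :: 'a::euclidean_space \<Rightarrow> real)"
proof -
  define c where "c = 1 / (b - a)"
  have c: "1 \<le> c" using assms by (simp add: c_def)
  have cc: "c \<le> c\<^sup>2" using c by (simp add: power2_eq_square)
  have eq: "cutoff a b x = ramp (c * (b - (norm x)\<^sup>2))" for x :: 'a by (simp add: cutoff_def c_def)
  have out: "cutoff a b x = 0" if "1 \<le> norm x" for x :: 'a
  proof (rule cutoff_eq_0[OF assms(2)])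
    have "1 \<le> (norm x)\<^sup>2" using that by simp
    then show "b \<le> (norm x)\<^sup>2" using assms by linarith
  qed
  have nsq: "(norm (x + y))\<^sup>2 = (norm x)\<^sup>2 + 2 * (x \<bullet> y) + (norm y)\<^sup>2"
    "(norm (x - y))\<^sup>2 = (norm x)\<^sup>2 - 2 * (x \<bullet> y) + (norm y)\<^sup>2" for x y :: 'a
    by (simp_all add: power2_norm_eq_inner inner_simps inner_commute)
  note b01 = cutoff_01[of a b]
  have m: "(cutoff a b :: 'a \<Rightarrow> real) \<in> borel_measurable borel"
    unfolding cutoff_def[abs_def] ramp_def by measurable
  have lip: "\<bar>cutoff a b (x + y) - cutoff a b x\<bar> \<le> 200 * c\<^sup>2 * norm y" for x y :: 'a
  proof (cases "norm y < 1 \<and> norm x < 2")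
    case True
    have "\<bar>x \<bullet> y\<bar> \<le> norm x * norm y" by (rule Cauchy_Schwarz_ineq2)
    also have "\<dots> \<le> 2 * norm y" using True by (intro mult_right_mono) auto
    finally have xy: "\<bar>x \<bullet> y\<bar> \<le> 2 * norm y" .
    have yy: "(norm y)\<^sup>2 \<le> norm y" using True by (simp add: power2_eq_square mult_left_le_one_le)
    have "\<bar>cutoff a b (x + y) - cutoff a b x\<bar> \<le> 12 * \<bar>c * (b - (norm (x + y))\<^sup>2) - c * (b - (norm x)\<^sup>2)\<bar>"
      unfolding eq by (rule ramp_lipschitz)
    also have "c * (b - (norm (x + y))\<^sup>2) - c * (b - (norm x)\<^sup>2) = - (c * (2 * (x \<bullet> y) + (norm y)\<^sup>2))"
      unfolding nsq by (simp add: algebra_simps)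
    also have "\<bar>\<dots>\<bar> = c * \<bar>2 * (x \<bullet> y) + (norm y)\<^sup>2\<bar>" using c by (simp add: abs_mult)
    also have "\<dots> \<le> c * (5 * norm y)" using xy yy c zero_le_power2[of "norm y"] by (intro mult_left_mono) linarith+
    also have "12 * \<dots> = 60 * c * norm y" by simp
    also have "\<dots> \<le> 200 * c\<^sup>2 * norm y" using c cc by (intro mult_right_mono) auto
    finally show ?thesis by simp
  next
    case False
    have "\<bar>cutoff a b (x + y) - cutoff a b x\<bar> \<le> 1 * norm y"
    proof (cases "norm y < 1")
      case True
      with False have "1 \<le> norm x" "1 \<le> norm (x + y)" using norm_triangle_ineq4[of "x + y" y] by auto
      then show ?thesis by (simp add: out)
    next
      case False
      then show ?thesis using b01[of "x + y"] b01[of x] by (simp add: abs_le_iff)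
    qed
    also have "\<dots> \<le> 200 * c\<^sup>2 * norm y" using c cc by (intro mult_right_mono) auto
    finally show ?thesis .
  qed
  have sd: "\<bar>sdiff (cutoff a b) x y\<bar> \<le> 200 * c\<^sup>2 * (norm y)\<^sup>2" for x y :: 'a
  proof (cases "norm y < 1/2 \<and> norm x < 3/2")
    case True
    have "\<bar>x \<bullet> y\<bar> \<le> norm x * norm y" by (rule Cauchy_Schwarz_ineq2)
    also have "\<dots> \<le> (3/2) * norm y" using True by (intro mult_right_mono) auto
    finally have "\<bar>x \<bullet> y\<bar>\<^sup>2 \<le> ((3/2) * norm y)\<^sup>2" by (intro power_mono) auto
    then have xy: "(x \<bullet> y)\<^sup>2 \<le> 9/4 * (norm y)\<^sup>2" by (simp add: power_mult_distrib power2_eq_square)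
    \<comment> \<open>The argument of ramp at x \<plusminus> y is p + \<tau> \<plusminus> h: \<tau>
      is the even quadratic shift, estimated by the Lipschitz bound, and h the odd linear one,
      estimated by the second difference of ramp.\<close>
    define p where "p = c * (b - (norm x)\<^sup>2)"
    define \<tau> where "\<tau> = - (c * (norm y)\<^sup>2)"
    define h where "h = - (c * (2 * (x \<bullet> y)))"
    have e: "c * (b - (norm (x + y))\<^sup>2) = (p + \<tau>) + h" "c * (b - (norm (x - y))\<^sup>2) = (p + \<tau>) - h"
      unfolding nsq p_def \<tau>_def h_def by (simp_all add: algebra_simps)
    have "sdiff (cutoff a b) x y
      = (ramp ((p + \<tau>) + h) + ramp ((p + \<tau>) - h) - 2 * ramp (p + \<tau>)) + 2 * (ramp (p + \<tau>) - ramp p)"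
      unfolding sdiff_def eq e by (simp add: p_def)
    then have "\<bar>sdiff (cutoff a b) x y\<bar> \<le> 16 * h\<^sup>2 + 2 * (12 * \<bar>\<tau>\<bar>)"
      using ramp_sdiff[of "p + \<tau>" h] ramp_lipschitz[of "p + \<tau>" p] by simp
    also have "\<bar>\<tau>\<bar> = c * (norm y)\<^sup>2" using c by (simp add: \<tau>_def)
    also have "h\<^sup>2 = 4 * c\<^sup>2 * (x \<bullet> y)\<^sup>2" by (simp add: h_def power_mult_distrib)
    \<comment> \<open>The two coefficients become 144 and 24, hence 168 \<le> 200.\<close>
    also have "16 * (4 * c\<^sup>2 * (x \<bullet> y)\<^sup>2) + 2 * (12 * (c * (norm y)\<^sup>2))
        \<le> 16 * (4 * c\<^sup>2 * (9/4 * (norm y)\<^sup>2)) + 2 * (12 * (c\<^sup>2 * (norm y)\<^sup>2))"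
      using xy cc by (intro add_mono mult_left_mono mult_right_mono) auto
    also have "\<dots> \<le> 200 * c\<^sup>2 * (norm y)\<^sup>2" by simp
    finally show ?thesis .
  next
    case False
    have "\<bar>sdiff (cutoff a b) x y\<bar> \<le> 16 * (norm y)\<^sup>2"
    proof (cases "norm y < 1/2")
      case True
      with False have "1 \<le> norm x" "1 \<le> norm (x + y)" "1 \<le> norm (x - y)"
        using norm_triangle_ineq4[of "x + y" y] norm_triangle_ineq[of "x - y" y] by auto
      then show ?thesis by (simp add: sdiff_def out)
    next
      case False
      then have "(1/2)\<^sup>2 \<le> (norm y)\<^sup>2" by (intro power_mono) auto
      then have "4 \<le> 16 * (norm y)\<^sup>2" by (simp add: power2_eq_square)
      then show ?thesis using b01[of "x + y"] b01[of "x - y"] b01[of x] unfolding sdiff_def by linarith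
    qed
    also have "\<dots> \<le> 200 * c\<^sup>2 * (norm y)\<^sup>2" using c cc by (intro mult_right_mono) auto
    finally show ?thesis .
  qed
  have "\<bar>cutoff a b x\<bar> \<le> 200 * c\<^sup>2" for x :: 'a using b01[of x] c cc by simp
  moreover have "200 / (b - a)\<^sup>2 = 200 * c\<^sup>2" by (simp add: c_def power_divide)
  ultimately show ?thesis unfolding C11_def using m lip sd by simp
qed

section \<open>The a priori estimate\<close>

text \<open>The parameter t is the inverse width of the transition of \<eta>: its C11 constant is of
  size t^2 and its distance to the region \<psi> \<noteq> 1 of size 1/t. The constant C depends on
  neither t nor \<sigma>, and the loss is an explicit power of t, which a sufficiently small
  \<epsilon> can beat along the iteration.\<close>

lemma one_step:
  fixes lam Lam N0 d0 \<epsilon> :: real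
  assumes lam: "0 < lam" and N0: "0 < N0" and d0: "0 < d0" "d0 \<le> 1" and \<epsilon>: "0 < \<epsilon>" "\<epsilon> \<le> 1"
  obtains C where "0 \<le> C"
    "\<And>\<sigma> (K :: 'a::euclidean_space \<Rightarrow> real) M w \<eta> N' \<psi> g t.
      frac_kernel \<sigma> lam Lam K \<Longrightarrow> C11 M w \<Longrightarrow> integrable lborel w \<Longrightarrow> 1 \<le> t \<Longrightarrow>
      C11 (N0 * t\<^sup>2) \<eta> \<Longrightarrow> (\<And>x. 0 \<le> \<eta> x \<and> \<eta> x \<le> 1) \<Longrightarrow> (\<And>x. 1 < norm x \<Longrightarrow> \<eta> x = 0) \<Longrightarrow>
      C11 N' \<psi> \<Longrightarrow> (\<And>x. 0 \<le> \<psi> x \<and> \<psi> x \<le> 1) \<Longrightarrow> bsupp \<psi> \<Longrightarrow>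
      (\<And>x y. \<eta> x \<noteq> 0 \<Longrightarrow> norm (y - x) < d0 / t \<Longrightarrow> \<psi> y = 1) \<Longrightarrow>
      L2 g \<Longrightarrow> (\<And>x. \<eta> x \<noteq> 0 \<Longrightarrow> Lop K w x = g x) \<Longrightarrow>
      l2 (Lop K (\<lambda>x. \<eta> x * w x)) \<le> \<epsilon> * l2 (Lop K (\<lambda>x. \<psi> x * w x))
         + C * t ^ (4 * DIM('a) + 4) * (l2 g + l1 w)"
proof
  define n where "n = DIM('a)"
  define V where "V = vol1 TYPE('a)"
  have V: "0 < V" by (simp add: V_def vol1_pos)
  define \<kappa>0 where "\<kappa>0 = \<bar>Lam\<bar> * (2 ^ (n + 4) * V)"
  have \<kappa>0: "0 \<le> \<kappa>0" using V by (simp add: \<kappa>0_def)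
  define c1 where "c1 = 2 / (V * lam)"
  define c2 where "c2 = 2 / sqrt V"
  have c: "0 \<le> c1" "0 \<le> c2" using V lam by (auto simp: c1_def c2_def)
  define A0 where "A0 = 4 * N0 * \<kappa>0 + 8 * N0\<^sup>2 * \<kappa>0"
  have A0: "0 \<le> A0" using N0 \<kappa>0 by (simp add: A0_def)
  \<comment> \<open>The added 1 gives both A0 c1 / B \<le> 1 and B \<ge> 1; the latter ensures
    \<delta> \<le> 1 below.\<close>
  define B where "B = A0 * c1 + 1"
  have B: "1 \<le> B" using A0 c by (simp add: B_def)
  define S where "S = sqrt (measure lborel (cball (0::'a) 1))"
  have S: "0 \<le> S" by (simp add: S_def)
  define C1 where "C1 = A0 / \<epsilon> * c2 * (2 * B / \<epsilon>\<^sup>2) ^ n"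
  define C2 where "C2 = 2 * (\<bar>Lam\<bar> / d0 ^ (n + 2)) * S"
  have C12: "0 \<le> C1" "0 \<le> C2" using A0 c B \<epsilon> d0 S by (auto simp: C1_def C2_def)
  then show "0 \<le> 1 + C1 + C2" by simp
  fix \<sigma> M N' t :: real and K w \<eta> \<psi> g :: "'a \<Rightarrow> real"
  assume K: "frac_kernel \<sigma> lam Lam K" and w: "C11 M w" "integrable lborel w" and t: "1 \<le> t"
    and \<eta>: "C11 (N0 * t\<^sup>2) \<eta>" "\<And>x. 0 \<le> \<eta> x \<and> \<eta> x \<le> 1" "\<And>x. 1 < norm x \<Longrightarrow> \<eta> x = 0"
    and \<psi>: "C11 N' \<psi>" "\<And>x. 0 \<le> \<psi> x \<and> \<psi> x \<le> 1" "bsupp \<psi>"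
    and sep: "\<And>x y. \<eta> x \<noteq> 0 \<Longrightarrow> norm (y - x) < d0 / t \<Longrightarrow> \<psi> y = 1"
    and g: "L2 g" "\<And>x. \<eta> x \<noteq> 0 \<Longrightarrow> Lop K w x = g x"
  interpret frac_kernel \<sigma> lam Lam K by fact
  define v where "v = (\<lambda>x. \<psi> x * w x)"
  define X where "X = l2 v"
  define Y where "Y = l2 (Lop K v)"
  define G where "G = l2 g"
  define W where "W = l1 w"
  define T where "T = t ^ (4 * n + 4)"
  have pos: "0 \<le> X" "0 \<le> Y" "0 \<le> G" "0 \<le> W" by (auto simp: X_def Y_def G_def W_def)
  have T: "1 \<le> T" using t by (simp add: T_def)
  have \<kappa>: "0 \<le> kmass K" "kmass K \<le> \<kappa>0"
    using trunc_sq_K(2) Lam_nonneg kmass_nonneg by (auto simp: \<kappa>0_def n_def V_def)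
  have dt: "0 < d0 / t" "d0 / t \<le> 1" using d0 t by auto
  define b where "b = Lam / (d0 / t) ^ (n + 2)"
  have loc: "l2 (Lop K (\<lambda>x. \<eta> x * w x)) \<le> G + 2 * b * W * S
     + 4 * (N0 * t\<^sup>2) * kmass K * X + 4 * (N0 * t\<^sup>2) * sqrt (kmass K * (X * Y))"
    unfolding G_def W_def S_def X_def Y_def v_def
    by (rule localization[OF w \<eta> \<psi> sep dt(1) _ g]) (use K_far[OF dt] in \<open>auto simp: b_def n_def\<close>)
  have bW: "2 * b * W * S \<le> C2 * T * W"
  proof -
    have "b = \<bar>Lam\<bar> / d0 ^ (n + 2) * t ^ (n + 2)"
      using Lam_nonneg by (simp add: b_def power_divide)
    also have "\<dots> \<le> \<bar>Lam\<bar> / d0 ^ (n + 2) * T"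
      using d0 t unfolding T_def by (intro mult_left_mono power_increasing) auto
    finally have "2 * b * W * S \<le> 2 * (\<bar>Lam\<bar> / d0 ^ (n + 2) * T) * W * S"
      using pos S by (intro mult_right_mono mult_left_mono) auto
    then show ?thesis by (simp add: C2_def mult_ac)
  qed
  define A where "A = A0 * t ^ 4 / \<epsilon>"
  have A: "0 \<le> A" using A0 \<epsilon> t by (simp add: A_def)
  have t24: "t\<^sup>2 \<le> t ^ 4" using t by (intro power_increasing) auto
  \<comment> \<open>Young's inequality, spending half of the allowed \<epsilon> on Y; the other half
    is reserved for the Nash term.\<close>
  have "4 * (N0 * t\<^sup>2) * sqrt (kmass K * (X * Y)) \<le> \<epsilon> / 2 * Y + 8 * N0\<^sup>2 * t ^ 4 * kmass K / \<epsilon> * X"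
  proof -
    define p where "p = \<epsilon> / 2 * Y"
    define r where "r = 8 * N0\<^sup>2 * t ^ 4 * kmass K / \<epsilon> * X"
    have pr: "0 \<le> p" "0 \<le> r" using pos \<epsilon> \<kappa> t by (auto simp: p_def r_def)
    have "2 * (sqrt p * sqrt r) \<le> p + r" using sum_squares_bound[of "sqrt p" "sqrt r"] pr by simp
    moreover have "sqrt p * sqrt r = 2 * (N0 * t\<^sup>2) * sqrt (kmass K * (X * Y))"
    proof -
      have "p * r = (2 * (N0 * t\<^sup>2))\<^sup>2 * (kmass K * (X * Y))"
        using \<epsilon> by (simp add: p_def r_def power_mult_distrib power_mult[symmetric])
      then have "sqrt (p * r) = \<bar>2 * (N0 * t\<^sup>2)\<bar> * sqrt (kmass K * (X * Y))"
        by (simp only: real_sqrt_mult real_sqrt_abs)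
      then show ?thesis using N0 by (simp add: real_sqrt_mult)
    qed
    ultimately show ?thesis by (simp add: p_def r_def)
  qed
  also have "8 * N0\<^sup>2 * t ^ 4 * kmass K / \<epsilon> * X \<le> 8 * N0\<^sup>2 * t ^ 4 * \<kappa>0 / \<epsilon> * X"
    using \<kappa> \<epsilon> pos t by (intro mult_right_mono divide_right_mono mult_left_mono) auto
  finally have 1: "4 * (N0 * t\<^sup>2) * sqrt (kmass K * (X * Y)) \<le> \<epsilon> / 2 * Y + 8 * N0\<^sup>2 * t ^ 4 * \<kappa>0 / \<epsilon> * X"
    by simp
  have "4 * (N0 * t\<^sup>2) * kmass K * X \<le> 4 * (N0 * t ^ 4) * \<kappa>0 * X"
    using \<kappa> N0 t24 pos by (intro mult_right_mono mult_mono) auto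
  also have "\<dots> \<le> 4 * (N0 * t ^ 4) * \<kappa>0 * X / \<epsilon>"
  proof -
    have "0 \<le> 4 * (N0 * t ^ 4) * \<kappa>0 * X" using \<kappa>0 N0 t pos by auto
    then show ?thesis using \<epsilon> by (simp add: pos_le_divide_eq mult_left_le)
  qed
  finally have 2: "4 * (N0 * t\<^sup>2) * kmass K * X \<le> 4 * (N0 * t ^ 4) * \<kappa>0 * X / \<epsilon>" .
  have "4 * (N0 * t ^ 4) * \<kappa>0 * X / \<epsilon> + 8 * N0\<^sup>2 * t ^ 4 * \<kappa>0 / \<epsilon> * X = A * X"
    using \<epsilon> by (simp add: A_def A0_def field_simps)
  with 1 2 have AX: "4 * (N0 * t\<^sup>2) * kmass K * X + 4 * (N0 * t\<^sup>2) * sqrt (kmass K * (X * Y)) \<le> \<epsilon> / 2 * Y + A * X"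
    by linarith
  \<comment> \<open>The largest scale of this form at which the Nash coefficient A c1 \<delta> = (A0
    c1 / B) (\<epsilon> / 2) is sure to stay below \<epsilon> / 2.\<close>
  define \<delta> where "\<delta> = \<epsilon>\<^sup>2 / (2 * B * t ^ 4)"
  have t4: "1 \<le> t ^ 4" using t by simp
  have \<delta>: "0 < \<delta>" "\<delta> \<le> 1"
  proof -
    show "0 < \<delta>" using \<epsilon> B t by (simp add: \<delta>_def)
    have "1 * 1 \<le> 2 * B * t ^ 4" using B t4 by (intro mult_mono) auto
    moreover have "\<epsilon>\<^sup>2 \<le> 1" using \<epsilon> by (simp add: power_le_one)
    ultimately show "\<delta> \<le> 1" unfolding \<delta>_def by (simp add: divide_le_eq_1)
  qed
  have v: "C11c v"
    unfolding C11c_def v_def using C11_mult[OF \<psi>(1) w(1)] bsupp_mult[OF \<psi>(3), of w] by (auto simp: mult.commute)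
  have vW: "l1 v \<le> W"
    unfolding W_def
  proof (rule integral_mono)
    show "\<bar>v x\<bar> \<le> \<bar>w x\<bar>" for x using \<psi>(2)[of x] by (simp add: v_def abs_mult mult_left_le_one_le)
  qed (use C11c_integrable[OF v] w(2) in auto)
  have "X \<le> c1 * \<delta> * Y + c2 * l1 v / \<delta> ^ n"
    using nash_L2[OF v \<delta>] by (simp add: X_def Y_def c1_def c2_def V_def n_def)
  also have "c2 * l1 v / \<delta> ^ n \<le> c2 * W / \<delta> ^ n"
    using c vW \<delta> by (intro divide_right_mono mult_left_mono) auto
  finally have "A * X \<le> A * (c1 * \<delta> * Y + c2 * W / \<delta> ^ n)" using A by (intro mult_left_mono) auto
  also have "\<dots> = A * c1 * \<delta> * Y + A * c2 * W / \<delta> ^ n" by (simp add: algebra_simps)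
  also have "A * c1 * \<delta> * Y \<le> \<epsilon> / 2 * Y"
  proof (rule mult_right_mono)
    have "A * c1 * \<delta> = (A0 * c1 / B) * (\<epsilon> / 2)"
      using \<epsilon> B t by (simp add: A_def \<delta>_def field_simps power2_eq_square)
    also have "\<dots> \<le> 1 * (\<epsilon> / 2)" using \<epsilon> B by (intro mult_right_mono) (auto simp: B_def divide_le_eq_1)
    finally show "A * c1 * \<delta> \<le> \<epsilon> / 2" by simp
  qed (rule pos)
  \<comment> \<open>Origin of the exponent 4n + 4: \<delta>^(-n) contributes t^(4n) and A
    contributes t^4.\<close>
  also have "A * c2 * W / \<delta> ^ n = C1 * T * W"
  proof -
    have "1 / \<delta> ^ n = (2 * B / \<epsilon>\<^sup>2 * t ^ 4) ^ n" by (simp add: \<delta>_def power_one_over[symmetric])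
    also have "\<dots> = (2 * B / \<epsilon>\<^sup>2) ^ n * t ^ (4 * n)" by (simp only: power_mult_distrib power_mult)
    finally have "A * c2 * W * (1 / \<delta> ^ n) = (A0 * t ^ 4 / \<epsilon>) * c2 * W * ((2 * B / \<epsilon>\<^sup>2) ^ n * t ^ (4 * n))"
      by (simp add: A_def)
    also have "\<dots> = C1 * (t ^ (4 * n) * t ^ 4) * W" by (simp add: C1_def mult_ac)
    finally show ?thesis by (simp add: T_def power_add mult_ac)
  qed
  finally have "A * X \<le> \<epsilon> / 2 * Y + C1 * T * W" by simp
  with loc AX bW have "l2 (Lop K (\<lambda>x. \<eta> x * w x)) \<le> \<epsilon> * Y + (G + C1 * T * W + C2 * T * W)"
    by linarith
  also have "G + C1 * T * W + C2 * T * W \<le> (1 + C1 + C2) * T * (G + W)"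
  proof -
    have "G + C1 * T * W + C2 * T * W + (T - 1) * G + T * W + C1 * T * G + C2 * T * G = (1 + C1 + C2) * T * (G + W)"
      by (simp add: algebra_simps)
    moreover have "0 \<le> (T - 1) * G" "0 \<le> T * W" "0 \<le> C1 * T * G" "0 \<le> C2 * T * G" using C12 T pos by auto
    ultimately show ?thesis by linarith
  qed
  finally show "l2 (Lop K (\<lambda>x. \<eta> x * w x)) \<le> \<epsilon> * l2 (Lop K (\<lambda>x. \<psi> x * w x))
         + (1 + C1 + C2) * t ^ (4 * DIM('a) + 4) * (l2 g + l1 w)"
    by (simp add: Y_def G_def W_def T_def v_def n_def)
qed

text \<open>After k steps the tail is at most \<epsilon>^k H P^k \<le> H (1/2)^k and disappears in
  the limit. H may be arbitrarily large and is absent from the conclusion, so a purely qualitative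
  bound on the sequence is enough.\<close>

lemma iterate_absorption:
  fixes h :: "nat \<Rightarrow> real"
  assumes step: "\<And>k. h k \<le> \<epsilon> * h (Suc k) + C * Q ^ k * W" and grow: "\<And>k. h k \<le> H * P ^ k"
    and nn: "0 \<le> \<epsilon>" "0 \<le> C" "0 \<le> W" "0 \<le> H" "0 \<le> P" "0 \<le> Q" and small: "\<epsilon> * P \<le> 1/2" "\<epsilon> * Q \<le> 1/2"
  shows "h 0 \<le> 2 * C * W"
proof -
  have unroll: "h 0 \<le> \<epsilon> ^ k * h k + C * W * (\<Sum>j<k. (\<epsilon> * Q) ^ j)" for k
  proof (induction k)
    case (Suc k)
    have "\<epsilon> ^ k * h k \<le> \<epsilon> ^ k * (\<epsilon> * h (Suc k) + C * Q ^ k * W)"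
      by (intro mult_left_mono step) (simp add: nn)
    also have "\<dots> = \<epsilon> ^ Suc k * h (Suc k) + C * W * (\<epsilon> * Q) ^ k"
      by (simp add: power_mult_distrib algebra_simps)
    finally show ?case using Suc by (simp add: algebra_simps)
  qed simp
  have le: "h 0 \<le> H * (1/2) ^ k + 2 * C * W" for k
  proof -
    have "\<epsilon> ^ k * h k \<le> \<epsilon> ^ k * (H * P ^ k)" by (intro mult_left_mono grow) (simp add: nn)
    also have "\<dots> = H * (\<epsilon> * P) ^ k" by (simp add: power_mult_distrib)
    also have "\<dots> \<le> H * (1/2) ^ k" using nn small by (intro mult_left_mono power_mono) auto
    finally have 1: "\<epsilon> ^ k * h k \<le> H * (1/2) ^ k" .
    have "(\<Sum>j<k. (\<epsilon> * Q) ^ j) \<le> (\<Sum>j<k. (1/2) ^ j)"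
      using nn small by (intro sum_mono power_mono) auto
    also have "\<dots> \<le> 2" by (simp add: sum_gp_strict)
    finally have "C * W * (\<Sum>j<k. (\<epsilon> * Q) ^ j) \<le> C * W * 2" using nn by (intro mult_left_mono) auto
    with 1 unroll[of k] show ?thesis by simp
  qed
  have "(\<lambda>k. H * (1/2) ^ k + 2 * C * W) \<longlonglongrightarrow> H * 0 + 2 * C * W"
    by (intro tendsto_add tendsto_mult tendsto_const LIMSEQ_power_zero) simp
  then show ?thesis using le by (intro LIMSEQ_le_const[of _ "2 * C * W"]) auto
qed

text \<open>The cutoffs depend on \<open>(norm x)\<^sup>2\<close>.  Their thresholds increase from \<open>3/10 > (1/2)\<^sup>2\<close> to
  \<open>1/2 < (3/4)\<^sup>2\<close>.\<close>

theorem apriori_estimate: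
  fixes lam Lam :: real
  assumes lam: "0 < lam"
  obtains C where "0 \<le> C"
    "\<And>\<sigma> (K :: 'a::euclidean_space \<Rightarrow> real) M w g.
      frac_kernel \<sigma> lam Lam K \<Longrightarrow> C11 M w \<Longrightarrow> integrable lborel w \<Longrightarrow> L2 g \<Longrightarrow>
      (\<And>x. norm x < 3/4 \<Longrightarrow> Lop K w x = g x) \<Longrightarrow>
      l2 (Lop K (\<lambda>x. cutoff (3/10) (7/20) x * w x)) \<le> C * (l2 g + l1 w)"
proof -
  define Q where "Q = (2::real) ^ (4 * DIM('a) + 4)"
  have Q: "4 \<le> Q"
  proof -
    have "(2::real) ^ 2 \<le> Q" unfolding Q_def by (intro power_increasing) auto
    then show ?thesis by simp
  qed
  \<comment> \<open>Q is the growth of the forcing when t doubles; as Q \<ge> 4 the same \<epsilon>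
    also beats the factor 4 by which the norms may grow.\<close>
  define \<epsilon> where "\<epsilon> = 1 / (2 * Q)"
  have \<epsilon>: "0 < \<epsilon>" "\<epsilon> \<le> 1" "\<epsilon> * Q \<le> 1/2" "\<epsilon> * 4 \<le> 1/2" using Q by (auto simp: \<epsilon>_def field_simps)
  show thesis
  \<comment> \<open>A transition of width 2^(-k) / 20 in |x|^2 has C11 constant 200 * 400 * 4^k,
    hence 80000. Moving a point of the unit ball by e \<le> 1 changes |x|^2 by at most 3e, so 1/60
    keeps the change within the gap 2^(-k) / 20.\<close>
  proof (rule one_step[where 'a='a, OF lam _ _ _ \<epsilon>(1,2), of 80000 "1/60"])
    fix C :: real
    assume C: "0 \<le> C" and step:
    "\<And>\<sigma> (K :: 'a \<Rightarrow> real) M w \<eta> N' \<psi> g t.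
      frac_kernel \<sigma> lam Lam K \<Longrightarrow> C11 M w \<Longrightarrow> integrable lborel w \<Longrightarrow> 1 \<le> t \<Longrightarrow>
      C11 (80000 * t\<^sup>2) \<eta> \<Longrightarrow> (\<And>x. 0 \<le> \<eta> x \<and> \<eta> x \<le> 1) \<Longrightarrow> (\<And>x. 1 < norm x \<Longrightarrow> \<eta> x = 0) \<Longrightarrow>
      C11 N' \<psi> \<Longrightarrow> (\<And>x. 0 \<le> \<psi> x \<and> \<psi> x \<le> 1) \<Longrightarrow> bsupp \<psi> \<Longrightarrow>
      (\<And>x y. \<eta> x \<noteq> 0 \<Longrightarrow> norm (y - x) < (1/60) / t \<Longrightarrow> \<psi> y = 1) \<Longrightarrow>
      L2 g \<Longrightarrow> (\<And>x. \<eta> x \<noteq> 0 \<Longrightarrow> Lop K w x = g x) \<Longrightarrow>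
      l2 (Lop K (\<lambda>x. \<eta> x * w x)) \<le> \<epsilon> * l2 (Lop K (\<lambda>x. \<psi> x * w x))
         + C * t ^ (4 * DIM('a) + 4) * (l2 g + l1 w)"
    show thesis
    proof (rule that[of "2 * C"])
    show "0 \<le> 2 * C" using C by simp
    fix \<sigma> M :: real and K w g :: "'a \<Rightarrow> real"
    assume K: "frac_kernel \<sigma> lam Lam K" and w: "C11 M w" "integrable lborel w" and g: "L2 g"
      and eq: "\<And>x. norm x < 3/4 \<Longrightarrow> Lop K w x = g x"
    interpret frac_kernel \<sigma> lam Lam K by fact
    \<comment> \<open>From \<alpha> k to \<alpha> (k + 1) the increase is 2^(-k) / 10: one half is
      the transition of the k-th cutoff, the other half the gap to the region where the next cutoff
      may differ from 1.\<close>
    define \<alpha> where "\<alpha> k = 1/2 - (1/5) * (1/2::real) ^ k" for k :: nat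
    define \<beta> where "\<beta> k = \<alpha> k + (1/20) * (1/2::real) ^ k" for k :: nat
    have \<alpha>\<beta>: "0 \<le> \<alpha> k" "\<alpha> k < \<beta> k" "\<beta> k < 1/2" "\<alpha> (Suc k) = \<beta> k + (1/20) * (1/2) ^ k" for k
    proof -
      have "(1/2::real) ^ k \<le> 1" "0 < (1/2::real) ^ k" by (auto simp: power_le_one)
      then show "0 \<le> \<alpha> k" "\<alpha> k < \<beta> k" "\<beta> k < 1/2" "\<alpha> (Suc k) = \<beta> k + (1/20) * (1/2) ^ k"
        by (auto simp: \<alpha>_def \<beta>_def)
    qed
    define \<eta> where "\<eta> k = (cutoff (\<alpha> k) (\<beta> k) :: 'a \<Rightarrow> real)" for k
    have \<eta>C: "C11 (80000 * (2 ^ k)\<^sup>2) (\<eta> k)" for k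
    proof -
      have "200 / (\<beta> k - \<alpha> k)\<^sup>2 = 80000 * (2 ^ k)\<^sup>2"
        by (simp add: \<beta>_def power_mult_distrib power_divide)
      then show ?thesis using C11_cutoff[of "\<alpha> k" "\<beta> k", where 'a='a] \<alpha>\<beta>[of k] by (simp add: \<eta>_def)
    qed
    have \<eta>01: "0 \<le> \<eta> k x \<and> \<eta> k x \<le> 1" for k x by (simp add: \<eta>_def cutoff_01)
    have \<eta>ne: "(norm x)\<^sup>2 < \<beta> k" if "\<eta> k x \<noteq> 0" for k x
      using that cutoff_eq_0[OF \<alpha>\<beta>(2), of k x] by (force simp: \<eta>_def)
    have \<eta>0: "norm x < 3/4" if "\<eta> k x \<noteq> 0" for k x
    proof (rule power_less_imp_less_base)
      show "(norm x)\<^sup>2 < (3/4)\<^sup>2" using \<eta>ne[OF that] \<alpha>\<beta>(3)[of k] by (simp add: power2_eq_square)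
    qed simp
    have \<eta>out: "\<eta> k x = 0" if "1 < norm x" for k x using \<eta>0[of k x] that by force
    have sep: "\<eta> (Suc k) y = 1" if "\<eta> k x \<noteq> 0" "norm (y - x) < (1/60) / 2 ^ k" for k x y
    proof -
      have x: "norm x < 1" using \<eta>0[OF that(1)] by simp
      define e where "e = norm (y - x)"
      have e: "0 \<le> e" "e \<le> 1/60 * (1/2) ^ k" using that(2) by (auto simp: e_def power_divide)
      have "(1/2::real) ^ k \<le> 1" by (simp add: power_le_one)
      then have e1: "e \<le> 1" using e by linarith
      have "norm y \<le> norm x + e" unfolding e_def using norm_triangle_ineq[of x "y - x"] by simp
      then have "(norm y)\<^sup>2 \<le> (norm x + e)\<^sup>2" by (intro power_mono) auto
      also have "\<dots> = (norm x)\<^sup>2 + 2 * (norm x * e) + e * e" by (simp add: power2_eq_square algebra_simps)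
      also have "\<dots> \<le> (norm x)\<^sup>2 + 2 * (1 * e) + 1 * e"
        using x e e1 by (intro add_mono mult_left_mono mult_right_mono) auto
      also have "\<dots> \<le> \<beta> k + 1/20 * (1/2) ^ k" using \<eta>ne[OF that(1)] e by simp
      finally have "(norm y)\<^sup>2 \<le> \<alpha> (Suc k)" by (simp add: \<alpha>\<beta>(4))
      then show ?thesis unfolding \<eta>_def by (rule cutoff_eq_1[OF \<alpha>\<beta>(2)])
    qed
    have bs: "bsupp (\<eta> k)" for k unfolding bsupp_def using \<eta>out by blast
    define h where "h k = l2 (Lop K (\<lambda>x. \<eta> k x * w x))" for k
    define W where "W = l2 g + l1 w"
    have W: "0 \<le> W" by (simp add: W_def)
    define m where "m = sqrt (measure lborel (cball (0::'a) (1 + 1)) + measure lborel (cball (0::'a) 1))"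
    have m: "0 \<le> m" by (simp add: m_def)
    have "h 0 \<le> 2 * C * W"
    \<comment> \<open>M, the C11 constant of w, enters only through H and is therefore lost in the
      limit.\<close>
    proof (rule iterate_absorption[where Q=Q and P=4 and \<epsilon>=\<epsilon> and H="4 * (4 * 80000 * M) * kmass K * m"])
      fix k
      have "h k \<le> \<epsilon> * h (Suc k) + C * (2 ^ k) ^ (4 * DIM('a) + 4) * W"
        unfolding h_def W_def
        by (rule step[OF K w _ \<eta>C \<eta>01 \<eta>out \<eta>C \<eta>01 bs sep g]) (use eq[OF \<eta>0] in auto)
      then show "h k \<le> \<epsilon> * h (Suc k) + C * Q ^ k * W"
        by (simp add: Q_def power_mult[symmetric] mult.commute)
      have "h k \<le> 4 * (4 * (80000 * (2 ^ k)\<^sup>2) * M) * kmass K * m"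
        unfolding h_def m_def by (rule l2_Lop_bound[OF C11_mult[OF \<eta>C w(1)]]) (simp add: \<eta>out)
      moreover have "((2::real) ^ k)\<^sup>2 = 4 ^ k" by (simp add: power_mult[symmetric] power_commuting_commutes power2_eq_square power_mult_distrib[symmetric])
      ultimately show "h k \<le> 4 * (4 * 80000 * M) * kmass K * m * 4 ^ k" by (simp add: mult_ac)
    qed (use \<epsilon> C W Q m C11D(6)[OF w(1)] kmass_nonneg in auto)
    moreover have "\<eta> 0 = cutoff (3/10) (7/20)" by (simp add: \<eta>_def \<alpha>_def \<beta>_def)
    ultimately show "l2 (Lop K (\<lambda>x. cutoff (3/10) (7/20) x * w x)) \<le> 2 * C * (l2 g + l1 w)"
      by (simp add: h_def W_def)
    qed
  qed simp_all
qed

section \<open>Smooth functions of compact support\<close>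

text \<open>The functions exp(-1/t) / t^k, extended by 0: their span is closed under
  differentiation, so a single derivative formula covers all orders.\<close>

definition flat_exp :: "nat \<Rightarrow> real \<Rightarrow> real" where
  "flat_exp k t = (if 0 < t then exp (- 1 / t) / t ^ k else 0)"

text \<open>The term of order k + 2 in the series of exp (1/t) absorbs t^(-k) and leaves t^2, which
  forces derivative 0 at the origin.\<close>

lemma flat_exp_le: "\<bar>flat_exp k t\<bar> \<le> fact (k + 2) * t\<^sup>2"
proof (cases "0 < t")
  case True
  have "(1 / t) ^ (k + 2) / fact (k + 2) \<le> exp (1 / t)"
  proof -
    have s: "summable (\<lambda>n. (1 / t) ^ n /\<^sub>R fact n)" by (rule summable_exp_generic)
    have "(\<Sum>n\<in>{k + 2}. (1 / t) ^ n /\<^sub>R fact n) \<le> (\<Sum>n. (1 / t) ^ n /\<^sub>R fact n)"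
      using True by (intro sum_le_suminf s) auto
    then show ?thesis by (simp add: exp_def divide_inverse mult.commute)
  qed
  then have "1 / exp (1 / t) \<le> 1 / ((1 / t) ^ (k + 2) / fact (k + 2))"
    using True by (intro divide_left_mono mult_pos_pos) auto
  also have "\<dots> = fact (k + 2) * t ^ (k + 2)" by (simp add: power_one_over)
  finally have "exp (- 1 / t) \<le> fact (k + 2) * t ^ (k + 2)" by (simp add: exp_minus divide_inverse)
  then have "exp (- 1 / t) / t ^ k \<le> fact (k + 2) * t ^ (k + 2) / t ^ k"
    using True by (intro divide_right_mono) auto
  also have "\<dots> = fact (k + 2) * t\<^sup>2" using True by (simp add: power_add power2_eq_square)
  finally show ?thesis using True by (simp add: flat_exp_def)
qed (simp add: flat_exp_def)

lemma flat_exp_deriv: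
  "(flat_exp k has_real_derivative (flat_exp (k + 2) t - real k * flat_exp (k + 1) t)) (at t)"
proof -
  consider "0 < t" | "t < 0" | "t = 0" by linarith
  then show ?thesis
  proof cases
    case 1
    have "((\<lambda>t. exp (- 1 / t) / t ^ k) has_real_derivative (flat_exp (k + 2) t - real k * flat_exp (k + 1) t)) (at t)"
    proof -
      have e: "flat_exp (k + 2) t - real k * flat_exp (k + 1) t
        = (exp (- 1 / t) * (1 / t\<^sup>2) * t ^ k - exp (- 1 / t) * (real k * t ^ (k - 1))) / (t ^ k * t ^ k)"
      \<comment> \<open>The power rule produces t^(k - 1) with truncated subtraction; for k = 0 the
        coefficient \<open>real k\<close> removes it.\<close>
      proof (cases k)
        case 0 then show ?thesis using 1 by (simp add: flat_exp_def power2_eq_square)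
      next
        case (Suc j) then show ?thesis using 1 by (simp add: flat_exp_def power2_eq_square field_simps)
      qed
      show ?thesis unfolding e using 1
        by (auto intro!: derivative_eq_intros simp: power2_eq_square)
    qed
    moreover have ev: "\<forall>\<^sub>F s in nhds t. exp (- 1 / s) / s ^ k = flat_exp k s"
      using eventually_nhds_in_open[of "{0<..}" t] 1 by (auto elim!: eventually_mono simp: flat_exp_def)
    ultimately show ?thesis using DERIV_cong_ev[OF refl ev refl] by simp
  next
    case 2
    have "((\<lambda>t. 0) has_real_derivative (flat_exp (k + 2) t - real k * flat_exp (k + 1) t)) (at t)"
      using 2 by (simp add: flat_exp_def)
    moreover have ev: "\<forall>\<^sub>F s in nhds t. 0 = flat_exp k s"
      using eventually_nhds_in_open[of "{..<0}" t] 2 by (auto elim!: eventually_mono simp: flat_exp_def)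
    ultimately show ?thesis using DERIV_cong_ev[OF refl ev refl] by simp
  next
    case 3
    have "((\<lambda>h. (flat_exp k (0 + h) - flat_exp k 0) / h) \<longlongrightarrow> 0) (at 0)"
    proof (rule Lim_null_comparison)
      have "\<bar>flat_exp k h / h\<bar> \<le> fact (k + 2) * \<bar>h\<bar>" if "h \<noteq> 0" for h
      proof -
        have "h\<^sup>2 = \<bar>h\<bar> * \<bar>h\<bar>" by (simp add: power2_eq_square)
        then have "\<bar>flat_exp k h\<bar> \<le> (fact (k + 2) * \<bar>h\<bar>) * \<bar>h\<bar>" using flat_exp_le[of k h] by (simp only: mult.assoc)
        then show ?thesis using that unfolding abs_divide by (subst pos_divide_le_eq) auto
      qed
      then show "\<forall>\<^sub>F h in at 0. norm ((flat_exp k (0 + h) - flat_exp k 0) / h) \<le> fact (k + 2) * \<bar>h\<bar>"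
        unfolding eventually_at by (auto simp: flat_exp_def[of k 0] intro!: exI[of _ 1])
      show "((\<lambda>h. fact (k + 2) * \<bar>h\<bar>) \<longlongrightarrow> 0) (at (0::real))"
        by (intro tendsto_mult_right_zero tendsto_rabs_zero tendsto_ident_at)
    qed
    then show ?thesis using 3 by (simp add: DERIV_def flat_exp_def[of _ 0])
  qed
qed

text \<open>An algebra of functions containing the standard bumps and closed under directional
  derivatives, hence consisting of smooth functions.\<close>

inductive bump_algebra :: "real \<Rightarrow> 'a::euclidean_space \<Rightarrow> ('a \<Rightarrow> real) \<Rightarrow> bool" for r p where
  const: "bump_algebra r p (\<lambda>x. c)"
| linear: "bump_algebra r p (\<lambda>x. x \<bullet> a)"
| flat: "bump_algebra r p (\<lambda>x. flat_exp k (r - (x - p) \<bullet> (x - p)))"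
| add: "bump_algebra r p f \<Longrightarrow> bump_algebra r p g \<Longrightarrow> bump_algebra r p (\<lambda>x. f x + g x)"
| mult: "bump_algebra r p f \<Longrightarrow> bump_algebra r p g \<Longrightarrow> bump_algebra r p (\<lambda>x. f x * g x)"

lemma bump_algebra_derivative:
  assumes "bump_algebra r p f"
  shows "\<exists>D. (\<forall>x. (f has_derivative D x) (at x)) \<and> (\<forall>v. bump_algebra r p (\<lambda>x. D x v))"
  using assms
proof induction
  case (const c)
  show ?case by (rule exI[of _ "\<lambda>x v. 0"]) (auto intro: bump_algebra.const)
next
  case (linear a)
  show ?case
    by (rule exI[of _ "\<lambda>x v. v \<bullet> a"]) (auto intro: bump_algebra.const intro!: derivative_eq_intros)
next
  case (flat k)
  define q where "q x = r - (x - p) \<bullet> (x - p)" for x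
  \<comment> \<open>The factor -2 (x - p) \<bullet> v is written through x \<bullet> a and a
    constant, the generators of the algebra.\<close>
  define D where "D x v = (flat_exp (k + 2) (q x) + (- real k) * flat_exp (k + 1) (q x)) * (x \<bullet> (- 2 *\<^sub>R v) + 2 * (p \<bullet> v))"
    for x v
  have "((\<lambda>x. flat_exp k (q x)) has_derivative D x) (at x)" for x
  proof -
    have q': "(q has_derivative (\<lambda>v. - 2 * ((x - p) \<bullet> v))) (at x)"
      unfolding q_def[abs_def] by (auto intro!: derivative_eq_intros simp: inner_commute)
    from flat_exp_deriv[of k "q x"]
    have "(flat_exp k has_derivative (\<lambda>h. (flat_exp (k + 2) (q x) - real k * flat_exp (k + 1) (q x)) * h)) (at (q x))"
      by (simp add: has_field_derivative_def)
    from diff_chain_at[OF q' this] show ?thesis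
      by (simp add: o_def D_def[abs_def] inner_simps algebra_simps)
  qed
  moreover have "bump_algebra r p (\<lambda>x. D x v)" for v
    unfolding D_def q_def by (intro bump_algebra.intros)
  ultimately show ?case unfolding q_def by blast
next
  case (add f g)
  then obtain D E where D: "\<And>x. (f has_derivative D x) (at x)" "\<And>v. bump_algebra r p (\<lambda>x. D x v)"
    and E: "\<And>x. (g has_derivative E x) (at x)" "\<And>v. bump_algebra r p (\<lambda>x. E x v)" by blast
  show ?case
    by (rule exI[of _ "\<lambda>x v. D x v + E x v"])
      (use D E in \<open>auto intro!: bump_algebra.intros has_derivative_add\<close>)
next
  case (mult f g)
  then obtain D E where D: "\<And>x. (f has_derivative D x) (at x)" "\<And>v. bump_algebra r p (\<lambda>x. D x v)"
    and E: "\<And>x. (g has_derivative E x) (at x)" "\<And>v. bump_algebra r p (\<lambda>x. E x v)" by blast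
  show ?case
    by (rule exI[of _ "\<lambda>x v. f x * E x v + D x v * g x"])
      (use D E mult in \<open>auto intro!: bump_algebra.intros has_derivative_mult\<close>)
qed

text \<open>Membership in the algebra is the coinduction invariant, preserved by every directional
  derivative.\<close>

lemma bump_algebra_smooth: "bump_algebra r p f \<Longrightarrow> smooth f"
proof (coinduction arbitrary: f rule: smooth.coinduct)
  case (smooth f)
  obtain D where D: "\<And>x. (f has_derivative D x) (at x)" "\<And>v. bump_algebra r p (\<lambda>x. D x v)"
    using bump_algebra_derivative[OF smooth] by blast
  have "frechet_derivative f (at x) = D x" for x using frechet_derivative_at[OF D(1)] by simp
  then show ?case using D by (auto simp: differentiable_def)
qed

section \<open>Difference bounds for smooth functions of compact support\<close>

lemma smoothD:
  assumes "smooth f" shows "f differentiable (at x)" "smooth (\<lambda>x. frechet_derivative f (at x) v)"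
  using assms by (auto elim: smooth.cases)

lemma smooth_continuous: "smooth f \<Longrightarrow> continuous_on S f"
  by (meson smoothD(1) differentiable_at_withinI differentiable_imp_continuous_on differentiable_on_def)

lemma smooth_bounded:
  fixes f :: "'a::euclidean_space \<Rightarrow> real"
  assumes f: "smooth f" and R: "\<forall>x. R < norm x \<longrightarrow> f x = 0"
  obtains M where "0 \<le> M" "\<And>x. \<bar>f x\<bar> \<le> M"
proof -
  have "bounded (f ` cball 0 R)"
    by (intro compact_imp_bounded compact_continuous_image smooth_continuous f compact_cball)
  then obtain M where "\<forall>y\<in>f ` cball 0 R. norm y \<le> M" unfolding bounded_iff by blast
  then have M: "\<bar>f x\<bar> \<le> M" if "x \<in> cball 0 R" for x using that by auto
  have "\<bar>f x\<bar> \<le> max M 0" for x using M[of x] R by (cases "norm x \<le> R") auto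
  then show thesis using that[of "max M 0"] by simp
qed

lemma smooth_derivative_zero:
  fixes f :: "'a::euclidean_space \<Rightarrow> real"
  assumes f: "smooth f" and R: "\<forall>x. R < norm x \<longrightarrow> f x = 0" and x: "R < norm x"
  shows "frechet_derivative f (at x) v = 0"
proof -
  have "open {x::'a. R < norm x}" by (intro open_Collect_less continuous_intros)
  then have "(f has_derivative (\<lambda>v. 0)) (at x)"
    by (rule has_derivative_transform_within_open[OF has_derivative_const[of 0]]) (use x R in auto)
  from frechet_derivative_at[OF this, symmetric] show ?thesis by (simp only:)
qed

lemma smooth_derivative_expand:
  fixes f :: "'a::euclidean_space \<Rightarrow> real"
  assumes f: "smooth f"
  shows "frechet_derivative f (at x) v = (\<Sum>b\<in>Basis. (v \<bullet> b) * frechet_derivative f (at x) b)"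
proof -
  have lin: "linear (frechet_derivative f (at x))"
    by (intro linear_frechet_derivative smoothD f)
  have "frechet_derivative f (at x) v = frechet_derivative f (at x) (\<Sum>b\<in>Basis. (v \<bullet> b) *\<^sub>R b)"
    by (simp add: euclidean_representation)
  also have "\<dots> = (\<Sum>b\<in>Basis. (v \<bullet> b) * frechet_derivative f (at x) b)"
    by (simp add: linear_sum[OF lin] linear_scale[OF lin])
  finally show ?thesis .
qed

lemma smooth_lipschitz:
  fixes f :: "'a::euclidean_space \<Rightarrow> real"
  assumes f: "smooth f" and R: "\<forall>x. R < norm x \<longrightarrow> f x = 0"
  obtains M where "0 \<le> M" "\<And>x y. \<bar>f x - f y\<bar> \<le> M * norm (x - y)"
proof -
  have "\<exists>M. \<forall>x. \<bar>frechet_derivative f (at x) b\<bar> \<le> M" for b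
    using smooth_bounded[OF smoothD(2)[OF f], of R b] smooth_derivative_zero[OF f R, of _ b] by metis
  then obtain M where M: "\<And>b x. \<bar>frechet_derivative f (at x) b\<bar> \<le> M b" by metis
  have M0: "0 \<le> M b" for b using M abs_ge_zero order_trans by blast
  define S where "S = (\<Sum>b\<in>(Basis::'a set). M b)"
  have S: "0 \<le> S" unfolding S_def by (intro sum_nonneg M0)
  have le: "\<bar>frechet_derivative f (at x) v\<bar> \<le> S * norm v" for x v
  proof -
    have "\<bar>frechet_derivative f (at x) v\<bar> \<le> (\<Sum>b\<in>Basis. \<bar>(v \<bullet> b) * frechet_derivative f (at x) b\<bar>)"
      unfolding smooth_derivative_expand[OF f, of x v] by (rule sum_abs)
    also have "\<dots> \<le> (\<Sum>b\<in>Basis. norm v * M b)"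
      unfolding abs_mult by (intro sum_mono mult_mono M Basis_le_norm) auto
    finally show ?thesis by (simp add: S_def sum_distrib_left mult.commute)
  qed
  have "\<bar>f x - f y\<bar> \<le> S * norm (x - y)" for x y
  proof -
    have "norm (f x - f y) \<le> S * norm (x - y)"
    proof (rule differentiable_bound[of UNIV f "\<lambda>x. frechet_derivative f (at x)"])
      show "(f has_derivative frechet_derivative f (at x)) (at x within UNIV)" for x
        using smoothD(1)[OF f] by (simp add: frechet_derivative_works[symmetric])
      show "onorm (frechet_derivative f (at x)) \<le> S" for x
        using le by (intro onorm_bound S) auto
    qed auto
    then show ?thesis by simp
  qed
  with S that show thesis by blast
qed

text \<open>The mean value theorem for t \<mapsto> f (x + t y) + f (x - t y) turns the second
  difference into a difference of first derivatives at two points 2 t |y| apart, and first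
  derivatives are Lipschitz.\<close>

lemma smooth_sdiff:
  fixes f :: "'a::euclidean_space \<Rightarrow> real"
  assumes f: "smooth f" and R: "\<forall>x. R < norm x \<longrightarrow> f x = 0"
  obtains M where "0 \<le> M" "\<And>x y. \<bar>sdiff f x y\<bar> \<le> M * (norm y)\<^sup>2"
proof -
  have "\<exists>M. 0 \<le> M \<and> (\<forall>x y. \<bar>frechet_derivative f (at x) b - frechet_derivative f (at y) b\<bar> \<le> M * norm (x - y))" for b
    using smooth_lipschitz[OF smoothD(2)[OF f], of R b] smooth_derivative_zero[OF f R, of _ b] by metis
  then obtain M where M0: "\<And>b. 0 \<le> M b"
    and M: "\<And>b x y. \<bar>frechet_derivative f (at x) b - frechet_derivative f (at y) b\<bar> \<le> M b * norm (x - y)" by metis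
  define S where "S = (\<Sum>b\<in>(Basis::'a set). M b)"
  have S: "0 \<le> S" unfolding S_def by (intro sum_nonneg M0)
  have le: "\<bar>frechet_derivative f (at x) v - frechet_derivative f (at y) v\<bar> \<le> S * norm v * norm (x - y)" for x y v
  proof -
    have "frechet_derivative f (at x) v - frechet_derivative f (at y) v
      = (\<Sum>b\<in>Basis. (v \<bullet> b) * (frechet_derivative f (at x) b - frechet_derivative f (at y) b))"
      unfolding smooth_derivative_expand[OF f, of _ v] by (simp add: sum_subtractf algebra_simps)
    also have "\<bar>\<dots>\<bar> \<le> (\<Sum>b\<in>Basis. \<bar>(v \<bullet> b) * (frechet_derivative f (at x) b - frechet_derivative f (at y) b)\<bar>)"
      by (rule sum_abs)
    also have "\<dots> \<le> (\<Sum>b\<in>Basis. norm v * (M b * norm (x - y)))"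
      unfolding abs_mult by (intro sum_mono mult_mono M Basis_le_norm) auto
    finally show ?thesis by (simp add: S_def sum_distrib_left sum_distrib_right mult_ac)
  qed
  have "\<bar>sdiff f x y\<bar> \<le> 2 * S * (norm y)\<^sup>2" for x y
  proof -
    define g where "g t = f (x + t *\<^sub>R y) + f (x - t *\<^sub>R y)" for t
    define g' where "g' t = frechet_derivative f (at (x + t *\<^sub>R y)) y - frechet_derivative f (at (x - t *\<^sub>R y)) y" for t
    have der: "(g has_real_derivative g' t) (at t)" for t
    proof -
      have F: "(f has_derivative frechet_derivative f (at z)) (at z)" for z
        using smoothD(1)[OF f] by (simp add: frechet_derivative_works[symmetric])
      have 1: "((\<lambda>t. f (x + t *\<^sub>R y)) has_derivative (\<lambda>h. frechet_derivative f (at (x + t *\<^sub>R y)) (h *\<^sub>R y))) (at t)"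
        by (rule has_derivative_compose[OF _ F, of "\<lambda>t. x + t *\<^sub>R y"]) (auto intro!: derivative_eq_intros)
      have 2: "((\<lambda>t. f (x - t *\<^sub>R y)) has_derivative (\<lambda>h. frechet_derivative f (at (x - t *\<^sub>R y)) (- (h *\<^sub>R y)))) (at t)"
        by (rule has_derivative_compose[OF _ F, of "\<lambda>t. x - t *\<^sub>R y"]) (auto intro!: derivative_eq_intros)
      have lin: "linear (frechet_derivative f (at z))" for z by (intro linear_frechet_derivative smoothD f)
      show ?thesis
        unfolding has_field_derivative_def g_def[abs_def]
      proof (rule has_derivative_eq_rhs[OF has_derivative_add[OF 1 2]], rule ext)
        fix h
        show "frechet_derivative f (at (x + t *\<^sub>R y)) (h *\<^sub>R y) + frechet_derivative f (at (x - t *\<^sub>R y)) (- (h *\<^sub>R y))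
          = g' t * h"
          by (simp add: g'_def linear_neg[OF lin] linear_scale[OF lin] algebra_simps)
      qed
    qed
    obtain t where t: "0 < t" "t < 1" and "g 1 - g 0 = (1 - 0) * g' t"
      using MVT2[of 0 1 g g'] der by auto
    then have "sdiff f x y = g' t" by (simp add: sdiff_def g_def)
    also have "\<bar>g' t\<bar> \<le> S * norm y * norm ((x + t *\<^sub>R y) - (x - t *\<^sub>R y))" unfolding g'_def by (rule le)
    also have "(x + t *\<^sub>R y) - (x - t *\<^sub>R y) = (2 * t) *\<^sub>R y" unfolding mult_2 scaleR_left_distrib by simp
    also have "S * norm y * norm ((2 * t) *\<^sub>R y) = (S * (norm y)\<^sup>2) * (2 * t)"
      using t by (simp add: power2_eq_square)
    also have "\<dots> \<le> (S * (norm y)\<^sup>2) * 2" using S t by (intro mult_left_mono) auto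
    finally show ?thesis by simp
  qed
  then show thesis using that[of "2 * S"] S by simp
qed

lemma test_fun_zero:
  assumes "test_fun r \<phi>" "r \<le> norm x" shows "\<phi> x = 0"
proof (rule ccontr)
  assume "\<phi> x \<noteq> 0"
  then have "x \<in> closure {x. \<phi> x \<noteq> 0}" using closure_subset[of "{x. \<phi> x \<noteq> 0}"] by auto
  then show False using assms unfolding test_fun_def by auto
qed

lemma test_fun_C11c:
  assumes \<phi>: "test_fun r \<phi>" shows "C11c \<phi>"
proof -
  have s: "smooth \<phi>" using \<phi> by (simp add: test_fun_def)
  have z: "\<forall>x. r < norm x \<longrightarrow> \<phi> x = 0" using test_fun_zero[OF \<phi>] by simp
  obtain A where A: "0 \<le> A" "\<And>x. \<bar>\<phi> x\<bar> \<le> A" using smooth_bounded[OF s z] by blast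
  obtain B where B: "0 \<le> B" "\<And>x y. \<bar>\<phi> x - \<phi> y\<bar> \<le> B * norm (x - y)" using smooth_lipschitz[OF s z] by blast
  obtain D where D: "0 \<le> D" "\<And>x y. \<bar>sdiff \<phi> x y\<bar> \<le> D * (norm y)\<^sup>2" using smooth_sdiff[OF s z] by blast
  define M where "M = A + B + D"
  have "\<bar>\<phi> x\<bar> \<le> M" for x using A(2)[of x] B D by (simp add: M_def)
  moreover have "\<bar>\<phi> (x + y) - \<phi> x\<bar> \<le> M * norm y" for x y
    using B(2)[of "x + y" x] mult_right_mono[of B M "norm y"] A D by (simp add: M_def)
  moreover have "\<bar>sdiff \<phi> x y\<bar> \<le> M * (norm y)\<^sup>2" for x y
    using D(2)[of x y] mult_right_mono[of D M "(norm y)\<^sup>2"] A B by (simp add: M_def)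
  moreover have "\<phi> \<in> borel_measurable borel"
    by (intro borel_measurable_continuous_onI smooth_continuous s)
  ultimately have "C11 M \<phi>" by (simp add: C11_def)
  then show ?thesis using z by (auto simp: C11c_def bsupp_def)
qed

text \<open>The last property is the one that matters beyond a standard mollifier: z \<mapsto>
  \<rho> (p - z) is itself an admissible test function, so it can be inserted in the weak
  equation.\<close>

lemma mollifier_exists:
  assumes \<epsilon>: "0 < \<epsilon>"
  obtains \<rho> :: "'a::euclidean_space \<Rightarrow> real" where "C11c \<rho>" "\<And>x. 0 \<le> \<rho> x" "\<And>x. \<epsilon> \<le> norm x \<Longrightarrow> \<rho> x = 0"
    "(LBINT x. \<rho> x) = 1" "\<And>p r. norm p + \<epsilon> < r \<Longrightarrow> test_fun r (\<lambda>z. \<rho> (p - z))"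
proof -
  \<comment> \<open>The centre p is a parameter of the bump, so the reflected translate \<rho> (p -
    z) is again a multiple of a bump from the algebra.\<close>
  define b where "b p x = flat_exp 0 (\<epsilon>\<^sup>2 - (x - p) \<bullet> (x - p))" for p x :: 'a
  have bne: "b p x \<noteq> 0 \<longleftrightarrow> norm (x - p) < \<epsilon>" for p x
  proof -
    have "b p x \<noteq> 0 \<longleftrightarrow> (norm (x - p))\<^sup>2 < \<epsilon>\<^sup>2" by (simp add: b_def flat_exp_def power2_norm_eq_inner)
    also have "\<dots> \<longleftrightarrow> norm (x - p) < \<epsilon>" using \<epsilon> power_less_imp_less_base[of "norm (x - p)" 2 \<epsilon>]
      power_strict_mono[of "norm (x - p)" \<epsilon> 2] by auto
    finally show ?thesis .
  qed
  have b0: "0 \<le> b p x" for p x by (simp add: b_def flat_exp_def)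
  have tf: "test_fun r (\<lambda>x. c * b p x)" if "norm p + \<epsilon> < r" for p r c
  proof -
    have "smooth (\<lambda>x. c * b p x)"
      unfolding b_def by (rule bump_algebra_smooth[of "\<epsilon>\<^sup>2" p]) (intro bump_algebra.intros)
    moreover have sub: "closure {x. c * b p x \<noteq> 0} \<subseteq> cball p \<epsilon>"
    proof (rule closure_minimal)
      show "{x. c * b p x \<noteq> 0} \<subseteq> cball p \<epsilon>" using bne[of p] by (auto simp: dist_norm norm_minus_commute)
    qed simp
    moreover have "compact (closure {x. c * b p x \<noteq> 0})"
      using sub by (meson bounded_cball bounded_subset closed_closure compact_eq_bounded_closed)
    moreover have "cball p \<epsilon> \<subseteq> ball 0 r"
    proof
      fix x assume "x \<in> cball p \<epsilon>"
      then have "norm (x - p) \<le> \<epsilon>" by (simp add: dist_norm norm_minus_commute)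
      then show "x \<in> ball 0 r" using norm_triangle_ineq[of p "x - p"] that by simp
    qed
    ultimately show ?thesis by (auto simp: test_fun_def)
  qed
  have C: "C11c (b 0)" using test_fun_C11c[OF tf[of 0 "\<epsilon> + 1" 1]] by simp
  define I where "I = (LBINT x. b 0 x)"
  have "I \<noteq> 0"
  proof
    assume "I = 0"
    then have ae: "AE x in lborel. b 0 x = 0"
      unfolding I_def using integral_nonneg_eq_0_iff_AE[OF C11c_integrable[OF C]] b0 by simp
    have "AE x in lborel. x \<notin> ball (0::'a) \<epsilon>" using ae by eventually_elim (use bne[of 0] in auto)
    then have "emeasure lborel (ball (0::'a) \<epsilon>) = 0" by (subst (asm) AE_iff_null) (auto simp: null_sets_def ball_def)
    then show False using \<epsilon> vol1_pos[where 'a='a] by (simp add: emeasure_ball0)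
  qed
  moreover have "0 \<le> I" unfolding I_def by (simp add: b0)
  ultimately have I: "0 < I" by simp
  define \<rho> where "\<rho> x = (1 / I) * b 0 x" for x
  have sh: "\<rho> (p - z) = (1 / I) * b p z" for p z
    by (simp add: \<rho>_def b_def inner_commute) (simp add: inner_diff_left inner_diff_right inner_commute add.commute)
  show thesis
  proof (rule that[of \<rho>])
    show "C11c \<rho>" using test_fun_C11c[OF tf[of 0 "\<epsilon> + 1" "1 / I"]] by (simp add: \<rho>_def[abs_def])
    show "0 \<le> \<rho> x" for x using b0 I by (simp add: \<rho>_def)
    show "\<rho> x = 0" if "\<epsilon> \<le> norm x" for x using bne[of 0 x] that by (simp add: \<rho>_def)
    show "(LBINT x. \<rho> x) = 1" using I by (simp add: \<rho>_def I_def)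
    show "test_fun r (\<lambda>z. \<rho> (p - z))" if "norm p + \<epsilon> < r" for p r
      unfolding sh using tf[OF that] .
  qed
qed

section \<open>Mollification\<close>

definition mollify :: "('a::euclidean_space \<Rightarrow> real) \<Rightarrow> ('a \<Rightarrow> real) \<Rightarrow> 'a \<Rightarrow> real" where
  "mollify v \<rho> x = (LBINT z. v z * \<rho> (x - z))"

definition mollifier :: "real \<Rightarrow> ('a::euclidean_space \<Rightarrow> real) \<Rightarrow> bool" where
  "mollifier \<epsilon> \<rho> \<longleftrightarrow> C11c \<rho> \<and> (\<forall>x. 0 \<le> \<rho> x) \<and> (\<forall>x. \<epsilon> \<le> norm x \<longrightarrow> \<rho> x = 0) \<and> (LBINT x. \<rho> x) = 1 \<and>
     (\<forall>p r. norm p + \<epsilon> < r \<longrightarrow> test_fun r (\<lambda>z. \<rho> (p - z)))"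

lemma mollifierD:
  assumes "mollifier \<epsilon> \<rho>"
  shows "C11c \<rho>" "0 \<le> \<rho> x" "\<epsilon> \<le> norm x \<Longrightarrow> \<rho> x = 0" "(LBINT x. \<rho> x) = 1"
    "norm p + \<epsilon> < r \<Longrightarrow> test_fun r (\<lambda>z. \<rho> (p - z))" "\<rho> \<in> borel_measurable borel" "integrable lborel \<rho>"
  using assms C11c_borel[of \<rho>] C11c_integrable[of \<rho>] by (auto simp: mollifier_def)

lemma ex_mollifier: "0 < \<epsilon> \<Longrightarrow> \<exists>\<rho>::'a::euclidean_space \<Rightarrow> real. mollifier \<epsilon> \<rho>"
  unfolding mollifier_def by (metis mollifier_exists)

lemma mollify_measurable[measurable]:
  fixes v :: "'a::euclidean_space \<Rightarrow> real"
  assumes [measurable]: "v \<in> borel_measurable borel" "\<rho> \<in> borel_measurable borel"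
  shows "mollify v \<rho> \<in> borel_measurable borel"
  unfolding mollify_def[abs_def] by measurable

lemma integrable_mult_bounded:
  fixes v f :: "'a \<Rightarrow> real"
  assumes v: "integrable M v" and f: "f \<in> borel_measurable M" and B: "\<And>x. \<bar>f x\<bar> \<le> B"
  shows "integrable M (\<lambda>x. v x * f x)" "\<bar>\<integral>x. v x * f x \<partial>M\<bar> \<le> B * (\<integral>x. \<bar>v x\<bar> \<partial>M)"
proof -
  have le: "\<bar>v x * f x\<bar> \<le> B * \<bar>v x\<bar>" for x
    using mult_left_mono[OF B, of "\<bar>v x\<bar>" x] by (simp add: abs_mult mult.commute)
  have i: "integrable M (\<lambda>x. B * \<bar>v x\<bar>)" using v by simp
  show i': "integrable M (\<lambda>x. v x * f x)"
    by (rule Bochner_Integration.integrable_bound[OF i])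
      (use v f in \<open>auto intro: order_trans[OF le abs_ge_self]\<close>)
  have "\<bar>\<integral>x. v x * f x \<partial>M\<bar> \<le> (\<integral>x. \<bar>v x * f x\<bar> \<partial>M)" by (rule integral_abs_bound)
  also have "\<dots> \<le> (\<integral>x. B * \<bar>v x\<bar> \<partial>M)" using i i' le by (intro integral_mono) auto
  finally show "\<bar>\<integral>x. v x * f x \<partial>M\<bar> \<le> B * (\<integral>x. \<bar>v x\<bar> \<partial>M)" by simp
qed

lemma sdiff_mollify:
  fixes v :: "'a::euclidean_space \<Rightarrow> real"
  assumes v: "integrable lborel v" and \<rho>: "C11 M \<rho>"
  shows "sdiff (mollify v \<rho>) x y = (LBINT z. v z * sdiff \<rho> (x - z) y)"
proof -
  note C = C11D[OF \<rho>]
  have [measurable]: "\<rho> \<in> borel_measurable borel" by (rule C)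
  have i: "integrable lborel (\<lambda>z. v z * \<rho> (x - z))" for x
    by (rule integrable_mult_bounded(1)[OF v _ C(2)]) measurable
  have "v z * sdiff \<rho> (x - z) y = v z * \<rho> (x + y - z) + v z * \<rho> (x - y - z) - 2 * (v z * \<rho> (x - z))" for z
    by (simp add: sdiff_def algebra_simps)
  then show ?thesis
    using i[of "x + y"] i[of "x - y"] i[of x] by (simp add: sdiff_def[of "mollify v \<rho>"] mollify_def)
qed

text \<open>The constant may blow up with the mollifier. That is harmless: the estimates applied to
  mollified functions hold for every C11 constant with the same C.\<close>

lemma C11_mollify:
  fixes v :: "'a::euclidean_space \<Rightarrow> real"
  assumes v: "integrable lborel v" and \<rho>: "C11 M \<rho>"
  shows "C11 (M * l1 v) (mollify v \<rho>)"
proof -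
  note C = C11D[OF \<rho>]
  have [measurable]: "v \<in> borel_measurable borel" "\<rho> \<in> borel_measurable borel" using v C by auto
  have i: "integrable lborel (\<lambda>z. v z * \<rho> (x - z))" for x
    by (rule integrable_mult_bounded(1)[OF v _ C(2)]) measurable
  have "\<bar>mollify v \<rho> x\<bar> \<le> M * l1 v" for x
    unfolding mollify_def by (rule integrable_mult_bounded(2)[OF v _ C(2)]) measurable
  moreover have "\<bar>mollify v \<rho> (x + y) - mollify v \<rho> x\<bar> \<le> M * l1 v * norm y" for x y
  proof -
    have "mollify v \<rho> (x + y) - mollify v \<rho> x = (LBINT z. v z * (\<rho> (x + y - z) - \<rho> (x - z)))"
      unfolding mollify_def right_diff_distrib using i by simp
    also have "\<bar>\<dots>\<bar> \<le> M * norm y * l1 v"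
    proof (rule integrable_mult_bounded(2)[OF v])
      show "\<bar>\<rho> (x + y - z) - \<rho> (x - z)\<bar> \<le> M * norm y" for z using C(3)[of "x - z" y] by (simp add: algebra_simps)
    qed measurable
    finally show ?thesis by (simp add: mult_ac)
  qed
  moreover have "\<bar>sdiff (mollify v \<rho>) x y\<bar> \<le> M * l1 v * (norm y)\<^sup>2" for x y
  proof -
    have "sdiff (mollify v \<rho>) x y = (LBINT z. v z * sdiff \<rho> (x - z) y)" by (rule sdiff_mollify[OF assms])
    also have "\<bar>\<dots>\<bar> \<le> M * (norm y)\<^sup>2 * l1 v"
      by (rule integrable_mult_bounded(2)[OF v _ C(5)]) measurable
    finally show ?thesis by (simp add: mult_ac)
  qed
  ultimately show ?thesis by (simp add: C11_def)
qed

lemma mollify_pair_integrable: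
  fixes v :: "'a::euclidean_space \<Rightarrow> real"
  assumes v: "integrable lborel v" and \<rho>: "mollifier \<epsilon> \<rho>"
  shows "integrable (lborel \<Otimes>\<^sub>M lborel) (\<lambda>(z, x). v z * \<rho> (x - z))"
proof (rule lborel_pair.Fubini_integrable)
  note R = mollifierD[OF \<rho>]
  have [measurable]: "v \<in> borel_measurable borel" "\<rho> \<in> borel_measurable borel" using v R by auto
  show "(\<lambda>(z, x). v z * \<rho> (x - z)) \<in> borel_measurable (lborel \<Otimes>\<^sub>M lborel)" by measurable
  have "(LBINT x. norm (case (z, x) of (z, x) \<Rightarrow> v z * \<rho> (x - z))) = \<bar>v z\<bar>" for z
    using integral_lborel_shift(3)[of \<rho> z] R by (simp add: abs_mult)
  then show "integrable lborel (\<lambda>z. LBINT x. norm (case (z, x) of (z, x) \<Rightarrow> v z * \<rho> (x - z)))"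
    using v by simp
  show "AE z in lborel. integrable lborel (\<lambda>x. case (z, x) of (z, x) \<Rightarrow> v z * \<rho> (x - z))"
    using integrable_lborel_shift(3)[OF R(7)] by auto
qed

lemma mollify_integral:
  fixes v :: "'a::euclidean_space \<Rightarrow> real"
  assumes v: "integrable lborel v" and \<rho>: "mollifier \<epsilon> \<rho>"
  shows "integrable lborel (mollify v \<rho>)" "(LBINT x. mollify v \<rho> x) = (LBINT x. v x)"
proof -
  note R = mollifierD[OF \<rho>] and i = mollify_pair_integrable[OF assms]
  show "integrable lborel (mollify v \<rho>)"
    unfolding mollify_def[abs_def] using lborel_pair.integrable_snd[of "\<lambda>z x. v z * \<rho> (x - z)"] i by simp
  have "(LBINT x. mollify v \<rho> x) = (LBINT z. (LBINT x. v z * \<rho> (x - z)))"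
    unfolding mollify_def by (rule lborel_pair.Fubini_integral[OF i])
  also have "\<dots> = (LBINT z. v z)"
    using integral_lborel_shift(3)[OF R(6)] R(4) by simp
  finally show "(LBINT x. mollify v \<rho> x) = (LBINT x. v x)" .
qed

lemma mollify_L1:
  fixes v :: "'a::euclidean_space \<Rightarrow> real"
  assumes v: "integrable lborel v" and \<rho>: "mollifier \<epsilon> \<rho>"
  shows "(LBINT x. \<bar>mollify v \<rho> x\<bar>) \<le> l1 v"
proof -
  note R = mollifierD[OF \<rho>]
  have va: "integrable lborel (\<lambda>x. \<bar>v x\<bar>)" using v by simp
  have "(LBINT x. \<bar>mollify v \<rho> x\<bar>) \<le> (LBINT x. mollify (\<lambda>x. \<bar>v x\<bar>) \<rho> x)"
  proof (rule integral_mono)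
    fix x
    have "\<bar>mollify v \<rho> x\<bar> \<le> (LBINT z. \<bar>v z * \<rho> (x - z)\<bar>)" unfolding mollify_def by (rule integral_abs_bound)
    then show "\<bar>mollify v \<rho> x\<bar> \<le> mollify (\<lambda>x. \<bar>v x\<bar>) \<rho> x" using R(2) by (simp add: mollify_def abs_mult)
  qed (use mollify_integral(1)[OF v \<rho>] mollify_integral(1)[OF va \<rho>] in auto)
  then show ?thesis using mollify_integral(2)[OF va \<rho>] by simp
qed

text \<open>Jensen's inequality for the probability density z \<mapsto> \<rho> (x - z), obtained
  from Cauchy-Schwarz by splitting \<rho> into two square roots; the integral of g^2 is then
  preserved by mollification.\<close>

lemma mollify_L2:
  fixes g :: "'a::euclidean_space \<Rightarrow> real"
  assumes g: "L2 g" and \<rho>: "mollifier \<epsilon> \<rho>"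
  shows "L2 (mollify g \<rho>)" "l2 (mollify g \<rho>) \<le> l2 g"
proof -
  note R = mollifierD[OF \<rho>]
  have [measurable]: "g \<in> borel_measurable borel" and \<rho>m[measurable]: "\<rho> \<in> borel_measurable borel"
    using g R by auto
  have g2: "integrable lborel (\<lambda>x. (g x)\<^sup>2)" using g by auto
  obtain M where M: "C11 M \<rho>" using R(1) by (auto simp: C11c_def)
  have sq: "(mollify g \<rho> x)\<^sup>2 \<le> mollify (\<lambda>x. (g x)\<^sup>2) \<rho> x" for x
  proof -
    note \<rho>i = integrable_lborel_shift(4)[OF R(7), of x]
    have L: "L2 (\<lambda>z. sqrt (\<rho> (x - z)))" "(l2 (\<lambda>z. sqrt (\<rho> (x - z))))\<^sup>2 = 1"
      using \<rho>i R(2) R(4) integral_lborel_shift(4)[OF R(6), of x] by (auto simp: L2_in_def l2_sq)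
    have i2: "integrable lborel (\<lambda>z. (g z)\<^sup>2 * \<rho> (x - z))"
      by (rule integrable_mult_bounded(1)[OF g2 _ C11D(2)[OF M]]) measurable
    have L': "L2 (\<lambda>z. g z * sqrt (\<rho> (x - z)))"
      "(l2 (\<lambda>z. g z * sqrt (\<rho> (x - z))))\<^sup>2 = mollify (\<lambda>x. (g x)\<^sup>2) \<rho> x"
      using i2 R(2) by (auto simp: L2_in_def l2_sq mollify_def power_mult_distrib)
    have "mollify g \<rho> x = (LBINT z. (g z * sqrt (\<rho> (x - z))) * sqrt (\<rho> (x - z)))"
      using R(2) by (simp add: mollify_def mult.assoc)
    then have "\<bar>mollify g \<rho> x\<bar>\<^sup>2 \<le> (l2 (\<lambda>z. g z * sqrt (\<rho> (x - z))) * l2 (\<lambda>z. sqrt (\<rho> (x - z))))\<^sup>2"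
      using l2_Cauchy_Schwarz[OF L'(1) L(1)] by (intro power_mono) auto
    then show ?thesis unfolding power_mult_distrib L' L by simp
  qed
  note m = mollify_integral[OF g2 \<rho>]
  have "integrable lborel (\<lambda>x. (mollify g \<rho> x)\<^sup>2)"
    by (rule Bochner_Integration.integrable_bound[OF m(1)]) (auto intro: order_trans[OF sq abs_ge_self])
  then show L: "L2 (mollify g \<rho>)" by (simp add: L2_in_def)
  show "l2 (mollify g \<rho>) \<le> l2 g"
  proof (rule power2_le_imp_le)
    have "(l2 (mollify g \<rho>))\<^sup>2 \<le> (LBINT x. mollify (\<lambda>x. (g x)\<^sup>2) \<rho> x)"
      unfolding l2_sq using L m(1) sq by (intro integral_mono) auto
    then show "(l2 (mollify g \<rho>))\<^sup>2 \<le> (l2 g)\<^sup>2" using m(2) by (simp add: l2_sq)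
  qed simp
qed

text \<open>Fubini moves the averaging onto h, where continuity gives pointwise convergence and the
  bound H gives the dominating function H |v|. Convergence of the pairings thus follows without any
  norm convergence of the mollified functions.\<close>

lemma mollify_pairing_tendsto:
  fixes v :: "'a::euclidean_space \<Rightarrow> real"
  assumes v: "integrable lborel v" and \<rho>: "\<And>k. mollifier (\<epsilon> k) (\<rho> k)" and \<epsilon>: "\<epsilon> \<longlonglongrightarrow> 0"
    and h: "\<And>x. isCont h x" "\<And>x. \<bar>h x\<bar> \<le> H"
  shows "(\<lambda>k. LBINT x. mollify v (\<rho> k) x * h x) \<longlonglongrightarrow> (LBINT x. v x * h x)"
proof -
  have [measurable]: "h \<in> borel_measurable borel"
    using h(1) by (intro borel_measurable_continuous_onI continuous_at_imp_continuous_on) auto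
  have [measurable]: "v \<in> borel_measurable borel" using v by auto
  note R = mollifierD[OF \<rho>]
  have [measurable]: "\<rho> k \<in> borel_measurable borel" for k by (rule R)
  define s where "s k z = (LBINT x. \<rho> k (x - z) * h x)" for k z
  have \<rho>i: "integrable lborel (\<lambda>x. \<rho> k (x - z))" "(LBINT x. \<rho> k (x - z)) = 1" for k z
    using integrable_lborel_shift(3)[OF R(7)] integral_lborel_shift(3)[OF R(6)] R(4) by auto
  have si: "integrable lborel (\<lambda>x. \<rho> k (x - z) * h x)" for k z
    by (rule integrable_mult_bounded(1)[OF \<rho>i(1) _ h(2)]) measurable
  have [measurable]: "s k \<in> borel_measurable borel" for k unfolding s_def[abs_def] by measurable
  have sH: "\<bar>s k z\<bar> \<le> H" for k z
    using integrable_mult_bounded(2)[OF \<rho>i(1)[of k z] _ h(2)] \<rho>i(2)[of k z] R(2) by (simp add: s_def)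
  have slim: "(\<lambda>k. s k z) \<longlonglongrightarrow> h z" for z
  proof (rule LIMSEQ_I)
    fix r :: real assume r: "0 < r"
    from h(1)[of z] r obtain d where d: "0 < d" "\<And>x. norm (x - z) < d \<Longrightarrow> \<bar>h x - h z\<bar> < r / 2"
      unfolding continuous_at_eps_delta dist_norm real_norm_def by (metis half_gt_zero)
    from \<epsilon> d(1) obtain N where N: "\<And>k. N \<le> k \<Longrightarrow> \<epsilon> k < d"
      by (metis LIMSEQ_D abs_ge_self diff_zero order_le_less_trans real_norm_def)
    have "norm (s k z - h z) < r" if k: "N \<le> k" for k
    proof -
      have "s k z - h z = (LBINT x. \<rho> k (x - z) * h x - \<rho> k (x - z) * h z)"
        using si[of k z] \<rho>i[of k z] by (simp add: s_def)
      also have "\<bar>\<dots>\<bar> \<le> (LBINT x. \<bar>\<rho> k (x - z) * h x - \<rho> k (x - z) * h z\<bar>)" by (rule integral_abs_bound)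
      also have "\<dots> \<le> (LBINT x. \<rho> k (x - z) * (r / 2))"
      proof (rule integral_mono)
        show "integrable lborel (\<lambda>x. \<bar>\<rho> k (x - z) * h x - \<rho> k (x - z) * h z\<bar>)"
          using si[of k z] \<rho>i(1)[of k z] by auto
        show "integrable lborel (\<lambda>x. \<rho> k (x - z) * (r / 2))" using \<rho>i(1)[of k z] by simp
        fix x
        show "\<bar>\<rho> k (x - z) * h x - \<rho> k (x - z) * h z\<bar> \<le> \<rho> k (x - z) * (r / 2)"
        proof (cases "norm (x - z) < d")
          case True
          have "\<bar>\<rho> k (x - z) * (h x - h z)\<bar> \<le> \<rho> k (x - z) * (r / 2)"
            unfolding abs_mult using d(2)[OF True] R(2)[of k "x - z"] by (intro mult_mono) auto
          then show ?thesis by (simp add: right_diff_distrib)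
        next
          case False
          then have "\<rho> k (x - z) = 0" using N[OF k] by (intro R(3)) auto
          then show ?thesis by simp
        qed
      qed
      also have "\<dots> = r / 2" using \<rho>i(2)[of k z] by simp
      finally show ?thesis using r by simp
    qed
    then show "\<exists>N. \<forall>k\<ge>N. norm (s k z - h z) < r" by blast
  qed
  have eq: "(LBINT x. mollify v (\<rho> k) x * h x) = (LBINT z. v z * s k z)" for k
  proof -
    have i: "integrable (lborel \<Otimes>\<^sub>M lborel) (\<lambda>(z, x). v z * \<rho> k (x - z) * h x)"
    proof -
      have "integrable (lborel \<Otimes>\<^sub>M lborel) (\<lambda>p. (case p of (z, x) \<Rightarrow> v z * \<rho> k (x - z)) * (case p of (z, x) \<Rightarrow> h x))"
        by (rule integrable_mult_bounded(1)[OF mollify_pair_integrable[OF v \<rho>], of _ H]) (use h(2) in \<open>auto split: prod.splits\<close>)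
      then show ?thesis by (simp add: case_prod_beta')
    qed
    have "(LBINT x. mollify v (\<rho> k) x * h x) = (LBINT x. (LBINT z. v z * \<rho> k (x - z) * h x))"
      by (simp add: mollify_def)
    also have "\<dots> = (LBINT z. (LBINT x. v z * \<rho> k (x - z) * h x))"
      by (rule lborel_pair.Fubini_integral[OF i])
    finally show ?thesis by (simp add: s_def mult.assoc)
  qed
  show ?thesis
    unfolding eq
  proof (rule integral_dominated_convergence[where w="\<lambda>z. H * \<bar>v z\<bar>"])
    show "integrable lborel (\<lambda>z. H * \<bar>v z\<bar>)" using v by simp
    show "AE z in lborel. (\<lambda>k. v z * s k z) \<longlonglongrightarrow> v z * h z" using slim by (auto intro!: tendsto_intros)
    show "AE z in lborel. norm (v z * s k z) \<le> H * \<bar>v z\<bar>" for k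
      using mult_left_mono[OF sH[of k], of "\<bar>v z\<bar>" for z] by (auto simp: abs_mult mult.commute)
  qed measurable
qed

section \<open>Operators and mollification\<close>

context levy_kernel
begin

text \<open>Reflection merely exchanges the two translates in \<open>sdiff\<close>.\<close>

lemma Lop_reflect: "Lop K (\<lambda>z. \<rho> (x - z)) z = Lop K \<rho> (x - z)"
  unfolding Lop_def sdiff_def by (rule Bochner_Integration.integral_cong) (auto simp: algebra_simps)

text \<open>At x the operator on the mollified function is the weak pairing of v with the test
  function \<rho> (x - z). Hence the weak equation becomes a pointwise one for the mollified
  function.\<close>

lemma Lop_mollify:
  assumes v: "integrable lborel v" and \<rho>: "C11 M \<rho>"
  shows "Lop K (mollify v \<rho>) x = (LBINT z. v z * Lop K (\<lambda>z. \<rho> (x - z)) z)"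
proof -
  note C = C11D[OF \<rho>]
  have [measurable]: "v \<in> borel_measurable borel" "\<rho> \<in> borel_measurable borel" using v C by auto
  have I: "integrable (lborel \<Otimes>\<^sub>M lborel) (\<lambda>(z, y). v z * sdiff \<rho> (x - z) y * K y)"
  proof (rule lborel_pair.Fubini_integrable)
    have b: "\<bar>sdiff \<rho> (x - z) y\<bar> \<le> 4 * M * trunc_sq y" for y z by (rule C11_sdiff_le[OF \<rho>])
    have ki: "integrable lborel (\<lambda>y. \<bar>sdiff \<rho> (x - z) y\<bar> * K y)" "(LBINT y. \<bar>sdiff \<rho> (x - z) y\<bar> * K y) \<le> 4 * M * kmass K" for z
      using integrable_times_K[of "\<lambda>y. \<bar>sdiff \<rho> (x - z) y\<bar>" "4 * M"] b by force+
    have eq: "(LBINT y. norm (case (z, y) of (z, y) \<Rightarrow> v z * sdiff \<rho> (x - z) y * K y))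
        = \<bar>v z\<bar> * (LBINT y. \<bar>sdiff \<rho> (x - z) y\<bar> * K y)" for z
      by (simp add: abs_mult K_nonneg mult.assoc)
    have "integrable lborel (\<lambda>z. \<bar>v z\<bar> * (LBINT y. \<bar>sdiff \<rho> (x - z) y\<bar> * K y))"
    proof (rule integrable_mult_bounded(1)[of _ _ _ "4 * M * kmass K"])
      have "0 \<le> (LBINT y. \<bar>sdiff \<rho> (x - z) y\<bar> * K y)" for z
        by (intro integral_nonneg_AE) (simp add: K_nonneg)
      then show "\<bar>LBINT y. \<bar>sdiff \<rho> (x - z) y\<bar> * K y\<bar> \<le> 4 * M * kmass K" for z
        using ki(2)[of z] by simp
    qed (use v in auto)
    then show "integrable lborel (\<lambda>z. LBINT y. norm (case (z, y) of (z, y) \<Rightarrow> v z * sdiff \<rho> (x - z) y * K y))"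
      unfolding eq .
    have "integrable lborel (\<lambda>y. v z * (sdiff \<rho> (x - z) y * K y))" for z
      using Lop_integrable[OF \<rho>, of "x - z"] by simp
    then show "AE z in lborel. integrable lborel (\<lambda>y. case (z, y) of (z, y) \<Rightarrow> v z * sdiff \<rho> (x - z) y * K y)"
      by (simp add: mult.assoc)
  qed measurable
  have "Lop K (mollify v \<rho>) x = (LBINT y. (LBINT z. v z * sdiff \<rho> (x - z) y * K y))"
    unfolding Lop_def sdiff_mollify[OF assms] by simp
  also have "\<dots> = (LBINT z. (LBINT y. v z * sdiff \<rho> (x - z) y * K y))"
    by (rule lborel_pair.Fubini_integral[OF I])
  also have "\<dots> = (LBINT z. v z * Lop K \<rho> (x - z))"
    by (simp add: Lop_def mult.assoc)
  finally show ?thesis by (simp add: Lop_reflect)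
qed

text \<open>Supplies the continuous bounded multiplier for \<open>mollify_pairing_tendsto\<close>;
  dominated convergence with weight \<open>trunc_sq y * K y\<close>.\<close>

lemma isCont_Lop:
  assumes v: "C11 M v" shows "isCont (Lop K v) x"
  unfolding continuous_at_sequentially
proof (intro allI impI)
  fix s assume s: "s \<longlonglongrightarrow> x"
  note C = C11D[OF v]
  have [measurable]: "v \<in> borel_measurable borel" by (rule C)
  have v_lim: "(\<lambda>k. v (s k + y)) \<longlonglongrightarrow> v (x + y)" for y
  proof (rule LIM_zero_cancel, rule Lim_null_comparison)
    have "\<bar>v (s k + y) - v (x + y)\<bar> \<le> M * norm (s k - x)" for k
      using C(3)[of "x + y" "s k - x"] by (simp add: algebra_simps)
    then show "\<forall>\<^sub>F k in sequentially. norm (v (s k + y) - v (x + y)) \<le> M * norm (s k - x)" by simp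
    show "(\<lambda>k. M * norm (s k - x)) \<longlonglongrightarrow> 0"
      using s by (intro tendsto_mult_right_zero tendsto_norm_zero LIM_zero)
  qed
  have "(\<lambda>k. LBINT y. sdiff v (s k) y * K y) \<longlonglongrightarrow> (LBINT y. sdiff v x y * K y)"
  proof (rule integral_dominated_convergence[where w="\<lambda>y. 4 * M * (trunc_sq y * K y)"])
    show "integrable lborel (\<lambda>y. 4 * M * (trunc_sq y * K y))" using K_int by simp
    have "(\<lambda>k. sdiff v (s k) y * K y) \<longlonglongrightarrow> sdiff v x y * K y" for y
      unfolding sdiff_def using v_lim[of y] v_lim[of "- y"] v_lim[of 0] by (intro tendsto_intros) auto
    then show "AE y in lborel. (\<lambda>k. sdiff v (s k) y * K y) \<longlonglongrightarrow> sdiff v x y * K y" by simp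
    show "AE y in lborel. norm (sdiff v (s k) y * K y) \<le> 4 * M * (trunc_sq y * K y)" for k
      using mult_right_mono[OF C11_sdiff_le[OF v, of "s k"] K_nonneg] by (auto simp: abs_mult K_nonneg mult.assoc)
  qed measurable
  then show "(Lop K v \<circ> s) \<longlonglongrightarrow> Lop K v x" by (simp add: o_def Lop_def)
qed

end

section \<open>The interior estimate in weak form\<close>

text \<open>Split w with the innermost cutoff. For \<eta> w the operator is moved off \<phi>,
  exchanged for \<open>Lop K\<close> at the cost of the ratio Lam / lam, and bounded by the a priori
  estimate. The rest of w lives away from the support of \<phi>, where \<open>Lop K' \<phi>\<close>
  is bounded by the L1 norm of \<phi>, hence by its L2 norm.\<close>

lemma interior_bound_C11:
  fixes lam Lam :: real
  assumes lam: "0 < lam"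
  obtains C where "0 \<le> C"
    "\<And>\<sigma> (K :: 'a::euclidean_space \<Rightarrow> real) K' M w g \<phi>.
      frac_kernel \<sigma> lam Lam K \<Longrightarrow> frac_kernel \<sigma> lam Lam K' \<Longrightarrow> C11 M w \<Longrightarrow> integrable lborel w \<Longrightarrow>
      L2 g \<Longrightarrow> (\<And>x. norm x < 3/4 \<Longrightarrow> Lop K w x = g x) \<Longrightarrow>
      C11c \<phi> \<Longrightarrow> (\<And>x. 1/2 \<le> norm x \<Longrightarrow> \<phi> x = 0) \<Longrightarrow>
      \<bar>LBINT x. w x * Lop K' \<phi> x\<bar> \<le> C * (l2 g + l1 w) * l2 \<phi>"
proof (rule apriori_estimate[OF lam, of Lam, where 'a='a])
  fix C0 :: real
  assume C0: "0 \<le> C0" and apriori: "\<And>\<sigma> (K :: 'a \<Rightarrow> real) M w g.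
      frac_kernel \<sigma> lam Lam K \<Longrightarrow> C11 M w \<Longrightarrow> integrable lborel w \<Longrightarrow> L2 g \<Longrightarrow>
      (\<And>x. norm x < 3/4 \<Longrightarrow> Lop K w x = g x) \<Longrightarrow>
      l2 (Lop K (\<lambda>x. cutoff (3/10) (7/20) x * w x)) \<le> C0 * (l2 g + l1 w)"
  define m where "m = sqrt (measure lborel (cball (0::'a) 1))"
  \<comment> \<open>1/25 = 27/50 - 1/2 is the distance between the support of \<phi> and the points
    where \<eta> may differ from 1.\<close>
  define b where "b = \<bar>Lam\<bar> / (1/25) ^ (DIM('a) + 2)"
  define C where "C = \<bar>Lam\<bar> / lam * C0 + 2 * b * m"
  have nn: "0 \<le> m" "0 \<le> b" by (auto simp: m_def b_def)
  show thesis
  proof (rule that[of C])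
    show "0 \<le> C" using C0 lam nn by (simp add: C_def)
    fix \<sigma> M :: real and K K' w g \<phi> :: "'a \<Rightarrow> real"
    assume K: "frac_kernel \<sigma> lam Lam K" and K': "frac_kernel \<sigma> lam Lam K'" and w: "C11 M w" "integrable lborel w"
      and g: "L2 g" "\<And>x. norm x < 3/4 \<Longrightarrow> Lop K w x = g x"
      and \<phi>: "C11c \<phi>" "\<And>x. 1/2 \<le> norm x \<Longrightarrow> \<phi> x = 0"
    interpret K: frac_kernel \<sigma> lam Lam K by fact
    interpret K': frac_kernel \<sigma> lam Lam K' by fact
    define G where "G = l2 g + l1 w"
    have W: "0 \<le> l1 w" "l1 w \<le> G" by (auto simp: G_def)
    define \<eta> where "\<eta> = (cutoff (3/10) (7/20) :: 'a \<Rightarrow> real)"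
    have \<eta>C: "C11 (200 / (7/20 - 3/10)\<^sup>2) \<eta>" unfolding \<eta>_def by (rule C11_cutoff) auto
    have \<eta>0: "\<eta> x = 0" if "1 < norm x" for x
    proof -
      have "1 \<le> (norm x)\<^sup>2" using that by simp
      then show ?thesis unfolding \<eta>_def by (intro cutoff_eq_0) auto
    qed
    define v where "v = (\<lambda>x. \<eta> x * w x)"
    have vM: "C11 (4 * (200 / (7/20 - 3/10)\<^sup>2) * M) v" unfolding v_def by (rule C11_mult[OF \<eta>C w(1)])
    have v: "C11c v" using vM \<eta>0 unfolding C11c_def bsupp_def v_def by (metis mult_zero_left)
    obtain N where N: "C11 N \<phi>" using \<phi>(1) by (auto simp: C11c_def)
    have [measurable]: "\<phi> \<in> borel_measurable borel" "w \<in> borel_measurable borel" "\<eta> \<in> borel_measurable borel"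
      using C11D(1)[OF N] C11D(1)[OF w(1)] C11D(1)[OF \<eta>C] by auto
    have KK: "K' y \<le> (Lam / lam) * K y" for y
    proof -
      have "K' y \<le> (2 - \<sigma>) * Lam / norm y powr (real DIM('a) + \<sigma>)" by (rule K'.upper)
      also have "\<dots> = (Lam / lam) * ((2 - \<sigma>) * lam / norm y powr (real DIM('a) + \<sigma>))" using lam by simp
      also have "\<dots> \<le> (Lam / lam) * K y" using lam K.Lam_nonneg by (intro mult_left_mono K.lower) auto
      finally show ?thesis .
    qed
    have Lm: "Lop K' \<phi> \<in> borel_measurable lborel" by measurable
    have vi: "integrable lborel v" by (rule C11c_integrable[OF v])
    note Lb = K'.Lop_bound[OF N]
    have 1: "\<bar>LBINT x. v x * Lop K' \<phi> x\<bar> \<le> \<bar>Lam\<bar> / lam * C0 * G * l2 \<phi>"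
    proof -
      have "(LBINT x. v x * Lop K' \<phi> x) = (LBINT x. Lop K' v x * \<phi> x)"
        by (rule C11c_swap_Lop[OF K'.levy_kernel_axioms \<phi>(1) vM])
      also have "\<bar>\<dots>\<bar> \<le> l2 (Lop K' v) * l2 \<phi>"
        by (rule l2_Cauchy_Schwarz[OF K'.Lop_L2[OF v] C11c_L2[OF \<phi>(1)]])
      also have "\<dots> \<le> ((Lam / lam) * l2 (Lop K v)) * l2 \<phi>"
        using lam K.Lam_nonneg
        by (intro mult_right_mono Lop_L2_comparison[OF K.levy_kernel_axioms K'.levy_kernel_axioms KK _ v]) auto
      also have "\<dots> \<le> ((Lam / lam) * (C0 * G)) * l2 \<phi>"
        using lam K.Lam_nonneg apriori[OF K w g] by (intro mult_right_mono mult_left_mono) (auto simp: v_def \<eta>_def G_def)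
      finally show ?thesis using K.Lam_nonneg by simp
    qed
    define F where "F = l1 \<phi>"
    have F: "0 \<le> F" "F \<le> l2 \<phi> * m"
    proof -
      show "0 \<le> F" by (simp add: F_def)
      note ind = L2_indicator_cball[of 1 1, where 'a='a] l2_indicator_cball[of 1 1, where 'a='a]
      have "F = (LBINT x. \<bar>\<phi> x\<bar> * indicator (cball 0 1) x)"
        unfolding F_def using \<phi>(2) by (intro Bochner_Integration.integral_cong) (auto simp: indicator_def)
      then show "F \<le> l2 \<phi> * m"
        using l2_Cauchy_Schwarz[OF L2_abs[OF C11c_L2[OF \<phi>(1)]] ind(1)] ind(2) by (simp add: m_def)
    qed
    have 2: "\<bar>(w x - v x) * Lop K' \<phi> x\<bar> \<le> (2 * b * F) * \<bar>w x\<bar>" for x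
    proof (cases "(norm x)\<^sup>2 \<le> 3/10")
      case True
      then have "\<eta> x = 1" unfolding \<eta>_def by (intro cutoff_eq_1) auto
      then show ?thesis using nn F by (simp add: v_def)
    next
      case False
      \<comment> \<open>(27/50)^2 = 0.2916 is a rational square just below 3/10.\<close>
      have x: "27/50 < norm x"
      proof (rule power_less_imp_less_base)
        show "(27/50)\<^sup>2 < (norm x)\<^sup>2" using False by (simp add: power2_eq_square)
      qed simp
      have "\<bar>Lop K' \<phi> x\<bar> \<le> 2 * b * F"
        unfolding F_def
      proof (rule K'.Lop_far[OF C11c_integrable[OF \<phi>(1)], of x "1/25"])
        fix y assume "norm (y - x) < 1/25"
        then show "\<phi> y = 0" using x norm_triangle_ineq3[of y x] by (intro \<phi>(2)) linarith
      next
        fix y :: 'a assume "1/25 \<le> norm y"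
        then show "K' y \<le> b" using K'.K_far[of "1/25" y] K'.Lam_nonneg by (simp add: b_def)
      qed simp
      moreover have "\<bar>w x - v x\<bar> \<le> \<bar>w x\<bar>"
      proof -
        have "w x - v x = (1 - \<eta> x) * w x" by (simp add: v_def algebra_simps)
        then show ?thesis
          using cutoff_01[of "3/10" "7/20" x] by (simp add: \<eta>_def abs_mult mult_left_le_one_le)
      qed
      ultimately show ?thesis
        unfolding abs_mult using nn F by (subst mult.commute) (intro mult_mono, auto)
    qed
    have i1: "integrable lborel (\<lambda>x. v x * Lop K' \<phi> x)" by (rule integrable_mult_bounded(1)[OF vi Lm Lb])
    have i2: "integrable lborel (\<lambda>x. (w x - v x) * Lop K' \<phi> x)"
      by (rule integrable_mult_bounded(1)[OF _ Lm Lb]) (use w(2) vi in auto)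
    have "\<bar>LBINT x. (w x - v x) * Lop K' \<phi> x\<bar> \<le> (LBINT x. \<bar>(w x - v x) * Lop K' \<phi> x\<bar>)"
      by (rule integral_abs_bound)
    also have "\<dots> \<le> (LBINT x. (2 * b * F) * \<bar>w x\<bar>)"
      using i2 w(2) 2 by (intro integral_mono) auto
    also have "\<dots> = (2 * b * F) * l1 w" by simp
    also have "\<dots> \<le> (2 * b * (l2 \<phi> * m)) * G"
      using nn F W by (intro mult_mono mult_left_mono) auto
    finally have 3: "\<bar>LBINT x. (w x - v x) * Lop K' \<phi> x\<bar> \<le> 2 * b * m * G * l2 \<phi>" by (simp add: mult_ac)
    have "(LBINT x. w x * Lop K' \<phi> x) = (LBINT x. v x * Lop K' \<phi> x + (w x - v x) * Lop K' \<phi> x)"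
      by (rule Bochner_Integration.integral_cong) (auto simp: algebra_simps)
    also have "\<dots> = (LBINT x. v x * Lop K' \<phi> x) + (LBINT x. (w x - v x) * Lop K' \<phi> x)"
      using i1 i2 by simp
    finally have "\<bar>LBINT x. w x * Lop K' \<phi> x\<bar> \<le> \<bar>Lam\<bar> / lam * C0 * G * l2 \<phi> + 2 * b * m * G * l2 \<phi>"
      using 1 3 by linarith
    also have "\<dots> = C * G * l2 \<phi>" by (simp add: C_def algebra_simps)
    finally show "\<bar>LBINT x. w x * Lop K' \<phi> x\<bar> \<le> C * (l2 g + l1 w) * l2 \<phi>"
      by (simp add: G_def)
  qed
qed

text \<open>The bound for C11 functions is applied to mollifications of v. Neither C nor the
  right-hand side deteriorates, since mollification does not increase the norms of v and g, and the
  pairing with \<open>Lop K' \<phi>\<close> passes to the limit.\<close>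

theorem interior_bound:
  fixes lam Lam :: real
  assumes lam: "0 < lam"
  obtains C where "0 \<le> C"
    "\<And>\<sigma> (K :: 'a::euclidean_space \<Rightarrow> real) K' v g \<phi>.
      frac_kernel \<sigma> lam Lam K \<Longrightarrow> frac_kernel \<sigma> lam Lam K' \<Longrightarrow> integrable lborel v \<Longrightarrow>
      L2 g \<Longrightarrow> (\<And>\<psi>. test_fun (7/8) \<psi> \<Longrightarrow> (LBINT x. v x * Lop K \<psi> x) = (LBINT x. g x * \<psi> x)) \<Longrightarrow>
      C11c \<phi> \<Longrightarrow> (\<And>x. 1/2 \<le> norm x \<Longrightarrow> \<phi> x = 0) \<Longrightarrow>
      \<bar>LBINT x. v x * Lop K' \<phi> x\<bar> \<le> C * (l2 g + l1 v) * l2 \<phi>"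
proof (rule interior_bound_C11[OF lam, of Lam, where 'a='a])
  fix C :: real
  assume C: "0 \<le> C" and bound: "\<And>\<sigma> (K :: 'a \<Rightarrow> real) K' M w g \<phi>.
      frac_kernel \<sigma> lam Lam K \<Longrightarrow> frac_kernel \<sigma> lam Lam K' \<Longrightarrow> C11 M w \<Longrightarrow> integrable lborel w \<Longrightarrow>
      L2 g \<Longrightarrow> (\<And>x. norm x < 3/4 \<Longrightarrow> Lop K w x = g x) \<Longrightarrow>
      C11c \<phi> \<Longrightarrow> (\<And>x. 1/2 \<le> norm x \<Longrightarrow> \<phi> x = 0) \<Longrightarrow>
      \<bar>LBINT x. w x * Lop K' \<phi> x\<bar> \<le> C * (l2 g + l1 w) * l2 \<phi>"
  show thesis
  proof (rule that[OF C])
    fix \<sigma> :: real and K K' v g \<phi> :: "'a \<Rightarrow> real"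
    assume K: "frac_kernel \<sigma> lam Lam K" and K': "frac_kernel \<sigma> lam Lam K'" and v: "integrable lborel v"
      and g: "L2 g" and sol: "\<And>\<psi>. test_fun (7/8) \<psi> \<Longrightarrow> (LBINT x. v x * Lop K \<psi> x) = (LBINT x. g x * \<psi> x)"
      and \<phi>: "C11c \<phi>" "\<And>x. 1/2 \<le> norm x \<Longrightarrow> \<phi> x = 0"
    interpret K: frac_kernel \<sigma> lam Lam K by fact
    interpret K': frac_kernel \<sigma> lam Lam K' by fact
    obtain N where N: "C11 N \<phi>" using \<phi>(1) by (auto simp: C11c_def)
    \<comment> \<open>The divisor 9 keeps every scale strictly below 1/8 = 7/8 - 3/4, so for |x| <
      3/4 the mollifier centred at x is a test function in the ball of radius 7/8.\<close>
    define \<epsilon> where "\<epsilon> k = inverse (real (Suc k)) / 9" for k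
    have \<epsilon>: "0 < \<epsilon> k" "\<epsilon> k < 1/8" for k
    proof -
      show "0 < \<epsilon> k" by (simp add: \<epsilon>_def)
      have "inverse (real (Suc k)) \<le> 1" by (simp add: inverse_le_1_iff)
      then show "\<epsilon> k < 1/8" by (simp add: \<epsilon>_def)
    qed
    have \<epsilon>0: "\<epsilon> \<longlonglongrightarrow> 0"
      using tendsto_divide_zero[OF LIMSEQ_inverse_real_of_nat, of 9] unfolding \<epsilon>_def[abs_def] by simp
    obtain \<rho> where \<rho>: "\<And>k. mollifier (\<epsilon> k) (\<rho> k :: 'a \<Rightarrow> real)" using ex_mollifier[OF \<epsilon>(1)] by metis
    define B where "B = C * (l2 g + l1 v) * l2 \<phi>"
    have le: "\<bar>LBINT x. mollify v (\<rho> k) x * Lop K' \<phi> x\<bar> \<le> B" for k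
    proof -
      note R = mollifierD[OF \<rho>[of k]]
      obtain M where M: "C11 M (\<rho> k)" using R(1) by (auto simp: C11c_def)
      have "Lop K (mollify v (\<rho> k)) x = mollify g (\<rho> k) x" if "norm x < 3/4" for x
      proof -
        have "test_fun (7/8) (\<lambda>z. \<rho> k (x - z))" using that \<epsilon>(2)[of k] by (intro R(5)) simp
        from sol[OF this] show ?thesis by (simp add: K.Lop_mollify[OF v M] mollify_def)
      qed
      then have "\<bar>LBINT x. mollify v (\<rho> k) x * Lop K' \<phi> x\<bar>
        \<le> C * (l2 (mollify g (\<rho> k)) + (LBINT x. \<bar>mollify v (\<rho> k) x\<bar>)) * l2 \<phi>"
        by (intro bound[OF K K' C11_mollify[OF v M] mollify_integral(1)[OF v \<rho>] mollify_L2(1)[OF g \<rho>] _ \<phi>]) auto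
      also have "\<dots> \<le> B"
        unfolding B_def using mollify_L2(2)[OF g \<rho>[of k]] mollify_L1[OF v \<rho>[of k]] C
        by (intro mult_right_mono mult_left_mono add_mono) auto
      finally show ?thesis .
    qed
    have "(\<lambda>k. \<bar>LBINT x. mollify v (\<rho> k) x * Lop K' \<phi> x\<bar>) \<longlonglongrightarrow> \<bar>LBINT x. v x * Lop K' \<phi> x\<bar>"
      by (intro tendsto_rabs mollify_pairing_tendsto[OF v \<rho> \<epsilon>0 K'.isCont_Lop[OF N] K'.Lop_bound[OF N]])
    then have "\<bar>LBINT x. v x * Lop K' \<phi> x\<bar> \<le> B" by (rule LIMSEQ_le_const2) (use le in auto)
    then show "\<bar>LBINT x. v x * Lop K' \<phi> x\<bar> \<le> C * (l2 g + l1 v) * l2 \<phi>"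
      by (simp add: B_def)
  qed
qed

section \<open>The contribution of the exterior\<close>

text \<open>If |x| < 7/8 and |y| \<ge> 1 then |x - y| \<ge> |y| / 8; the power n + 2 of 8 dominates
  n + \<sigma>. The factor 2 replaces |y|^\<sigma> by the weight 1 + |y|^\<sigma>.\<close>

definition far_const :: "real \<Rightarrow> 'a::euclidean_space itself \<Rightarrow> real" where
  "far_const Lam _ = 2 * \<bar>Lam\<bar> * 8 ^ (DIM('a) + 2)"

context frac_kernel
begin

lemma K_exterior:
  assumes x: "norm x < 7/8" and y: "1 \<le> norm y"
  shows "K (x - y) \<le> far_const Lam TYPE('a) / (1 + norm y powr \<sigma>)"
    and "K (y - x) \<le> far_const Lam TYPE('a) / (1 + norm y powr \<sigma>)"
proof -
  have le: "K h \<le> far_const Lam TYPE('a) / (1 + norm y powr \<sigma>)" if h: "norm y / 8 \<le> norm h" for h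
  proof -
    define p where "p = real DIM('a) + \<sigma>"
    have p: "0 < p" "p \<le> real (DIM('a) + 2)" using \<sigma> by (auto simp: p_def)
    have y8: "0 < norm y / 8" using y by linarith
    have Y: "1 \<le> norm y powr \<sigma>" using y \<sigma> by (simp add: ge_one_powr_ge_zero)
    have "K h \<le> (2 - \<sigma>) * Lam / norm h powr p" unfolding p_def by (rule upper)
    also have "\<dots> \<le> (2 - \<sigma>) * Lam / (norm y / 8) powr p"
      using h y8 p \<sigma> Lam_nonneg by (intro divide_left_mono powr_mono2 mult_pos_pos mult_nonneg_nonneg) auto
    also have "\<dots> \<le> Lam / (norm y / 8) powr p"
      using \<sigma> Lam_nonneg by (intro divide_right_mono) (auto simp: mult_left_le_one_le)
    also have "\<dots> = Lam * 8 powr p / norm y powr p" using y by (simp add: powr_divide)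
    \<comment> \<open>The additional decay |y|^(-n) is given away to match the weight of the norm of
      u.\<close>
    also have "\<dots> \<le> Lam * 8 ^ (DIM('a) + 2) / norm y powr \<sigma>"
    proof (intro frac_le mult_left_mono Lam_nonneg mult_nonneg_nonneg)
      have "(8::real) powr p \<le> 8 powr real (DIM('a) + 2)" using p by (intro powr_mono) auto
      also have "\<dots> = 8 ^ (DIM('a) + 2)" by (rule powr_realpow) simp
      finally show "(8::real) powr p \<le> 8 ^ (DIM('a) + 2)" .
      show "norm y powr \<sigma> \<le> norm y powr p" using y by (intro powr_mono) (auto simp: p_def)
      show "0 < norm y powr \<sigma>" using Y by linarith
    qed auto
    also have "\<dots> = far_const Lam TYPE('a) / (2 * norm y powr \<sigma>)"
      using Lam_nonneg by (simp add: far_const_def)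
    also have "\<dots> \<le> far_const Lam TYPE('a) / (1 + norm y powr \<sigma>)"
      using Y by (intro divide_left_mono mult_pos_pos) (auto simp: far_const_def)
    finally show ?thesis .
  qed
  have "norm y / 8 \<le> norm (x - y)"
    using norm_triangle_ineq2[of y x] x y by (simp add: norm_minus_commute)
  then show "K (x - y) \<le> far_const Lam TYPE('a) / (1 + norm y powr \<sigma>)"
    and "K (y - x) \<le> far_const Lam TYPE('a) / (1 + norm y powr \<sigma>)"
    using le[of "x - y"] le[of "y - x"] by (auto simp: norm_minus_commute)
qed

text \<open>Outside the support of \<psi> no cancellation is involved: the two translates are
  integrated separately and each is recentred at the argument of \<psi>.\<close>

lemma Lop_exterior:
  assumes \<psi>: "C11c \<psi>" "\<And>x. 7/8 \<le> norm x \<Longrightarrow> \<psi> x = 0" and y: "1 \<le> norm y"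
  shows "Lop K \<psi> y = (LBINT x. \<psi> x * (K (x - y) + K (y - x)))"
proof -
  have [measurable]: "\<psi> \<in> borel_measurable borel" using \<psi>(1) by measurable
  define B where "B = far_const Lam TYPE('a) / (1 + norm y powr \<sigma>)"
  have i: "integrable lborel (\<lambda>x. \<psi> x * J x)"
    if [measurable]: "J \<in> borel_measurable borel" and J: "\<And>x. 0 \<le> J x" "\<And>x. norm x < 7/8 \<Longrightarrow> J x \<le> B" for J
  proof (rule Bochner_Integration.integrable_bound)
    show "integrable lborel (\<lambda>x. B * \<psi> x)" using C11c_integrable[OF \<psi>(1)] by simp
    have "\<bar>\<psi> x * J x\<bar> \<le> \<bar>B * \<psi> x\<bar>" for x
    proof (cases "norm x < 7/8")
      case True
      then show ?thesis using mult_right_mono[OF J(2)[OF True] abs_ge_zero[of "\<psi> x"]] J(1)[of x] J(2)[OF True]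
        by (simp add: abs_mult mult.commute)
    qed (use \<psi>(2) in simp)
    then show "AE x in lborel. norm (\<psi> x * J x) \<le> norm (B * \<psi> x)" by simp
  qed measurable
  have i1: "integrable lborel (\<lambda>x. \<psi> x * K (x - y))" and i2: "integrable lborel (\<lambda>x. \<psi> x * K (y - x))"
    using K_exterior[OF _ y] K_nonneg by (intro i; simp add: B_def)+
  have y0: "\<psi> y = 0" using \<psi>(2) y by simp
  have s1: "(LBINT h. \<psi> (y + h) * K h) = (LBINT x. \<psi> x * K (x - y))"
    and j1: "integrable lborel (\<lambda>h. \<psi> (y + h) * K h)"
    using integral_lborel_shift(2)[of "\<lambda>x. \<psi> x * K (x - y)" y] integrable_lborel_shift(2)[OF i1, of y] by simp_all
  have s2: "(LBINT h. \<psi> (y - h) * K h) = (LBINT x. \<psi> x * K (y - x))"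
    and j2: "integrable lborel (\<lambda>h. \<psi> (y - h) * K h)"
    using integral_lborel_shift(4)[of "\<lambda>x. \<psi> x * K (y - x)" y] integrable_lborel_shift(4)[OF i2, of y] by simp_all
  have "Lop K \<psi> y = (LBINT h. \<psi> (y + h) * K h + \<psi> (y - h) * K h)"
    by (simp add: Lop_def sdiff_def y0 distrib_right)
  also have "\<dots> = (LBINT x. \<psi> x * K (x - y)) + (LBINT x. \<psi> x * K (y - x))"
    using j1 j2 s1 s2 by simp
  also have "\<dots> = (LBINT x. \<psi> x * (K (x - y) + K (y - x)))"
    using i1 i2 by (simp add: distrib_left)
  finally show ?thesis .
qed

text \<open>On the ball of radius 7/8, where z vanishes, T is the operator applied to z, an
  absolutely convergent integral bounded by the weighted L1 norm. Fubini identifies it with the weak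
  pairing, so exterior values act on interior test functions like a bounded source.\<close>

lemma exterior_contribution:
  assumes z[measurable]: "z \<in> borel_measurable borel"
    and zi: "integrable lborel (\<lambda>y. \<bar>z y\<bar> / (1 + norm y powr \<sigma>))" and z0: "\<And>y. norm y < 1 \<Longrightarrow> z y = 0"
  obtains T where "L2 T"
    "l2 T \<le> 2 * far_const Lam TYPE('a) * sqrt (measure lborel (cball (0::'a) 1)) * (LBINT y. \<bar>z y\<bar> / (1 + norm y powr \<sigma>))"
    "\<And>\<psi>. C11c \<psi> \<Longrightarrow> (\<And>x. 7/8 \<le> norm x \<Longrightarrow> \<psi> x = 0) \<Longrightarrow>
       integrable lborel (\<lambda>x. z x * Lop K \<psi> x) \<and> (LBINT x. z x * Lop K \<psi> x) = (LBINT x. T x * \<psi> x)"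
proof -
  define c where "c = far_const Lam TYPE('a)"
  have c: "0 \<le> c" by (simp add: c_def far_const_def)
  define U where "U = (LBINT y. \<bar>z y\<bar> / (1 + norm y powr \<sigma>))"
  define m where "m = sqrt (measure lborel (cball (0::'a) 1))"
  define P where "P x y = z y * (K (x - y) + K (y - x))" for x y
  have P_le: "\<bar>P x y\<bar> \<le> 2 * c * (\<bar>z y\<bar> / (1 + norm y powr \<sigma>))" if "norm x < 7/8" for x y
  proof (cases "norm y < 1")
    case True then show ?thesis using z0 by (simp add: P_def)
  next
    case False
    have "\<bar>K (x - y) + K (y - x)\<bar> \<le> 2 * (c / (1 + norm y powr \<sigma>))"
      using K_exterior[OF that, of y] False K_nonneg[of "x - y"] K_nonneg[of "y - x"] by (simp add: c_def)
    from mult_left_mono[OF this abs_ge_zero[of "z y"]] show ?thesis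
      unfolding P_def abs_mult[of "z y"] by (simp add: mult_ac)
  qed
  define T where "T x = indicator (ball 0 (7/8)) x * (LBINT y. P x y)" for x
  have [measurable]: "ball (0::'a) r \<in> sets borel" for r by simp
  have [measurable]: "T \<in> borel_measurable borel" unfolding T_def[abs_def] P_def by measurable
  have T_le: "\<bar>T x\<bar> \<le> 2 * c * U * indicator (cball 0 1) x" for x
  proof (cases "norm x < 7/8")
    case True
    have Pi: "integrable lborel (\<lambda>y. 2 * c * (\<bar>z y\<bar> / (1 + norm y powr \<sigma>)))" by (intro integrable_mult_right zi)
    have Pi': "integrable lborel (P x)"
    proof (rule Bochner_Integration.integrable_bound[OF Pi])
      show "P x \<in> borel_measurable lborel" unfolding P_def[abs_def] by measurable
      show "AE y in lborel. norm (P x y) \<le> norm (2 * c * (\<bar>z y\<bar> / (1 + norm y powr \<sigma>)))"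
        unfolding real_norm_def by (intro AE_I2 order_trans[OF P_le[OF True] abs_ge_self])
    qed
    have "\<bar>LBINT y. P x y\<bar> \<le> (LBINT y. \<bar>P x y\<bar>)" by (rule integral_abs_bound)
    also have "\<dots> \<le> (LBINT y. 2 * c * (\<bar>z y\<bar> / (1 + norm y powr \<sigma>)))"
      using Pi Pi' P_le[OF True] by (intro integral_mono) auto
    also have "\<dots> = 2 * c * U" unfolding U_def by (rule integral_mult_right_zero)
    finally show ?thesis using True by (simp add: T_def)
  next
    case False
    have "0 \<le> U" unfolding U_def by (intro integral_nonneg_AE) (auto intro!: divide_nonneg_nonneg add_nonneg_nonneg)
    then show ?thesis using False c by (simp add: T_def indicator_def)
  qed
  have U0: "0 \<le> U" unfolding U_def by (intro integral_nonneg_AE) (auto intro!: divide_nonneg_nonneg add_nonneg_nonneg)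
  have L: "L2 T" "l2 T \<le> 2 * c * m * U"
  proof -
    note i = L2_indicator_cball[of "2 * c * U" 1, where 'a='a]
    have ae: "AE x in lborel. \<bar>T x\<bar> \<le> \<bar>2 * c * U * indicator (cball 0 1) x\<bar>"
      by (intro AE_I2 order_trans[OF T_le abs_ge_self])
    have Tm': "T \<in> borel_measurable lborel" by measurable
    show "L2 T" by (rule L2_bound(1)[OF i Tm' ae])
    have "l2 T \<le> l2 (\<lambda>x. 2 * c * U * indicator (cball (0::'a) 1) x)" by (rule L2_bound(2)[OF i Tm' ae])
    also have "\<dots> = 2 * c * m * U" using l2_indicator_cball[of "2 * c * U" 1, where 'a='a] c U0 by (simp add: m_def)
    finally show "l2 T \<le> 2 * c * m * U" .
  qed
  show thesis
  proof (rule that[OF L(1)])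
    show "l2 T \<le> 2 * far_const Lam TYPE('a) * sqrt (measure lborel (cball (0::'a) 1)) * (LBINT y. \<bar>z y\<bar> / (1 + norm y powr \<sigma>))"
      using L(2) by (simp add: c_def m_def U_def)
    fix \<psi> :: "'a \<Rightarrow> real"
    assume \<psi>: "C11c \<psi>" "\<And>x. 7/8 \<le> norm x \<Longrightarrow> \<psi> x = 0"
    have [measurable]: "\<psi> \<in> borel_measurable borel" using \<psi>(1) by measurable
    have le: "\<bar>\<psi> x * P x y\<bar> \<le> \<bar>\<psi> x\<bar> * (2 * c * (\<bar>z y\<bar> / (1 + norm y powr \<sigma>)))" for x y
    proof (cases "norm x < 7/8")
      case True
      show ?thesis unfolding abs_mult[of "\<psi> x"] by (intro mult_left_mono P_le[OF True]) simp
    qed (use \<psi>(2) in simp)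
    have \<psi>i: "integrable lborel \<psi>" by (rule C11c_integrable[OF \<psi>(1)])
    have Pm: "(\<lambda>(x, y). \<psi> x * P x y) \<in> borel_measurable (lborel \<Otimes>\<^sub>M lborel)" unfolding P_def by measurable
    have I: "integrable (lborel \<Otimes>\<^sub>M lborel) (\<lambda>(x, y). \<psi> x * P x y)"
    proof (rule Bochner_Integration.integrable_bound[OF _ Pm])
      show "integrable (lborel \<Otimes>\<^sub>M lborel) (\<lambda>(x, y). \<bar>\<psi> x\<bar> * (2 * c * (\<bar>z y\<bar> / (1 + norm y powr \<sigma>))))"
      proof (rule lborel_pair.Fubini_integrable)
        have "(LBINT y. norm (case (x, y) of (x, y) \<Rightarrow> \<bar>\<psi> x\<bar> * (2 * c * (\<bar>z y\<bar> / (1 + norm y powr \<sigma>)))))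
          = \<bar>\<psi> x\<bar> * (2 * c * U)" for x
        proof -
          have "norm (\<bar>\<psi> x\<bar> * (2 * c * (\<bar>z y\<bar> / (1 + norm y powr \<sigma>)))) = (\<bar>\<psi> x\<bar> * (2 * c)) * (\<bar>z y\<bar> / (1 + norm y powr \<sigma>))" for y
            using c by (simp add: abs_mult abs_divide add_nonneg_nonneg)
          then show ?thesis by (simp only: prod.case integral_mult_right_zero U_def mult.assoc)
        qed
        then show "integrable lborel (\<lambda>x. LBINT y. norm (case (x, y) of (x, y) \<Rightarrow> \<bar>\<psi> x\<bar> * (2 * c * (\<bar>z y\<bar> / (1 + norm y powr \<sigma>)))))"
          using \<psi>i by simp
        show "AE x in lborel. integrable lborel (\<lambda>y. case (x, y) of (x, y) \<Rightarrow> \<bar>\<psi> x\<bar> * (2 * c * (\<bar>z y\<bar> / (1 + norm y powr \<sigma>))))"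
          by (intro AE_I2) (simp only: prod.case, intro integrable_mult_right zi)
      qed measurable
      show "AE p in lborel \<Otimes>\<^sub>M lborel. norm (case p of (x, y) \<Rightarrow> \<psi> x * P x y)
        \<le> norm (case p of (x, y) \<Rightarrow> \<bar>\<psi> x\<bar> * (2 * c * (\<bar>z y\<bar> / (1 + norm y powr \<sigma>))))"
        unfolding split_beta real_norm_def by (intro AE_I2 order_trans[OF le abs_ge_self])
    qed
    have e: "(LBINT x. \<psi> x * P x y) = z y * Lop K \<psi> y" for y
    proof (cases "norm y < 1")
      case True then show ?thesis using z0 by (simp add: P_def)
    next
      case False
      then have "Lop K \<psi> y = (LBINT x. \<psi> x * (K (x - y) + K (y - x)))" by (intro Lop_exterior \<psi>) auto
      moreover have "\<psi> x * P x y = z y * (\<psi> x * (K (x - y) + K (y - x)))" for x by (simp add: P_def)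
      ultimately show ?thesis by (simp only: integral_mult_right_zero)
    qed
    have "integrable lborel (\<lambda>y. z y * Lop K \<psi> y)"
      using lborel_pair.integrable_snd[OF I] by (simp add: e)
    moreover have "(LBINT y. z y * Lop K \<psi> y) = (LBINT x. T x * \<psi> x)"
    proof -
      have "(LBINT y. z y * Lop K \<psi> y) = (LBINT x. (LBINT y. \<psi> x * P x y))"
        using lborel_pair.Fubini_integral[OF I] by (simp add: e)
      also have "\<dots> = (LBINT x. T x * \<psi> x)"
        using \<psi>(2) by (intro Bochner_Integration.integral_cong) (auto simp: T_def indicator_def)
      finally show ?thesis .
    qed
    ultimately show "integrable lborel (\<lambda>x. z x * Lop K \<psi> x) \<and> (LBINT x. z x * Lop K \<psi> x) = (LBINT x. T x * \<psi> x)"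
      by blast
  qed
qed

end

section \<open>Borel representatives\<close>

lemma lebesgue_to_lborel:
  fixes F :: "'a::euclidean_space \<Rightarrow> real"
  assumes F: "F \<in> borel_measurable lebesgue" and F0: "F0 \<in> borel_measurable borel" and ae: "AE x in lborel. F x = F0 x"
  shows "integral\<^sup>L lebesgue F = integral\<^sup>L lborel F0" "integrable lebesgue F \<longleftrightarrow> integrable lborel F0"
proof -
  have F0': "F0 \<in> borel_measurable lborel" using F0 by simp
  have F0l: "F0 \<in> borel_measurable lebesgue" using F0' by (rule measurable_completion)
  have ae': "AE x in lebesgue. F x = F0 x" using ae by (rule AE_completion)
  show "integral\<^sup>L lebesgue F = integral\<^sup>L lborel F0"
    using integral_cong_AE[OF F F0l ae'] integral_completion[OF F0'] by simp
  show "integrable lebesgue F \<longleftrightarrow> integrable lborel F0"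
    using integrable_cong_AE[OF F F0l ae'] integrable_completion[OF F0'] by simp
qed

lemma ex_borel_representative:
  fixes F :: "'a::euclidean_space \<Rightarrow> real"
  assumes "F \<in> borel_measurable lebesgue"
  obtains F0 where "F0 \<in> borel_measurable borel" "AE x in lborel. F x = F0 x"
  using completion_ex_borel_measurable_real[OF assms] by auto

text \<open>A Borel version of K satisfies the bounds only almost everywhere, while
  \<open>frac_kernel\<close> asks for them at every point, the origin included. Clamping between the
  two bounds repairs this and changes the kernel only on a null set.\<close>

lemma class_L0_representative:
  fixes K :: "'a::euclidean_space \<Rightarrow> real"
  assumes K: "class_L0 \<sigma> lam Lam K" and \<sigma>: "1 < \<sigma>" "\<sigma> < 2" and lam: "0 < lam" "lam \<le> Lam"
  obtains K0 where "frac_kernel \<sigma> lam Lam K0" "\<And>\<phi> x. \<phi> \<in> borel_measurable borel \<Longrightarrow> intop K \<phi> x = Lop K0 \<phi> x"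
proof -
  have Km: "K \<in> borel_measurable lebesgue" using K by (simp add: class_L0_def)
  obtain J where J[measurable]: "J \<in> borel_measurable borel" and KJ: "AE x in lborel. K x = J x"
    using ex_borel_representative[OF Km] by blast
  define lo where "lo y = (2 - \<sigma>) * lam / norm y powr (real DIM('a) + \<sigma>)" for y :: 'a
  define up where "up y = (2 - \<sigma>) * Lam / norm y powr (real DIM('a) + \<sigma>)" for y :: 'a
  have [measurable]: "lo \<in> borel_measurable borel" "up \<in> borel_measurable borel"
    unfolding lo_def[abs_def] up_def[abs_def] by measurable
  have lu: "lo y \<le> up y" for y
    unfolding lo_def up_def using \<sigma> lam by (intro divide_right_mono mult_left_mono) auto
  define K0 where "K0 y = max (lo y) (min (up y) (J y))" for y
  have [measurable]: "K0 \<in> borel_measurable borel" unfolding K0_def[abs_def] by measurable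
  have "frac_kernel \<sigma> lam Lam K0"
  proof
    show "(2 - \<sigma>) * lam / norm y powr (real DIM('a) + \<sigma>) \<le> K0 y" for y by (simp add: K0_def lo_def)
    show "K0 y \<le> (2 - \<sigma>) * Lam / norm y powr (real DIM('a) + \<sigma>)" for y
      using lu[of y] by (simp add: K0_def up_def)
  qed (use \<sigma> lam in auto)
  moreover have "AE y in lborel. K y = K0 y"
  proof -
    have "AE y in lborel. y \<noteq> (0::'a)" by (rule AE_lborel_singleton)
    then show ?thesis using KJ
    proof eventually_elim
      case (elim y)
      then have "lo y \<le> K y" "K y \<le> up y" using K by (auto simp: class_L0_def lo_def up_def)
      then show ?case using elim by (simp add: K0_def)
    qed
  qed
  then have "intop K \<phi> x = Lop K0 \<phi> x" if [measurable]: "\<phi> \<in> borel_measurable borel" for \<phi> x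
  proof -
    have s: "(\<lambda>y. sdiff \<phi> x y) \<in> borel_measurable lborel" by measurable
    show ?thesis
      unfolding intop_def Lop_def
    proof (rule lebesgue_to_lborel(1))
      show "(\<lambda>y. sdiff \<phi> x y * K y) \<in> borel_measurable lebesgue"
        by (intro borel_measurable_times measurable_completion[OF s] Km)
      show "AE y in lborel. sdiff \<phi> x y * K y = sdiff \<phi> x y * K0 y"
        using \<open>AE y in lborel. K y = K0 y\<close> by eventually_elim simp
    qed measurable
  qed
  ultimately show thesis using that by blast
qed

section \<open>Assembly: splitting at the unit sphere, duality, and return to the completed
  measure\<close>

theorem theorem4p3:
  fixes \<sigma>0 lam Lam C1 :: real
  assumes "1 < \<sigma>0" and "0 < lam" and "lam \<le> Lam"
  shows "\<exists>C. \<forall>(\<sigma>::real) (K :: real^'n \<Rightarrow> real) (K' :: real^'n \<Rightarrow> real)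
              (u :: real^'n \<Rightarrow> real) (f :: real^'n \<Rightarrow> real).
     \<sigma>0 \<le> \<sigma> \<and> \<sigma> < 2 \<and> class_L1 C1 \<sigma> lam Lam K \<and> class_L0 \<sigma> lam Lam K' \<and>
     in_wL1 \<sigma> u \<and> in_L2_on (ball 0 1) f \<and> dist_solves K u 1 f \<longrightarrow>
     (\<exists>g. in_L2_on (ball 0 (1/2)) g \<and> dist_solves K' u (1/2) g \<and>
          L2_norm_on (ball 0 (1/2)) g \<le> C * (wnorm \<sigma> u + L2_norm_on (ball 0 1) f))"
proof (rule interior_bound[OF assms(2), of Lam, where 'a="real^'n"])
  fix C :: real
  assume C: "0 \<le> C" and bound: "\<And>\<sigma> (K :: real^'n \<Rightarrow> real) K' v g \<phi>.
      frac_kernel \<sigma> lam Lam K \<Longrightarrow> frac_kernel \<sigma> lam Lam K' \<Longrightarrow> integrable lborel v \<Longrightarrow>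
      L2 g \<Longrightarrow> (\<And>\<psi>. test_fun (7/8) \<psi> \<Longrightarrow> (LBINT x. v x * Lop K \<psi> x) = (LBINT x. g x * \<psi> x)) \<Longrightarrow>
      C11c \<phi> \<Longrightarrow> (\<And>x. 1/2 \<le> norm x \<Longrightarrow> \<phi> x = 0) \<Longrightarrow>
      \<bar>LBINT x. v x * Lop K' \<phi> x\<bar> \<le> C * (l2 g + l1 v) * l2 \<phi>"
  define ct where "ct = 2 * far_const Lam TYPE(real^'n) * sqrt (measure lborel (cball (0::real^'n) 1))"
  have ct: "0 \<le> ct" by (simp add: ct_def far_const_def)
  show ?thesis
  \<comment> \<open>The sum of the coefficient C ct + 2 C + ct of the weighted norm and the
    coefficient C of the norm of f in the final estimate.\<close>
  proof (rule exI[of _ "C * ct + 2 * C + ct + C"], intro allI impI, elim conjE)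
    fix \<sigma> :: real and K K' u f :: "real^'n \<Rightarrow> real"
    assume \<sigma>: "\<sigma>0 \<le> \<sigma>" "\<sigma> < 2" and K: "class_L1 C1 \<sigma> lam Lam K" and K': "class_L0 \<sigma> lam Lam K'"
      and u: "in_wL1 \<sigma> u" and f: "in_L2_on (ball 0 1) f" and sol: "dist_solves K u 1 f"
    have \<sigma>1: "1 < \<sigma>" using \<sigma> assms(1) by simp
    obtain J where J: "frac_kernel \<sigma> lam Lam J" "\<And>\<phi> x. \<phi> \<in> borel_measurable borel \<Longrightarrow> intop K \<phi> x = Lop J \<phi> x"
      using class_L0_representative[of \<sigma> lam Lam K] K \<sigma>1 \<sigma>(2) assms(2,3) by (auto simp: class_L1_def)
    obtain J' where J': "frac_kernel \<sigma> lam Lam J'" "\<And>\<phi> x. \<phi> \<in> borel_measurable borel \<Longrightarrow> intop K' \<phi> x = Lop J' \<phi> x"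
      using class_L0_representative[OF K' \<sigma>1 \<sigma>(2) assms(2,3)] by blast
    interpret J: frac_kernel \<sigma> lam Lam J by fact
    interpret J': frac_kernel \<sigma> lam Lam J' by fact
    have [measurable]: "ball (0::real^'n) r \<in> sets borel" for r by simp
    have um: "u \<in> borel_measurable lebesgue" using u by (simp add: in_wL1_def)
    obtain u0 where u0[measurable]: "u0 \<in> borel_measurable borel" and uu: "AE x in lborel. u x = u0 x"
      using ex_borel_representative[OF um] by blast
    \<comment> \<open>Measurability of f is known on the ball only, so the product with the
      indicator is replaced by a Borel function; f0 then vanishes almost everywhere outside the
      ball.\<close>
    have fm: "(\<lambda>x. indicator (ball 0 1) x * f x) \<in> borel_measurable lebesgue"
      using f by (simp add: in_L2_on_def set_borel_measurable_def)
    obtain f0 where f0[measurable]: "f0 \<in> borel_measurable borel"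
      and ff: "AE x in lborel. indicator (ball 0 1) x * f x = f0 x"
      using ex_borel_representative[OF fm] by blast
    define wt where "wt y = 1 + norm y powr \<sigma>" for y :: "real^'n"
    have wt: "1 \<le> wt y" for y by (simp add: wt_def)
    have [measurable]: "wt \<in> borel_measurable borel" unfolding wt_def[abs_def] by measurable
    define U where "U = (LBINT y. \<bar>u0 y\<bar> / wt y)"
    have Ui: "integrable lborel (\<lambda>y. \<bar>u0 y\<bar> / wt y)" and U: "wnorm \<sigma> u = U"
    proof -
      have m: "(\<lambda>y. \<bar>u y\<bar> / wt y) \<in> borel_measurable lebesgue"
        using u by (auto simp: in_wL1_def wt_def)
      have m0: "(\<lambda>y. \<bar>u0 y\<bar> / wt y) \<in> borel_measurable borel" by measurable
      have ae: "AE y in lborel. \<bar>u y\<bar> / wt y = \<bar>u0 y\<bar> / wt y" using uu by eventually_elim simp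
      show "integrable lborel (\<lambda>y. \<bar>u0 y\<bar> / wt y)" "wnorm \<sigma> u = U"
        using u lebesgue_to_lborel[OF m m0 ae] by (auto simp: in_wL1_def wnorm_def U_def wt_def)
    qed
    have U0: "0 \<le> U" unfolding U_def using wt by (intro integral_nonneg_AE AE_I2 divide_nonneg_nonneg) (auto intro: order_trans[of 0 1])
    have fL2: "L2 f0" and fn: "L2_norm_on (ball 0 1) f = l2 f0"
    proof -
      have e: "indicator (ball 0 1) x *\<^sub>R (f x)\<^sup>2 = (indicator (ball 0 1) x * f x)\<^sup>2" for x
        by (simp add: indicator_def)
      have m: "(\<lambda>x. indicator (ball 0 1) x *\<^sub>R (f x)\<^sup>2) \<in> borel_measurable lebesgue"
        unfolding e using fm by (rule borel_measurable_power)
      have m0: "(\<lambda>x. (f0 x)\<^sup>2) \<in> borel_measurable borel" by measurable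
      have ae: "AE x in lborel. indicator (ball 0 1) x *\<^sub>R (f x)\<^sup>2 = (f0 x)\<^sup>2"
        unfolding e using ff by eventually_elim simp
      show "L2 f0" "L2_norm_on (ball 0 1) f = l2 f0"
        using f lebesgue_to_lborel[OF m m0 ae]
        by (auto simp: in_L2_on_def set_integrable_def L2_norm_on_def set_lebesgue_integral_def L2_in_def norm2_def)
    qed
    have sol0: "(LBINT x. u0 x * Lop J \<phi> x) = (LBINT x. f0 x * \<phi> x)" if t: "test_fun 1 \<phi>" for \<phi>
    proof -
      have \<phi>[measurable]: "\<phi> \<in> borel_measurable borel" using test_fun_C11c[OF t] by measurable
      have l: "Lop J \<phi> \<in> borel_measurable lborel" "\<phi> \<in> borel_measurable lborel" by measurable
      have "(LINT x|lebesgue. u x * intop K \<phi> x) = (LBINT x. u0 x * Lop J \<phi> x)"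
        unfolding J(2)[OF \<phi>]
        by (rule lebesgue_to_lborel(1))
          (use uu in \<open>auto intro!: borel_measurable_times um measurable_completion[OF l(1)] elim!: eventually_mono\<close>)
      moreover have "(LINT x:ball 0 1|lebesgue. f x * \<phi> x) = (LBINT x. f0 x * \<phi> x)"
        unfolding set_lebesgue_integral_def
      proof (rule lebesgue_to_lborel(1))
        have "(\<lambda>x. (indicator (ball 0 1) x * f x) * \<phi> x) \<in> borel_measurable lebesgue"
          by (intro borel_measurable_times fm measurable_completion[OF l(2)])
        then show "(\<lambda>x. indicator (ball 0 1) x *\<^sub>R (f x * \<phi> x)) \<in> borel_measurable lebesgue"
          by (simp add: mult.assoc)
        show "AE x in lborel. indicator (ball 0 1) x *\<^sub>R (f x * \<phi> x) = f0 x * \<phi> x"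
          using ff by eventually_elim (simp add: mult.assoc[symmetric])
      qed measurable
      ultimately show ?thesis using sol t by (simp add: dist_solves_def)
    qed
    define v where "v x = indicator (ball 0 1) x * u0 x" for x
    define z where "z x = u0 x - v x" for x
    have [measurable]: "v \<in> borel_measurable borel" unfolding v_def[abs_def] by measurable
    have zm[measurable]: "z \<in> borel_measurable borel" unfolding z_def[abs_def] by measurable
    \<comment> \<open>On the unit ball the weight 1 + |x|^\<sigma> is at most 2; this is the origin
      of the term 2 C in the constant.\<close>
    have v_le: "\<bar>v x\<bar> \<le> 2 * (\<bar>u0 x\<bar> / wt x)" for x
    proof (cases "norm x < 1")
      case True
      have "norm x powr \<sigma> \<le> 1 powr \<sigma>" using True \<sigma>1 by (intro powr_mono2) auto
      then have "wt x \<le> 2" by (simp add: wt_def)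
      then have "\<bar>u0 x\<bar> * wt x \<le> \<bar>u0 x\<bar> * 2" by (intro mult_left_mono) auto
      then have "\<bar>u0 x\<bar> \<le> 2 * (\<bar>u0 x\<bar> / wt x)" using wt[of x] by (simp add: pos_le_divide_eq mult.commute)
      then show ?thesis using True by (simp add: v_def)
    next
      case False then show ?thesis using wt[of x] by (simp add: v_def)
    qed
    have Ui2: "integrable lborel (\<lambda>x. 2 * (\<bar>u0 x\<bar> / wt x))" by (intro integrable_mult_right Ui)
    have vi: "integrable lborel v"
      proof (rule Bochner_Integration.integrable_bound[OF Ui2])
      show "AE x in lborel. norm (v x) \<le> norm (2 * (\<bar>u0 x\<bar> / wt x))"
        unfolding real_norm_def by (intro AE_I2 order_trans[OF v_le abs_ge_self])
    qed measurable
    have v1: "l1 v \<le> 2 * U"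
    proof -
      have "l1 v \<le> (LBINT x. 2 * (\<bar>u0 x\<bar> / wt x))"
        using vi Ui2 v_le by (intro integral_mono) auto
      then show ?thesis by (simp only: integral_mult_right_zero U_def)
    qed
    have z_le: "\<bar>z x\<bar> / wt x \<le> \<bar>u0 x\<bar> / wt x" for x
      using wt[of x] by (intro divide_right_mono) (auto simp: z_def v_def indicator_def)
    have zi: "integrable lborel (\<lambda>x. \<bar>z x\<bar> / wt x)"
    proof (rule Bochner_Integration.integrable_bound[OF Ui])
      show "AE x in lborel. norm (\<bar>z x\<bar> / wt x) \<le> norm (\<bar>u0 x\<bar> / wt x)"
      proof (rule AE_I2)
        fix x
        have "0 \<le> \<bar>z x\<bar> / wt x" using wt[of x] by simp
        then show "norm (\<bar>z x\<bar> / wt x) \<le> norm (\<bar>u0 x\<bar> / wt x)"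
          unfolding real_norm_def using order_trans[OF z_le abs_ge_self, of x] by (simp only: abs_of_nonneg)
      qed
    qed measurable
    have zU: "(LBINT x. \<bar>z x\<bar> / wt x) \<le> U"
      unfolding U_def by (intro integral_mono zi Ui z_le)
    have z0: "z y = 0" if "norm y < 1" for y using that by (simp add: z_def v_def)
    obtain T where T: "L2 T" "l2 T \<le> ct * (LBINT y. \<bar>z y\<bar> / wt y)"
      "\<And>\<psi>. C11c \<psi> \<Longrightarrow> (\<And>x. 7/8 \<le> norm x \<Longrightarrow> \<psi> x = 0) \<Longrightarrow>
       integrable lborel (\<lambda>x. z x * Lop J \<psi> x) \<and> (LBINT x. z x * Lop J \<psi> x) = (LBINT x. T x * \<psi> x)"
      using J.exterior_contribution[OF zm zi[unfolded wt_def] z0] unfolding ct_def wt_def by blast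
    obtain T' where T': "L2 T'" "l2 T' \<le> ct * (LBINT y. \<bar>z y\<bar> / wt y)"
      "\<And>\<psi>. C11c \<psi> \<Longrightarrow> (\<And>x. 7/8 \<le> norm x \<Longrightarrow> \<psi> x = 0) \<Longrightarrow>
       integrable lborel (\<lambda>x. z x * Lop J' \<psi> x) \<and> (LBINT x. z x * Lop J' \<psi> x) = (LBINT x. T' x * \<psi> x)"
      using J'.exterior_contribution[OF zm zi[unfolded wt_def] z0] unfolding ct_def wt_def by blast
    have TU: "l2 T \<le> ct * U" "l2 T' \<le> ct * U"
      using T(2) T'(2) mult_left_mono[OF zU ct] by linarith+
    have vL: "integrable lborel (\<lambda>x. v x * Lop I \<phi> x)" if I: "frac_kernel \<sigma> lam Lam I" and \<phi>: "C11c \<phi>" for I \<phi>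
    proof -
      interpret I: frac_kernel \<sigma> lam Lam I by fact
      obtain N where N: "C11 N \<phi>" using \<phi> by (auto simp: C11c_def)
      have [measurable]: "\<phi> \<in> borel_measurable borel" using \<phi> by measurable
      show ?thesis by (rule integrable_mult_bounded(1)[OF vi _ I.Lop_bound[OF N]]) measurable
    qed
    \<comment> \<open>The source that v sees: subtracting the exterior part z from u moves its
      contribution to the right-hand side.\<close>
    define g where "g x = f0 x - T x" for x
    have gL2: "L2 g" unfolding g_def[abs_def] by (rule L2_diff[OF fL2 T(1)])
    have gn: "l2 g \<le> l2 f0 + ct * U"
      unfolding g_def[abs_def] using l2_diff_le[OF fL2 T(1)] TU(1) by linarith
    have vsol: "(LBINT x. v x * Lop J \<psi> x) = (LBINT x. g x * \<psi> x)" if t: "test_fun (7/8) \<psi>" for \<psi>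
    proof -
      have \<psi>: "C11c \<psi>" "\<And>x. 7/8 \<le> norm x \<Longrightarrow> \<psi> x = 0"
        using test_fun_C11c[OF t] test_fun_zero[OF t] by auto
      have t1: "test_fun 1 \<psi>" using t unfolding test_fun_def by auto
      note TT = T(3)[OF \<psi>]
      have "(LBINT x. v x * Lop J \<psi> x) = (LBINT x. u0 x * Lop J \<psi> x - z x * Lop J \<psi> x)"
        by (simp add: z_def algebra_simps)
      also have "\<dots> = (LBINT x. u0 x * Lop J \<psi> x) - (LBINT x. z x * Lop J \<psi> x)"
      proof (rule Bochner_Integration.integral_diff)
        \<comment> \<open>Integrability of the pairing with u0 is regained from its two pieces, the
          integrable v and the exterior z.\<close>
        have "integrable lborel (\<lambda>x. v x * Lop J \<psi> x + z x * Lop J \<psi> x)" using vL[OF J(1) \<psi>(1)] TT by simp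
        then show "integrable lborel (\<lambda>x. u0 x * Lop J \<psi> x)" by (simp add: z_def algebra_simps)
      qed (use TT in blast)
      also have "\<dots> = (LBINT x. f0 x * \<psi> x) - (LBINT x. T x * \<psi> x)" using sol0[OF t1] TT by simp
      also have "\<dots> = (LBINT x. g x * \<psi> x)"
        using L2_mult_integrable[OF fL2 C11c_L2[OF \<psi>(1)]] L2_mult_integrable[OF T(1) C11c_L2[OF \<psi>(1)]]
        by (simp add: g_def left_diff_distrib)
      finally show ?thesis .
    qed
    \<comment> \<open>C11 functions vanishing off the ball of radius 1/2 contain the test functions
      and are visibly closed under linear combinations; the interior bound holds for all of
      them.\<close>
    define V where "V = {\<phi> :: real^'n \<Rightarrow> real. C11c \<phi> \<and> (\<forall>x. 1/2 \<le> norm x \<longrightarrow> \<phi> x = 0)}"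
    define A where "A = C * (l2 g + l1 v)"
    have A0: "0 \<le> A" using C by (simp add: A_def)
    have "\<exists>g1. L2 g1 \<and> l2 g1 \<le> A \<and> (\<forall>\<phi>\<in>V. (LBINT x. g1 x * \<phi> x) = (LBINT x. v x * Lop J' \<phi> x))"
    proof (rule L2_riesz)
      show "L2 \<phi>" if "\<phi> \<in> V" for \<phi> using that C11c_L2[of \<phi>] by (simp add: V_def)
      have "C11c (\<lambda>x::real^'n. 0)"
        using C11_const[of 0, where 'a="real^'n"] by (auto simp: C11c_def bsupp_def)
      then have "(\<lambda>x. 0) \<in> V" by (simp add: V_def)
      then show "V \<noteq> {}" by blast
      show "(\<lambda>x. \<phi> x + c * \<psi> x) \<in> V" if "\<phi> \<in> V" "\<psi> \<in> V" for \<phi> \<psi> c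
        using that C11c_lin[of \<phi> \<psi> c] by (simp add: V_def)
      show "(LBINT x. v x * Lop J' (\<lambda>x. \<phi> x + c * \<psi> x) x)
        = (LBINT x. v x * Lop J' \<phi> x) + c * (LBINT x. v x * Lop J' \<psi> x)" if "\<phi> \<in> V" "\<psi> \<in> V" for \<phi> \<psi> c
      proof -
        have c: "C11c \<phi>" "C11c \<psi>" using that by (auto simp: V_def)
        then obtain M N where MN: "C11 M \<phi>" "C11 N \<psi>" by (auto simp: C11c_def)
        have "v x * Lop J' (\<lambda>x. \<phi> x + c * \<psi> x) x = v x * Lop J' \<phi> x + c * (v x * Lop J' \<psi> x)" for x
          unfolding J'.Lop_lin[OF MN] by (simp add: algebra_simps)
        then show ?thesis using vL[OF J'(1) c(1)] vL[OF J'(1) c(2)] by simp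
      qed
      show "\<bar>LBINT x. v x * Lop J' \<phi> x\<bar> \<le> A * l2 \<phi>" if "\<phi> \<in> V" for \<phi>
        unfolding A_def using that by (intro bound[OF J(1) J'(1) vi gL2 vsol]) (auto simp: V_def)
    qed (rule A0)
    then obtain g1 where g1: "L2 g1" "l2 g1 \<le> A"
      "\<And>\<phi>. \<phi> \<in> V \<Longrightarrow> (LBINT x. g1 x * \<phi> x) = (LBINT x. v x * Lop J' \<phi> x)" by blast
    \<comment> \<open>The second operator acting on u: g1 represents its action on v by duality, T'
      is its explicit action on the exterior part.\<close>
    define G where "G x = g1 x + T' x" for x
    have GL2: "L2 G" unfolding G_def[abs_def] by (rule L2_add[OF g1(1) T'(1)])
    have [measurable]: "G \<in> borel_measurable borel" using GL2 by auto
    have Gn: "l2 G \<le> A + ct * U"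
      unfolding G_def[abs_def] using l2_sum_le[OF g1(1) T'(1)] g1(2) TU(2) by linarith
    \<comment> \<open>G is square-integrable on the whole space; its restriction H has the norm that
      the claim on the half ball measures.\<close>
    define H where "H = (\<lambda>x. indicator (ball 0 (1/2)) x * G x)"
    have [measurable]: "H \<in> borel_measurable borel" unfolding H_def by measurable
    have HL2: "L2 H" "l2 H \<le> l2 G"
    proof -
      have ae: "AE x in lborel. \<bar>H x\<bar> \<le> \<bar>G x\<bar>" by (simp add: H_def indicator_def)
      have m: "H \<in> borel_measurable lborel" by measurable
      show "L2 H" "l2 H \<le> l2 G" using L2_bound[OF GL2 m ae] by auto
    qed
    show "\<exists>g. in_L2_on (ball 0 (1/2)) g \<and> dist_solves K' u (1/2) g \<and>
          L2_norm_on (ball 0 (1/2)) g \<le> (C * ct + 2 * C + ct + C) * (wnorm \<sigma> u + L2_norm_on (ball 0 1) f)"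
    proof (intro exI conjI)
      have e: "(\<lambda>x. indicator (ball 0 (1/2)) x *\<^sub>R (G x)\<^sup>2) = (\<lambda>x. (H x)\<^sup>2)"
        by (auto simp: H_def indicator_def)
      have H2: "(\<lambda>x. (H x)\<^sup>2) \<in> borel_measurable lborel" by measurable
      have Hl: "H \<in> borel_measurable lborel" by measurable
      show "in_L2_on (ball 0 (1/2)) G"
        unfolding in_L2_on_def set_borel_measurable_def set_integrable_def e
        using measurable_completion[OF Hl] HL2(1) integrable_completion[OF H2] by (simp add: H_def L2_in_def)
      have "L2_norm_on (ball 0 (1/2)) G = l2 H"
        unfolding L2_norm_on_def set_lebesgue_integral_def e norm2_def using integral_completion[OF H2] by simp
      also have "\<dots> \<le> A + ct * U" using HL2(2) Gn by simp
      also have "A \<le> C * ((l2 f0 + ct * U) + 2 * U)"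
        unfolding A_def using gn v1 C by (intro mult_left_mono add_mono) auto
      also have "C * ((l2 f0 + ct * U) + 2 * U) + ct * U \<le> (C * ct + 2 * C + ct + C) * (U + l2 f0)"
      proof -
        have "C * ((l2 f0 + ct * U) + 2 * U) + ct * U + (C * ct + 2 * C + ct) * l2 f0 + C * U
          = (C * ct + 2 * C + ct + C) * (U + l2 f0)" by (simp add: algebra_simps)
        moreover have "0 \<le> (C * ct + 2 * C + ct) * l2 f0" "0 \<le> C * U" using C ct U0 by auto
        ultimately show ?thesis by linarith
      qed
      finally show "L2_norm_on (ball 0 (1/2)) G \<le> (C * ct + 2 * C + ct + C) * (wnorm \<sigma> u + L2_norm_on (ball 0 1) f)"
        by (simp add: U fn)
      show "dist_solves K' u (1/2) G"
        unfolding dist_solves_def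
      proof (intro allI impI)
        fix \<phi> :: "real^'n \<Rightarrow> real" assume t: "test_fun (1/2) \<phi>"
        have \<phi>: "C11c \<phi>" "\<And>x. 1/2 \<le> norm x \<Longrightarrow> \<phi> x = 0"
          using test_fun_C11c[OF t] test_fun_zero[OF t] by auto
        have \<phi>m[measurable]: "\<phi> \<in> borel_measurable borel" using \<phi>(1) by measurable
        have TT: "integrable lborel (\<lambda>x. z x * Lop J' \<phi> x)" "(LBINT x. z x * Lop J' \<phi> x) = (LBINT x. T' x * \<phi> x)"
          using T'(3)[OF \<phi>(1)] \<phi>(2) by auto
        note vv = vL[OF J'(1) \<phi>(1)]
        have eq: "u0 x * Lop J' \<phi> x = v x * Lop J' \<phi> x + z x * Lop J' \<phi> x" for x by (simp add: z_def algebra_simps)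
        have i: "integrable lborel (\<lambda>x. u0 x * Lop J' \<phi> x)" unfolding eq using vv TT by simp
        have "(LBINT x. u0 x * Lop J' \<phi> x) = (LBINT x. g1 x * \<phi> x) + (LBINT x. T' x * \<phi> x)"
          unfolding eq using vv TT g1(3)[of \<phi>] \<phi> by (simp add: V_def)
        also have "\<dots> = (LBINT x. G x * \<phi> x)"
          using L2_mult_integrable[OF g1(1) C11c_L2[OF \<phi>(1)]] L2_mult_integrable[OF T'(1) C11c_L2[OF \<phi>(1)]]
          by (simp add: G_def distrib_right)
        finally have 1: "(LBINT x. u0 x * Lop J' \<phi> x) = (LBINT x. G x * \<phi> x)" .
        have l: "Lop J' \<phi> \<in> borel_measurable lborel" by measurable
        have um': "(\<lambda>x. u x * Lop J' \<phi> x) \<in> borel_measurable lebesgue"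
          by (intro borel_measurable_times um measurable_completion[OF l])
        have ae: "AE x in lborel. u x * Lop J' \<phi> x = u0 x * Lop J' \<phi> x" using uu by eventually_elim simp
        have m0: "(\<lambda>x. u0 x * Lop J' \<phi> x) \<in> borel_measurable borel" by measurable
        note c = lebesgue_to_lborel[OF um' m0 ae]
        have "(\<lambda>x. indicator (ball 0 (1/2)) x *\<^sub>R (G x * \<phi> x)) = (\<lambda>x. G x * \<phi> x)"
        proof
          fix x
          show "indicator (ball 0 (1/2)) x *\<^sub>R (G x * \<phi> x) = G x * \<phi> x"
            using \<phi>(2)[of x] by (cases "norm x < 1/2") auto
        qed
        moreover have "(\<lambda>x. G x * \<phi> x) \<in> borel_measurable lborel" by measurable
        ultimately have "(LINT x:ball 0 (1/2)|lebesgue. G x * \<phi> x) = (LBINT x. G x * \<phi> x)"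
          unfolding set_lebesgue_integral_def by (simp add: integral_completion)
        then show "integrable lebesgue (\<lambda>x. u x * intop K' \<phi> x) \<and>
          (LINT x|lebesgue. u x * intop K' \<phi> x) = (LINT x:ball 0 (1/2)|lebesgue. G x * \<phi> x)"
          unfolding J'(2)[OF \<phi>m] using c i 1 by simp
      qed
    qed
  qed
qed

end
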